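(* Let $d\geqslant 1$ be an integer, let $p\in\{d,d+1\}$, and let $s>0$ with $s\in [p-2, d)$. Let $A\subset \mathbb{R}^{p}$ be a compact set of positive $s$-capacity and let $\mu_s$ be the $s$-equilibrium measure on $A$. If $A$ is $(d, C^\infty)$-smooth at a point $x_0\in A$, then $\mu_s$ is upper $d$-regular at $x_0$; i.e., there is a constant $c(x_0)$ such that $\mu_s(B(x_0,r))\leqslant c(x_0)\,r^d$ for every $r>0$.
   Context: Measures are finite nonnegative Borel measures; $B(x,r):=\{y\in\mathbb{R}^p: |y-x|<r\}$. For a measure $\mu$ supported on a compact set $A$, $U_s^\mu(x):=\int_A |x-y|^{-s}\,d\mu(y)$ and $I_s[\mu]:=\int_A U_s^\mu(x)\,d\mu(x)$. The $s$-Wiener constant is $W_s(A):=\inf I_s[\mu]$ over all probability measures $\mu$ supported on $A$, and $\mathrm{cap}_s(A):=1/W_s(A)$; positive $s$-capacity means $W_s(A)<\infty$. In that case there is a unique probability measure $\mu_s$ supported on $A$ attaining $W_s(A)$, called the $s$-equilibrium measure on $A$. A set $E\subset\mathbb{R}^p$ (bounded) is $d$-regular if for some measure $\lambda$ supported on $E$ there is a positive constant $C_0$ such that $C_0^{-1}r^d\leqslant \lambda(B(x,r))\leqslant C_0r^d$ for all $x\in E$ and $0<r<\mathrm{diam}(E)$. A compact set $A$ is $d$-regular at $x\in A$ if for some $r_1>0$ the set $A\cap B(x,r_1)$ is $d$-regular. Let $A\subset\mathbb{R}^p$ be a compact set that is $d$-regular at a point $x_0\in A$. Then $A$ is $(d,C^\infty)$-smooth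 at $x_0$ if there exist $r_0>0$ and a $C^\infty$-smooth invertible function $\varphi: B(x_0,r_0)\cap A\to\mathbb{R}^d$ (invertible onto its image) such that $\varphi(B(x_0,r_0)\cap A)$ is open in $\mathbb{R}^d$ and $\varphi^{-1}$ is also $C^\infty$-smooth. *)

theory Defs
  imports "HOL-Analysis.Analysis"
begin

text \<open>Being supported on \<open>A\<close> means that the complement of \<open>A\<close> is null. No closedness is built in,
  because it is also used for sets of the form \<open>A \<inter> ball x r\<close>.\<close>

definition fin_borel_measure_on :: "(real ^ 'p) set \<Rightarrow> (real ^ 'p) measure \<Rightarrow> bool" where
  "fin_borel_measure_on A \<mu> \<longleftrightarrow> sets \<mu> = sets borel \<and> finite_measure \<mu> \<and> (AE y in \<mu>. y \<in> A)"

definition prob_measure_on :: "(real ^ 'p) set \<Rightarrow> (real ^ 'p) measure \<Rightarrow> bool" where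
  "prob_measure_on A \<mu> \<longleftrightarrow> fin_borel_measure_on A \<mu> \<and> emeasure \<mu> UNIV = 1"

text \<open>The value on the diagonal is \<open>\<infinity>\<close>; the real-valued \<open>0 powr (- s)\<close> would be \<open>0\<close>.\<close>

definition riesz_kernel :: "real \<Rightarrow> real ^ 'p \<Rightarrow> real ^ 'p \<Rightarrow> ennreal" where
  "riesz_kernel s x y = (if x = y then \<infinity> else ennreal (norm (x - y) powr (- s)))"

definition riesz_potential :: "real \<Rightarrow> (real ^ 'p) set \<Rightarrow> (real ^ 'p) measure \<Rightarrow> real ^ 'p \<Rightarrow> ennreal" where
  "riesz_potential s A \<mu> x = (\<integral>\<^sup>+ y\<in>A. riesz_kernel s x y \<partial>\<mu>)"

definition riesz_energy :: "real \<Rightarrow> (real ^ 'p) set \<Rightarrow> (real ^ 'p) measure \<Rightarrow> ennreal" where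
  "riesz_energy s A \<mu> = (\<integral>\<^sup>+ x\<in>A. riesz_potential s A \<mu> x \<partial>\<mu>)"

definition wiener_const :: "real \<Rightarrow> (real ^ 'p) set \<Rightarrow> ennreal" where
  "wiener_const s A = (INF \<mu>\<in>{\<mu>. prob_measure_on A \<mu>}. riesz_energy s A \<mu>)"

text \<open>In \<^typ>\<open>ennreal\<close>, \<open>1 / \<infinity> = 0\<close>, so positive capacity is \<open>wiener_const s A < \<infinity>\<close>.\<close>

definition riesz_capacity :: "real \<Rightarrow> (real ^ 'p) set \<Rightarrow> ennreal" where
  "riesz_capacity s A = 1 / wiener_const s A"

text \<open>Stated as a predicate rather than by a definite description: for compact \<open>A\<close> of positive
  \<open>s\<close>-capacity there is exactly one such measure.\<close>

definition equilibrium_measure :: "real \<Rightarrow> (real ^ 'p) set \<Rightarrow> (real ^ 'p) measure \<Rightarrow> bool" where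
  "equilibrium_measure s A \<mu> \<longleftrightarrow> prob_measure_on A \<mu> \<and> riesz_energy s A \<mu> = wiener_const s A"

definition d_regular :: "nat \<Rightarrow> (real ^ 'p) set \<Rightarrow> bool" where
  "d_regular d E \<longleftrightarrow> bounded E \<and>
     (\<exists>\<nu>. fin_borel_measure_on E \<nu> \<and>
       (\<exists>C0>0. \<forall>x\<in>E. \<forall>r. 0 < r \<and> r < diameter E \<longrightarrow>
          inverse C0 * r ^ d \<le> measure \<nu> (ball x r) \<and> measure \<nu> (ball x r) \<le> C0 * r ^ d))"

definition d_regular_at :: "nat \<Rightarrow> (real ^ 'p) set \<Rightarrow> real ^ 'p \<Rightarrow> bool" where
  "d_regular_at d A x \<longleftrightarrow> compact A \<and> x \<in> A \<and> (\<exists>r1>0. d_regular d (A \<inter> ball x r1))"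

text \<open>For open \<open>S\<close>, the following is \<open>C\<^sup>n\<close>: all directional derivatives of order at most \<open>n\<close> exist
  and are continuous on \<open>S\<close>. It is meant for open \<open>S\<close> only.\<close>

primrec Ck_on :: "nat \<Rightarrow> 'a::real_normed_vector set \<Rightarrow> ('a \<Rightarrow> 'b::real_normed_vector) \<Rightarrow> bool" where
  "Ck_on 0 S f \<longleftrightarrow> continuous_on S f"
| "Ck_on (Suc n) S f \<longleftrightarrow>
     (\<forall>x\<in>S. f differentiable (at x)) \<and> (\<forall>v. Ck_on n S (\<lambda>x. frechet_derivative f (at x) v))"

text \<open>On an arbitrary subset \<open>S\<close>, \<open>C\<^sup>\<infinity>\<close>-smoothness means that locally there is a \<open>C\<^sup>\<infinity>\<close> extension to an
  open set of the ambient space. If \<open>S\<close> is open this is ordinary \<open>C\<^sup>\<infinity>\<close>-smoothness.\<close>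

definition Cinf_on :: "'a::real_normed_vector set \<Rightarrow> ('a \<Rightarrow> 'b::real_normed_vector) \<Rightarrow> bool" where
  "Cinf_on S f \<longleftrightarrow>
     (\<forall>x\<in>S. \<exists>U g. open U \<and> x \<in> U \<and> (\<forall>n. Ck_on n U g) \<and> (\<forall>y\<in>S \<inter> U. g y = f y))"

text \<open>\<open>(d, C\<^sup>\<infinity>)\<close>-smoothness at \<open>x0\<close>, with \<open>d = CARD('d)\<close>.\<close>

definition dCinf_smooth_at :: "'d::finite itself \<Rightarrow> (real ^ 'p) set \<Rightarrow> real ^ 'p \<Rightarrow> bool" where
  "dCinf_smooth_at _ A x0 \<longleftrightarrow> d_regular_at CARD('d) A x0 \<and>
     (\<exists>r0>0. \<exists>\<phi> :: real ^ 'p \<Rightarrow> real ^ 'd.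
        let V = ball x0 r0 \<inter> A in
          inj_on \<phi> V \<and> Cinf_on V \<phi> \<and> open (\<phi> ` V) \<and> Cinf_on (\<phi> ` V) (inv_into V \<phi>))"

end

(*
  Idea. Write U for the potential of the equilibrium measure mu and W for the Wiener constant.
  Varying mu gives U <= W on its support and, by averaging over small balls of the regular measure,
  U >= W on A near x0. Extend U to the half-space t >= 0 by
    u(x,t) = integral of (|x-y|^2 + t)^(-s/2) d mu(y),
  where t is the square of the height (the Caffarelli-Silvestre extension). Off A x {0} it satisfies
    Lap_x u + 4 t u_tt + 2 alpha u_t = 0   with alpha = s + 2 - p >= 0,
  for which a minimum principle holds. Near x0 an explicit supersolution b with
  b(x0,t) = O(t^((d-s)/2)) then gives u(x0,t) >= W - O(t^((d-s)/2)).
  On the other hand U(x0) - u(x0,r^2) >= c r^(-s) mu(B(x0,r)). As U(x0) <= W, comparing the two at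
  t = r^2 gives mu(B(x0,r)) = O(r^s r^(d-s)).
*)

theory Submission
  imports Defs "HOL-Probability.Probability"
begin

text \<open>With \<open>t\<close> as squared height the extended kernel is smooth across
  \<open>t = 0\<close> away from its pole, and the coefficient \<open>4 * t\<close> of the equation
  vanishes there. Bottom points off \<open>A\<close> can therefore be treated like interior points,
  without a boundary condition. What survives at \<open>t = 0\<close> is the one-sided term with
  coefficient \<open>2 * \<alpha>\<close>; its sign, and hence the minimum principle, is the
  hypothesis that \<open>s\<close> is at least \<open>p - 2\<close>. The potential need not be
  continuous up to \<open>A\<close>. So a minimum is found by lower semicontinuity alone, and it is
  tested with finite differences: a one-sided third-order estimate for the kernel can be integrated
  over \<mu>, with no differentiation under the integral. With \<gamma> denoting
  \<open>d - s\<close>, the power \<open>a\<close> of \<open>t\<close>, or of the squared distance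
  to a flat hypersurface, is mapped to \<open>2 * a * (2 * a - \<gamma>)\<close> times the power
  \<open>a - 1\<close>. Thus \<open>\<gamma> / 2\<close> is critical and a slightly higher power
  must be subtracted for strictness. The increment \<open>1/4\<close> is below \<open>1/2\<close> so
  that this gain beats the errors caused by curvature.\<close>

section \<open>The Riesz kernel and its extension to a half-space\<close>

text \<open>The argument \<open>q\<close> is a squared distance; \<open>inverse 0 = \<infinity>\<close> in \<^typ>\<open>ennreal\<close> gives the value at \<open>0\<close>.\<close>

definition rkern :: "real \<Rightarrow> real \<Rightarrow> ennreal" where
  "rkern s q = inverse (ennreal (q powr (s/2)))"

text \<open>The variable \<open>t\<close> is the square of the distance to \<open>\<real>\<^sup>p\<close> in the half-space
  \<open>\<real>\<^sup>p \<times> [0,\<infinity>)\<close>.\<close>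

definition pot :: "real \<Rightarrow> (real ^ 'p) measure \<Rightarrow> real ^ 'p \<Rightarrow> real \<Rightarrow> ennreal" where
  "pot s \<mu> x t = (\<integral>\<^sup>+ y. rkern s (norm (x - y) ^ 2 + t) \<partial>\<mu>)"

lemma rkern_pos: "0 < q \<Longrightarrow> rkern s q = ennreal (q powr (- s / 2))"
  unfolding rkern_def by (subst inverse_ennreal) (auto simp: powr_minus)

lemma rkern_zero: "rkern s 0 = \<infinity>"
  by (simp add: rkern_def)

lemma power2_powr_half:
  fixes a s :: real
  assumes "0 < a"
  shows "(a ^ 2) powr (- s / 2) = a powr (- s)"
proof -
  have "(a ^ 2) powr (- s / 2) = (a powr 2) powr (- s / 2)" using assms by (subst powr_numeral) auto
  then show ?thesis by (simp only: powr_powr) simp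
qed

lemma rkern_power2: "0 < a \<Longrightarrow> rkern s (a ^ 2) = ennreal (a powr (- s))"
  using power2_powr_half[of a s] by (simp add: rkern_pos)

lemma riesz_kernel_eq_rkern: "riesz_kernel s x y = rkern s (norm (x - y) ^ 2)"
proof (cases "x = y")
  case False
  then have "norm (x - y) ^ 2 > 0" by simp
  then show ?thesis
    using False by (simp add: riesz_kernel_def rkern_power2)
qed (simp add: riesz_kernel_def rkern_zero)

lemma rkern_measurable[measurable]: "rkern s \<in> borel_measurable borel"
  unfolding rkern_def by measurable

lemma continuous_on_rkern: "0 < s \<Longrightarrow> continuous_on {0..} (rkern s)"
  unfolding rkern_def
  by (intro continuous_on_inverse_ennreal continuous_on_ennreal continuous_on_powr' continuous_intros) auto

lemma rkern_antimono: "0 < s \<Longrightarrow> 0 \<le> a \<Longrightarrow> a \<le> b \<Longrightarrow> rkern s b \<le> rkern s a"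
  by (cases "a = 0"; cases "b = 0") (auto simp: rkern_zero rkern_pos intro!: ennreal_leI powr_mono2')

lemma pot_measurable[measurable]:
  fixes \<mu> \<nu> :: "(real ^ 'p) measure"
  assumes "finite_measure \<mu>" and [measurable_cong]: "sets \<mu> = sets borel"
    and [measurable_cong]: "sets \<nu> = sets borel"
  shows "(\<lambda>x. pot s \<mu> x t) \<in> borel_measurable \<nu>"
proof -
  interpret finite_measure \<mu> by fact
  show ?thesis unfolding pot_def by measurable
qed

lemma riesz_potential_eq_pot:
  assumes "AE y in \<mu>. y \<in> A"
  shows "riesz_potential s A \<mu> x = pot s \<mu> x 0"
  unfolding riesz_potential_def pot_def riesz_kernel_eq_rkern
  by (rule nn_integral_cong_AE) (use assms in \<open>auto elim!: eventually_mono\<close>)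

lemma riesz_energy_eq_pot:
  assumes "AE y in \<mu>. y \<in> A"
  shows "riesz_energy s A \<mu> = (\<integral>\<^sup>+ x. pot s \<mu> x 0 \<partial>\<mu>)"
  unfolding riesz_energy_def riesz_potential_eq_pot[OF assms]
  by (rule nn_integral_cong_AE) (use assms in \<open>auto elim!: eventually_mono\<close>)

lemma pot_swap:
  fixes \<mu> \<nu> :: "(real ^ 'p) measure"
  assumes "finite_measure \<mu>" "finite_measure \<nu>"
    and [measurable_cong]: "sets \<mu> = sets borel" "sets \<nu> = sets borel"
  shows "(\<integral>\<^sup>+ x. pot s \<mu> x 0 \<partial>\<nu>) = (\<integral>\<^sup>+ x. pot s \<nu> x 0 \<partial>\<mu>)"
proof -
  interpret \<mu>: finite_measure \<mu> by fact
  interpret \<nu>: finite_measure \<nu> by fact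
  interpret pair_sigma_finite \<nu> \<mu> ..
  have "(\<integral>\<^sup>+ y. \<integral>\<^sup>+ x. rkern s (norm (x - y) ^ 2) \<partial>\<nu> \<partial>\<mu>) = (\<integral>\<^sup>+ x. \<integral>\<^sup>+ y. rkern s (norm (x - y) ^ 2) \<partial>\<mu> \<partial>\<nu>)"
    by (rule Fubini') measurable
  then show ?thesis unfolding pot_def by (simp add: norm_minus_commute)
qed

lemma AE_in_set_iff:
  fixes \<mu> :: "'a::topological_space measure"
  assumes "sets \<mu> = sets borel" "A \<in> sets borel"
  shows "(AE y in \<mu>. y \<in> A) \<longleftrightarrow> emeasure \<mu> (- A) = 0"
  using assms sets_eq_imp_space_eq[OF assms(1)]
  by (intro AE_iff_measurable) auto

section \<open>Variation of the equilibrium measure\<close>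

text \<open>The convex combination of \<mu> and \<nu> with weights \<open>1 - e\<close> and
  \<open>e\<close> is the law of a draw whose source is decided by a Bernoulli variable. Its
  integration formula makes the energy a quadratic polynomial in \<open>e\<close>.\<close>

lemma mixture_exists:
  fixes \<mu> \<nu> :: "(real ^ 'p) measure"
  assumes \<mu>: "prob_measure_on A \<mu>" and \<nu>: "prob_measure_on A \<nu>" and A: "A \<in> sets borel"
    and e: "0 \<le> e" "e \<le> 1"
  obtains \<kappa> where "prob_measure_on A \<kappa>"
    "\<And>f. f \<in> borel_measurable borel \<Longrightarrow>
       (\<integral>\<^sup>+ x. f x \<partial>\<kappa>) = ennreal (1 - e) * (\<integral>\<^sup>+ x. f x \<partial>\<mu>) + ennreal e * (\<integral>\<^sup>+ x. f x \<partial>\<nu>)"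
proof -
  define \<kappa> where "\<kappa> = measure_pmf (bernoulli_pmf e) \<bind> (\<lambda>b. if b then \<nu> else \<mu>)"
  have sm: "sets \<mu> = sets borel" "sets \<nu> = sets borel"
    using \<mu> \<nu> by (auto simp: prob_measure_on_def fin_borel_measure_on_def)
  then have sp: "space \<mu> = UNIV" "space \<nu> = UNIV"
    using sets_eq_imp_space_eq[of \<mu> borel] sets_eq_imp_space_eq[of \<nu> borel] by auto
  have pm: "prob_space \<mu>" "prob_space \<nu>"
    using \<mu> \<nu> sp by (auto simp: prob_measure_on_def intro!: prob_spaceI)
  have N: "(\<lambda>b. if b then \<nu> else \<mu>) \<in> measurable (measure_pmf (bernoulli_pmf e)) (subprob_algebra borel)"
    by (auto simp: space_subprob_algebra sm pm prob_space_imp_subprob_space)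
  have int: "(\<integral>\<^sup>+ x. f x \<partial>\<kappa>) = ennreal (1 - e) * (\<integral>\<^sup>+ x. f x \<partial>\<mu>) + ennreal e * (\<integral>\<^sup>+ x. f x \<partial>\<nu>)"
    if "f \<in> borel_measurable borel" for f
    unfolding \<kappa>_def using e by (subst nn_integral_bind[OF that N]) (simp add: mult.commute add.commute)
  have s\<kappa>: "sets \<kappa> = sets borel"
    unfolding \<kappa>_def by (rule sets_bind) (auto simp: sm)
  have em: "emeasure \<kappa> X = ennreal (1 - e) * emeasure \<mu> X + ennreal e * emeasure \<nu> X"
    if "X \<in> sets borel" for X
    using int[of "indicator X"] that s\<kappa> sm by simp
  have U: "emeasure \<kappa> UNIV = 1"
    using em[of UNIV] \<mu> \<nu> e by (simp add: prob_measure_on_def flip: ennreal_plus)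
  have null: "emeasure \<mu> (- A) = 0" "emeasure \<nu> (- A) = 0"
    using \<mu> \<nu> AE_in_set_iff[OF sm(1) A] AE_in_set_iff[OF sm(2) A]
    by (auto simp: prob_measure_on_def fin_borel_measure_on_def)
  have "emeasure \<kappa> (- A) = 0" using em[of "- A"] null A by simp
  then have "AE y in \<kappa>. y \<in> A"
    using AE_in_set_iff[OF s\<kappa> A] by simp
  moreover have "finite_measure \<kappa>"
    using U s\<kappa> sets_eq_imp_space_eq[OF s\<kappa>] by (intro finite_measureI) auto
  ultimately have "prob_measure_on A \<kappa>"
    using U s\<kappa> by (auto simp: prob_measure_on_def fin_borel_measure_on_def)
  then show thesis using int that by blast
qed

text \<open>At \<open>e = 0\<close> both sides agree, so the derivative \<open>2 * (m - W)\<close>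
  of the right-hand side there must be nonnegative.\<close>

lemma quadratic_perturbation:
  fixes W m I :: real
  assumes "\<And>e. 0 < e \<Longrightarrow> e \<le> 1 \<Longrightarrow> W \<le> (1 - e)^2 * W + 2 * e * (1 - e) * m + e^2 * I"
  shows "W \<le> m"
proof (rule ccontr)
  assume "\<not> W \<le> m"
  then have d: "W - m > 0" by simp
  define B where "B = \<bar>W - 2 * m + I\<bar> + 1"
  \<comment> \<open>Small enough that the second-order contribution \<open>e * B\<close> is at most
    \<open>W - m\<close>, half of the first-order loss \<open>2 * (W - m)\<close>.\<close>
  define e where "e = min 1 ((W - m) / B)"
  have B: "B > 0" by (auto simp: B_def)
  have e: "0 < e" "e \<le> 1" using d B by (auto simp: e_def)
  have "W \<le> (1 - e)^2 * W + 2 * e * (1 - e) * m + e^2 * I" using assms e by blast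
  then have "e * (2 * (W - m)) \<le> e * (e * (W - 2 * m + I))"
    by (simp add: power2_eq_square algebra_simps)
  then have "2 * (W - m) \<le> e * (W - 2 * m + I)" using e by simp
  also have "\<dots> \<le> e * B" using e by (intro mult_left_mono) (auto simp: B_def)
  also have "\<dots> \<le> W - m" using B by (simp add: e_def min_def field_simps)
  finally show False using d by simp
qed

text \<open>Minimality of the energy along the mixtures of \<mu> and \<nu>, differentiated at
  \<open>e = 0\<close>, bounds the mutual energy. Finite energy of \<nu> keeps the
  \<open>e^2\<close> term real; an infinite mutual energy makes the claim trivial.\<close>

lemma equilibrium_variation_prob:
  fixes \<mu> \<nu> :: "(real ^ 'p) measure"
  assumes eq: "equilibrium_measure s A \<mu>" and A: "A \<in> sets borel"
    and W: "wiener_const s A < \<infinity>" and \<nu>: "prob_measure_on A \<nu>"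
    and I: "(\<integral>\<^sup>+ x. pot s \<nu> x 0 \<partial>\<nu>) < \<infinity>"
  shows "wiener_const s A \<le> (\<integral>\<^sup>+ x. pot s \<mu> x 0 \<partial>\<nu>)"
proof (cases "(\<integral>\<^sup>+ x. pot s \<mu> x 0 \<partial>\<nu>) < \<infinity>")
  case m: True
  have \<mu>: "prob_measure_on A \<mu>" and eW: "riesz_energy s A \<mu> = wiener_const s A"
    using eq by (auto simp: equilibrium_measure_def)
  have fin: "finite_measure \<mu>" "finite_measure \<nu>" and sm: "sets \<mu> = sets borel" "sets \<nu> = sets borel"
    and AE: "AE y in \<mu>. y \<in> A" "AE y in \<nu>. y \<in> A"
    using \<mu> \<nu> by (auto simp: prob_measure_on_def fin_borel_measure_on_def)
  note [measurable_cong] = sm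
  obtain w where w: "wiener_const s A = ennreal w" "0 \<le> w" using W by (cases "wiener_const s A") auto
  obtain m' where m': "(\<integral>\<^sup>+ x. pot s \<mu> x 0 \<partial>\<nu>) = ennreal m'" "0 \<le> m'"
    using m by (cases "(\<integral>\<^sup>+ x. pot s \<mu> x 0 \<partial>\<nu>)") auto
  obtain i where i: "(\<integral>\<^sup>+ x. pot s \<nu> x 0 \<partial>\<nu>) = ennreal i" "0 \<le> i"
    using I by (cases "(\<integral>\<^sup>+ x. pot s \<nu> x 0 \<partial>\<nu>)") auto
  have wm: "(\<integral>\<^sup>+ x. pot s \<mu> x 0 \<partial>\<mu>) = ennreal w" using riesz_energy_eq_pot[OF AE(1)] eW w by metis
  have sw: "(\<integral>\<^sup>+ x. pot s \<nu> x 0 \<partial>\<mu>) = ennreal m'" using pot_swap[OF fin sm] m' by simp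
  have "w \<le> (1 - e)^2 * w + 2 * e * (1 - e) * m' + e^2 * i" if e: "0 < e" "e \<le> 1" for e
  proof -
    obtain \<kappa> where \<kappa>: "prob_measure_on A \<kappa>"
      and int: "\<And>f. f \<in> borel_measurable borel \<Longrightarrow>
       (\<integral>\<^sup>+ x. f x \<partial>\<kappa>) = ennreal (1 - e) * (\<integral>\<^sup>+ x. f x \<partial>\<mu>) + ennreal e * (\<integral>\<^sup>+ x. f x \<partial>\<nu>)"
      using mixture_exists[OF \<mu> \<nu> A] e by (metis less_imp_le)
    have AE\<kappa>: "AE y in \<kappa>. y \<in> A" and f\<kappa>: "finite_measure \<kappa>" and s\<kappa>: "sets \<kappa> = sets borel"
      using \<kappa> by (auto simp: prob_measure_on_def fin_borel_measure_on_def)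
    have pk: "pot s \<kappa> x 0 = ennreal (1 - e) * pot s \<mu> x 0 + ennreal e * pot s \<nu> x 0" for x
      unfolding pot_def by (rule int) measurable
    have mm[measurable]: "(\<lambda>x. pot s \<kappa> x 0) \<in> borel_measurable borel"
      "(\<lambda>x. pot s \<mu> x 0) \<in> borel_measurable borel" "(\<lambda>x. pot s \<nu> x 0) \<in> borel_measurable borel"
      using pot_measurable f\<kappa> s\<kappa> fin sm by blast+
    have "ennreal w \<le> riesz_energy s A \<kappa>"
      unfolding w(1)[symmetric] wiener_const_def by (rule INF_lower) (use \<kappa> in simp)
    also have "\<dots> = (\<integral>\<^sup>+ x. pot s \<kappa> x 0 \<partial>\<kappa>)" by (rule riesz_energy_eq_pot[OF AE\<kappa>])
    also have "\<dots> = ennreal (1 - e) * (\<integral>\<^sup>+ x. pot s \<kappa> x 0 \<partial>\<mu>) + ennreal e * (\<integral>\<^sup>+ x. pot s \<kappa> x 0 \<partial>\<nu>)"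
      by (rule int) measurable
    also have "(\<integral>\<^sup>+ x. pot s \<kappa> x 0 \<partial>\<mu>) = ennreal (1 - e) * ennreal w + ennreal e * ennreal m'"
      unfolding pk by (subst nn_integral_add) (auto simp: nn_integral_cmult wm sw)
    also have "(\<integral>\<^sup>+ x. pot s \<kappa> x 0 \<partial>\<nu>) = ennreal (1 - e) * ennreal m' + ennreal e * ennreal i"
      unfolding pk by (subst nn_integral_add) (auto simp: nn_integral_cmult m' i)
    also have "ennreal (1 - e) * (ennreal (1 - e) * ennreal w + ennreal e * ennreal m') +
        ennreal e * (ennreal (1 - e) * ennreal m' + ennreal e * ennreal i)
      = ennreal ((1 - e) * ((1 - e) * w + e * m') + e * ((1 - e) * m' + e * i))"
      using e w m' i by (simp add: ennreal_mult ennreal_plus)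
    also have "(1 - e) * ((1 - e) * w + e * m') + e * ((1 - e) * m' + e * i) =
        (1 - e)^2 * w + 2 * e * (1 - e) * m' + e^2 * i"
      by algebra
    finally show ?thesis using e w m' i by (subst (asm) ennreal_le_iff) auto
  qed
  then have "w \<le> m'" by (rule quadratic_perturbation)
  then show ?thesis using w m' by (simp add: ennreal_leI)
qed (simp add: not_less top.extremum_unique)

text \<open>Without normalisation the inequality applies directly to restrictions of measures to
  Borel sets. A measure of mass zero is trivial, any other is rescaled.\<close>

lemma equilibrium_variation:
  fixes \<mu> \<nu> :: "(real ^ 'p) measure"
  assumes eq: "equilibrium_measure s A \<mu>" and A: "A \<in> sets borel"
    and W: "wiener_const s A < \<infinity>" and \<nu>: "fin_borel_measure_on A \<nu>"
    and I: "(\<integral>\<^sup>+ x. pot s \<nu> x 0 \<partial>\<nu>) < \<infinity>"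
  shows "wiener_const s A * emeasure \<nu> UNIV \<le> (\<integral>\<^sup>+ x. pot s \<mu> x 0 \<partial>\<nu>)"
proof (cases "emeasure \<nu> UNIV = 0")
  case False
  have fin: "finite_measure \<nu>" and sm: "sets \<nu> = sets borel" and AE: "AE y in \<nu>. y \<in> A"
    using \<nu> by (auto simp: fin_borel_measure_on_def)
  have f\<mu>: "finite_measure \<mu>" "sets \<mu> = sets borel"
    using eq by (auto simp: equilibrium_measure_def prob_measure_on_def fin_borel_measure_on_def)
  note [measurable_cong] = sm
  have fm: "emeasure \<nu> UNIV \<noteq> \<infinity>" by (rule finite_measure.emeasure_finite[OF fin, unfolded infinity_ennreal_def[symmetric]])
  define c where "c = inverse (emeasure \<nu> UNIV)"
  have c: "c * emeasure \<nu> UNIV = 1" "emeasure \<nu> UNIV * c = 1"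
    unfolding c_def using False fm
    by (simp_all add: less_top mult.commute flip: divide_ennreal_def)
  have cf: "c \<noteq> \<infinity>" unfolding c_def using False by simp
  define \<kappa> where "\<kappa> = scale_measure c \<nu>"
  have s\<kappa>: "sets \<kappa> = sets borel" by (simp add: \<kappa>_def sm)
  have "emeasure \<kappa> UNIV = 1" using c by (simp add: \<kappa>_def)
  moreover have "AE y in \<kappa>. y \<in> A"
  proof -
    have "emeasure \<nu> (- A) = 0"
      using AE AE_in_set_iff[OF sm A] by simp
    then have "emeasure \<kappa> (- A) = 0" by (simp add: \<kappa>_def)
    then show ?thesis using AE_in_set_iff[OF s\<kappa> A] by simp
  qed
  ultimately have \<kappa>: "prob_measure_on A \<kappa>"
    using s\<kappa> sets_eq_imp_space_eq[OF s\<kappa>]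
    by (auto simp: prob_measure_on_def fin_borel_measure_on_def intro!: finite_measureI)
  have [measurable]: "(\<lambda>x. pot s \<nu> x 0) \<in> borel_measurable \<nu>" "(\<lambda>x. pot s \<mu> x 0) \<in> borel_measurable \<nu>"
    using pot_measurable fin sm f\<mu> by blast+
  have pk: "pot s \<kappa> x 0 = c * pot s \<nu> x 0" for x
    unfolding pot_def \<kappa>_def by (rule nn_integral_scale_measure) measurable
  have "(\<integral>\<^sup>+ x. pot s \<kappa> x 0 \<partial>\<kappa>) = c * (c * (\<integral>\<^sup>+ x. pot s \<nu> x 0 \<partial>\<nu>))"
    unfolding pk unfolding \<kappa>_def by (simp add: nn_integral_scale_measure nn_integral_cmult)
  also have "\<dots> < \<infinity>" using I cf by (simp add: ennreal_mult_less_top less_top)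
  finally have "wiener_const s A \<le> (\<integral>\<^sup>+ x. pot s \<mu> x 0 \<partial>\<kappa>)"
    by (rule equilibrium_variation_prob[OF eq A W \<kappa>])
  also have "\<dots> = c * (\<integral>\<^sup>+ x. pot s \<mu> x 0 \<partial>\<nu>)"
    unfolding \<kappa>_def by (simp add: nn_integral_scale_measure)
  finally have "wiener_const s A * emeasure \<nu> UNIV \<le> c * (\<integral>\<^sup>+ x. pot s \<mu> x 0 \<partial>\<nu>) * emeasure \<nu> UNIV"
    by (rule mult_right_mono) simp
  also have "\<dots> = (\<integral>\<^sup>+ x. pot s \<mu> x 0 \<partial>\<nu>)" using c by (simp add: mult.commute mult.left_commute flip: mult.assoc)
  finally show ?thesis .
qed simp

section \<open>The potential on the support of the measure\<close>

text \<open>Fatou's lemma, since the kernel is continuous on \<open>{0..}\<close> with the value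
  infinity at \<open>0\<close>. The points move in \<open>x\<close> and \<open>t\<close> jointly
  because a minimising sequence of the comparison argument may descend to \<open>A\<close> at height
  zero.\<close>

lemma pot_lower_semicontinuous:
  fixes \<mu> :: "(real ^ 'p) measure"
  assumes s: "0 < s" and [measurable_cong]: "sets \<mu> = sets borel"
    and x: "x \<longlonglongrightarrow> a" and t: "t \<longlonglongrightarrow> b" "\<And>n. 0 \<le> t n"
  shows "pot s \<mu> a b \<le> liminf (\<lambda>n. pot s \<mu> (x n) (t n))"
proof -
  have b: "0 \<le> b" using LIMSEQ_le_const[OF t(1)] t(2) by blast
  have "(\<lambda>n. rkern s (norm (x n - y) ^ 2 + t n)) \<longlonglongrightarrow> rkern s (norm (a - y) ^ 2 + b)" for y
    by (rule continuous_on_tendsto_compose[OF continuous_on_rkern[OF s]])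
       (use t b in \<open>auto intro!: tendsto_intros x\<close>)
  note lim = this
  have "pot s \<mu> a b = (\<integral>\<^sup>+ y. liminf (\<lambda>n. rkern s (norm (x n - y) ^ 2 + t n)) \<partial>\<mu>)"
    unfolding pot_def by (intro nn_integral_cong lim_imp_Liminf[OF _ lim, symmetric]) simp
  also have "\<dots> \<le> liminf (\<lambda>n. pot s \<mu> (x n) (t n))"
    unfolding pot_def by (rule nn_integral_liminf) measurable
  finally show ?thesis .
qed

lemma fin_borel_measure_on_density:
  assumes "fin_borel_measure_on A \<mu>" "S \<in> sets borel"
  shows "fin_borel_measure_on A (density \<mu> (indicator S))"
proof -
  have [measurable_cong]: "sets \<mu> = sets borel" and [simp]: "space \<mu> = UNIV"
    using assms sets_eq_imp_space_eq[of \<mu> borel] by (auto simp: fin_borel_measure_on_def)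
  have [measurable]: "S \<in> sets borel" by fact
  have "emeasure (density \<mu> (indicator S)) UNIV = emeasure \<mu> S"
    using assms by (simp add: emeasure_density)
  moreover have "emeasure \<mu> S < \<infinity>"
    using assms by (simp add: fin_borel_measure_on_def finite_measure.emeasure_finite less_top[symmetric])
  ultimately have "finite_measure (density \<mu> (indicator S))" by (intro finite_measureI) auto
  moreover have "AE y in density \<mu> (indicator S). y \<in> A"
    using assms by (subst AE_density) (auto simp: fin_borel_measure_on_def)
  ultimately show ?thesis by (auto simp: fin_borel_measure_on_def \<open>sets \<mu> = sets borel\<close>)
qed

lemma nn_integral_density_indicator:
  fixes \<mu> :: "'a::topological_space measure"
  assumes "sets \<mu> = sets borel" "S \<in> sets borel" "f \<in> borel_measurable borel"
  shows "(\<integral>\<^sup>+ x. f x \<partial>density \<mu> (indicator S)) = (\<integral>\<^sup>+ x. f x * indicator S x \<partial>\<mu>)"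
proof -
  have "f \<in> borel_measurable \<mu>" "S \<in> sets \<mu>" using assms by (simp_all cong: measurable_cong_sets)
  then show ?thesis by (subst nn_integral_density) (auto simp: mult.commute)
qed

lemma pot_density_le:
  fixes \<mu> :: "(real ^ 'p) measure"
  assumes "sets \<mu> = sets borel" "S \<in> sets borel"
  shows "pot s (density \<mu> (indicator S)) x t \<le> pot s \<mu> x t"
  unfolding pot_def by (subst nn_integral_density_indicator)
    (use assms in \<open>auto intro!: nn_integral_mono simp: indicator_def\<close>)

text \<open>A value above the Wiener constant would persist on a ball by lower semicontinuity, and
  that ball has positive mass. By \<open>equilibrium_variation\<close> the part of \<mu> off the
  ball already contributes its mass times the Wiener constant, so the total energy would be too
  large.\<close>

lemma pot_equilibrium_le:
  fixes \<mu> :: "(real ^ 'p) measure"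
  assumes eq: "equilibrium_measure s A \<mu>" and A: "A \<in> sets borel" and s: "0 < s"
    and W: "wiener_const s A < \<infinity>" and supp: "\<And>r. 0 < r \<Longrightarrow> 0 < emeasure \<mu> (ball x r)"
  shows "pot s \<mu> x 0 \<le> wiener_const s A"
proof (rule ccontr)
  assume "\<not> pot s \<mu> x 0 \<le> wiener_const s A"
  then obtain a where a: "wiener_const s A < a" "a < pot s \<mu> x 0"
    using dense by (meson not_le)
  have f\<mu>: "fin_borel_measure_on A \<mu>" and mass: "emeasure \<mu> UNIV = 1"
    and energy: "riesz_energy s A \<mu> = wiener_const s A"
    using eq by (auto simp: equilibrium_measure_def prob_measure_on_def)
  have sm[measurable_cong]: "sets \<mu> = sets borel" and fin: "finite_measure \<mu>" and AE: "AE y in \<mu>. y \<in> A"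
    using f\<mu> by (auto simp: fin_borel_measure_on_def)
  have [measurable]: "(\<lambda>x. pot s \<mu> x 0) \<in> borel_measurable borel"
    using pot_measurable fin sm by blast
  have "\<exists>r>0. \<forall>y\<in>ball x r. a \<le> pot s \<mu> y 0"
  proof (rule ccontr)
    assume "\<not> ?thesis"
    then have "\<forall>n::nat. \<exists>y. dist x y < inverse (Suc n) \<and> pot s \<mu> y 0 < a"
      by (metis mem_ball not_le inverse_positive_iff_positive of_nat_0_less_iff zero_less_Suc)
    then obtain y where y: "\<And>n. dist x (y n) < inverse (Suc n)" "\<And>n. pot s \<mu> (y n) 0 < a" by metis
    have "(\<lambda>n. dist (y n) x) \<longlonglongrightarrow> 0"
      by (rule tendsto_sandwich[OF _ _ tendsto_const LIMSEQ_inverse_real_of_nat])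
         (use y(1) in \<open>auto intro!: always_eventually simp: less_imp_le dist_commute\<close>)
    then have "y \<longlonglongrightarrow> x" by (simp flip: tendsto_dist_iff)
    then have "pot s \<mu> x 0 \<le> liminf (\<lambda>n. pot s \<mu> (y n) 0)"
      by (intro pot_lower_semicontinuous[OF s sm]) auto
    also have "\<dots> \<le> limsup (\<lambda>n. pot s \<mu> (y n) 0)" by (rule Liminf_le_Limsup) simp
    also have "\<dots> \<le> a" by (rule Limsup_bounded) (simp add: less_imp_le y(2))
    finally show False using a by simp
  qed
  then obtain r where r: "0 < r" "\<And>y. y \<in> ball x r \<Longrightarrow> a \<le> pot s \<mu> y 0" by blast
  define B where "B = ball x r"
  have [measurable]: "B \<in> sets borel" by (simp add: B_def)
  \<comment> \<open>removing from \<open>\<mu>\<close> a neighbourhood where its potential is large would contradict the variational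
    inequality\<close>
  define \<nu> where "\<nu> = density \<mu> (indicator (- B))"
  have f\<nu>: "fin_borel_measure_on A \<nu>"
    unfolding \<nu>_def by (rule fin_borel_measure_on_density[OF f\<mu>]) measurable
  have m\<nu>: "emeasure \<nu> UNIV = emeasure \<mu> (- B)"
    unfolding \<nu>_def by (subst emeasure_density) (auto simp: sm)
  have E: "(\<integral>\<^sup>+ x. pot s \<mu> x 0 \<partial>\<mu>) = wiener_const s A"
    using riesz_energy_eq_pot[OF AE] energy by metis
  have "(\<integral>\<^sup>+ x. pot s \<nu> x 0 \<partial>\<nu>) \<le> (\<integral>\<^sup>+ x. pot s \<mu> x 0 \<partial>\<nu>)"
    unfolding \<nu>_def by (intro nn_integral_mono pot_density_le) (auto simp: sm)
  also have "\<dots> \<le> (\<integral>\<^sup>+ x. pot s \<mu> x 0 \<partial>\<mu>)"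
    unfolding \<nu>_def by (subst nn_integral_density_indicator)
     (auto simp: sm indicator_def intro!: nn_integral_mono)
  finally have I: "(\<integral>\<^sup>+ x. pot s \<nu> x 0 \<partial>\<nu>) < \<infinity>" using E W by simp
  have V: "wiener_const s A * emeasure \<mu> (- B) \<le> (\<integral>\<^sup>+ x. pot s \<mu> x 0 * indicator (- B) x \<partial>\<mu>)"
    using equilibrium_variation[OF eq A W f\<nu> I] unfolding m\<nu>
    unfolding \<nu>_def by (subst (asm) nn_integral_density_indicator) (auto simp: sm)
  have "wiener_const s A * emeasure \<mu> (- B) + a * emeasure \<mu> B \<le>
      (\<integral>\<^sup>+ x. pot s \<mu> x 0 * indicator (- B) x \<partial>\<mu>) + (\<integral>\<^sup>+ x. pot s \<mu> x 0 * indicator B x \<partial>\<mu>)"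
  proof (rule add_mono[OF V])
    have "a * emeasure \<mu> B = (\<integral>\<^sup>+ x. a * indicator B x \<partial>\<mu>)"
      by (subst nn_integral_cmult_indicator) (auto simp: sm)
    also have "\<dots> \<le> (\<integral>\<^sup>+ x. pot s \<mu> x 0 * indicator B x \<partial>\<mu>)"
      by (intro nn_integral_mono) (auto simp: indicator_def B_def r(2))
    finally show "a * emeasure \<mu> B \<le> (\<integral>\<^sup>+ x. pot s \<mu> x 0 * indicator B x \<partial>\<mu>)" .
  qed
  also have "\<dots> = (\<integral>\<^sup>+ x. pot s \<mu> x 0 \<partial>\<mu>)"
    by (subst nn_integral_add[symmetric]) (auto intro!: nn_integral_cong simp: indicator_def)
  also have "\<dots> = wiener_const s A * emeasure \<mu> UNIV" using E mass by simp
  also have "emeasure \<mu> UNIV = emeasure \<mu> (- B) + emeasure \<mu> B"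
    by (subst plus_emeasure) (auto simp: sm)
  finally have "wiener_const s A * emeasure \<mu> (- B) + a * emeasure \<mu> B \<le>
      wiener_const s A * emeasure \<mu> (- B) + wiener_const s A * emeasure \<mu> B"
    by (simp add: distrib_left)
  moreover have fb: "emeasure \<mu> X < \<infinity>" for X
    using fin by (simp add: finite_measure.emeasure_finite less_top[symmetric])
  moreover have "wiener_const s A * emeasure \<mu> (- B) < \<infinity>"
    using W fb by (simp add: ennreal_mult_less_top)
  ultimately have "a * emeasure \<mu> B \<le> wiener_const s A * emeasure \<mu> B"
    by (auto simp: ennreal_add_left_cancel_le)
  moreover have "wiener_const s A * emeasure \<mu> B < a * emeasure \<mu> B"
    using supp[OF r(1)] fb[of B] a(1) by (intro ennreal_mult_strict_right_mono) (auto simp: B_def)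
  ultimately show False by simp
qed

section \<open>Loss of potential when a point is lifted to height \<open>r\<close>\<close>

lemma powr_gap:
  fixes a b \<sigma> :: real
  assumes "0 < a" "a \<le> b" "0 < \<sigma>"
  shows "(a + b) powr (- \<sigma>) + (1 - 2 powr (- \<sigma>)) * b powr (- \<sigma>) \<le> a powr (- \<sigma>)"
proof -
  have "a + b = a * (1 + b / a)" using assms by (simp add: field_simps)
  then have "(a + b) powr (- \<sigma>) = a powr (- \<sigma>) * (1 + b / a) powr (- \<sigma>)"
    using assms by (metis powr_mult less_imp_le)
  \<comment> \<open>Here \<open>a \<le> b\<close> enters: \<open>1 + b / a\<close> is at least
    \<open>2\<close>.\<close>
  also have "\<dots> \<le> a powr (- \<sigma>) * 2 powr (- \<sigma>)"
    using assms by (intro mult_left_mono powr_mono2') (auto simp: field_simps)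
  finally have "(a + b) powr (- \<sigma>) \<le> a powr (- \<sigma>) * 2 powr (- \<sigma>)" .
  moreover have "(1 - 2 powr (- \<sigma>)) * b powr (- \<sigma>) \<le> (1 - 2 powr (- \<sigma>)) * a powr (- \<sigma>)"
    using assms by (intro mult_left_mono powr_mono2') (use powr_mono[of "- \<sigma>" 0 2] in auto)
  ultimately show ?thesis by (simp add: algebra_simps)
qed

text \<open>Each \<open>y\<close> in the ball contributes a fixed fraction of
  \<open>r powr (- s)\<close> to the difference of the two kernels, by \<open>powr_gap\<close>
  applied to the squares of \<open>norm (x - y)\<close> and \<open>r\<close>. A sum is used instead
  of a difference because the potentials are extended reals.\<close>

lemma pot_gap:
  fixes \<mu> :: "(real ^ 'p) measure"
  assumes s: "0 < s" and r: "0 < r" and sm[measurable_cong]: "sets \<mu> = sets borel"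
  shows "pot s \<mu> x (r^2) + ennreal ((1 - 2 powr (- s / 2)) * r powr (- s)) * emeasure \<mu> (ball x r) \<le> pot s \<mu> x 0"
proof -
  have [measurable]: "ball x r \<in> sets borel" by simp
  define c where "c = ennreal ((1 - 2 powr (- s / 2)) * r powr (- s))"
  have c0: "0 \<le> (1 - 2 powr (- s / 2)) * r powr (- s)"
    using s powr_mono[of "- s / 2" 0 2] by simp
  have r2: "(r^2) powr (- (s / 2)) = r powr (- s)"
    using power2_powr_half[OF r, of s] by simp
  have le: "rkern s (norm (x - y) ^ 2 + r^2) + c * indicator (ball x r) y \<le> rkern s (norm (x - y) ^ 2 + 0)" for y
  proof (cases "x = y \<or> y \<notin> ball x r")
    case True
    then show ?thesis using s
      by (cases "x = y") (auto simp: rkern_zero indicator_def intro!: rkern_antimono)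
  next
    case False
    then have xy: "0 < norm (x - y) ^ 2" "norm (x - y) ^ 2 \<le> r^2" and in_ball: "y \<in> ball x r"
      by (auto simp: dist_norm intro!: power_mono)
    have "(norm (x - y) ^ 2 + r^2) powr (- (s/2)) + (1 - 2 powr (- (s/2))) * (r^2) powr (- (s/2))
        \<le> (norm (x - y) ^ 2) powr (- (s/2))"
      using xy s by (intro powr_gap) auto
    then show ?thesis using xy r in_ball c0
      unfolding c_def r2 by (simp add: rkern_pos add_pos_pos ennreal_leI flip: ennreal_plus)
  qed
  have "pot s \<mu> x (r^2) + c * emeasure \<mu> (ball x r) =
      (\<integral>\<^sup>+ y. rkern s (norm (x - y) ^ 2 + r^2) + c * indicator (ball x r) y \<partial>\<mu>)"
    unfolding pot_def
    by (subst nn_integral_add) (measurable, simp add: nn_integral_cmult_indicator sm)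
  also have "\<dots> \<le> pot s \<mu> x 0" unfolding pot_def by (intro nn_integral_mono le)
  finally show ?thesis unfolding c_def .
qed

section \<open>The potential on the regular part\<close>

text \<open>On the \<open>k\<close>-th dyadic shell the kernel times the mass is of order
  \<open>(\<rho> / 2 ^ k) powr (d - s)\<close>; since \<open>s < d\<close>, these bounds form a
  geometric series of ratio \<open>2 powr (s - d)\<close>.\<close>

lemma pot_ball_le:
  fixes \<nu> :: "(real ^ 'p) measure" and d :: nat and s :: real
  assumes s: "0 < s" "s < real d" and \<rho>: "0 < \<rho>" and C: "0 \<le> C"
    and fin: "finite_measure \<nu>" and sm[measurable_cong]: "sets \<nu> = sets borel"
    and up: "\<And>r. 0 < r \<Longrightarrow> r \<le> \<rho> \<Longrightarrow> measure \<nu> (ball y r) \<le> C * r ^ d"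
  shows "(\<integral>\<^sup>+ z. rkern s (norm (y - z) ^ 2) * indicator (ball y \<rho>) z \<partial>\<nu>)
     \<le> ennreal (C * 2 powr s / (1 - 2 powr (s - d)) * \<rho> powr (d - s))"
proof -
  interpret finite_measure \<nu> by fact
  \<comment> \<open>dyadic decomposition of the ball\<close>
  define r where "r k = \<rho> * (1/2) ^ k" for k :: nat
  have r0: "0 < r k" "r k \<le> \<rho>" for k using \<rho> by (auto simp: r_def mult_le_cancel_left1 power_le_one)
  have rlim: "r \<longlonglongrightarrow> 0" unfolding r_def by (rule tendsto_mult_right_zero) (simp add: LIMSEQ_realpow_zero)
  \<comment> \<open>The shells miss the centre, where the kernel is infinite. It is a null set
    because \<open>d\<close> is positive and the growth bound tends to zero.\<close>
  have "emeasure \<nu> {y} \<le> 0"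
  proof (rule tendsto_lowerbound[OF _ always_eventually])
    have "(\<lambda>k. C * r k ^ d) \<longlonglongrightarrow> C * 0 ^ d" by (intro tendsto_intros rlim)
    then show "(\<lambda>k. ennreal (C * r k ^ d)) \<longlonglongrightarrow> 0" using s by (auto dest!: tendsto_ennrealI simp: zero_power)
    show "\<forall>k. emeasure \<nu> {y} \<le> ennreal (C * r k ^ d)"
    proof
      fix k
      have "emeasure \<nu> {y} \<le> emeasure \<nu> (ball y (r k))" using r0 by (intro emeasure_mono) (auto simp: sm)
      also have "\<dots> = ennreal (measure \<nu> (ball y (r k)))" by (rule emeasure_eq_measure)
      also have "\<dots> \<le> ennreal (C * r k ^ d)" by (intro ennreal_leI up[OF r0])
      finally show "emeasure \<nu> {y} \<le> ennreal (C * r k ^ d)" .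
    qed
  qed simp
  then have AE: "AE z in \<nu>. z \<noteq> y" by (intro AE_I[of _ _ "{y}"]) (auto simp: sm)
  define g where "g k z = ennreal (r (Suc k) powr (- s)) * indicator (ball y (r k)) z" for k z
  have g[measurable]: "g k \<in> borel_measurable \<nu>" for k
  proof -
    have [measurable]: "ball y (r k) \<in> sets \<nu>" by (simp add: sm)
    show ?thesis unfolding g_def[abs_def] by measurable
  qed
  have dom: "rkern s (norm (y - z) ^ 2) * indicator (ball y \<rho>) z \<le> (\<Sum>k. g k z)" if z: "z \<noteq> y" for z
  proof (cases "z \<in> ball y \<rho>")
    case True
    \<comment> \<open>The first index whose radius does not exceed the distance; \<open>z\<close>
      then lies in the ball of the preceding index, whose \<open>g\<close> is built with the radius
      \<open>r n\<close>.\<close>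
    define n where "n = (LEAST k. r k \<le> dist y z)"
    obtain k where "r k < dist y z"
      using order_tendstoD(2)[OF rlim, of "dist y z"] z by (auto simp: eventually_sequentially)
    then have n: "r n \<le> dist y z" unfolding n_def by (intro LeastI[of "\<lambda>k. r k \<le> dist y z" k]) simp
    have "n \<noteq> 0" using n True by (cases n) (auto simp: r_def)
    then obtain m where m: "n = Suc m" by (cases n) auto
    have "\<not> r m \<le> dist y z" using not_less_Least[of m "\<lambda>k. r k \<le> dist y z"] m by (auto simp: n_def)
    then have zm: "z \<in> ball y (r m)" by simp
    have "rkern s (norm (y - z) ^ 2) \<le> rkern s (r n ^ 2)"
      using n r0[of n] s by (intro rkern_antimono power_mono) (auto simp: dist_norm)
    also have "\<dots> = ennreal (r n powr (- s))"
      using r0[of n] by (intro rkern_power2)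
    also have "\<dots> = g m z" using zm by (simp add: g_def m)
    also have "\<dots> \<le> (\<Sum>k. g k z)" using sum_le_suminf[of "\<lambda>k. g k z" "{m}"] by simp
    finally show ?thesis using True by simp
  qed simp
  define q where "q = 2 powr (s - real d)"
  have q: "0 < q" "q < 1" using s powr_less_mono[of "s - d" 0 2] by (auto simp: q_def)
  define D where "D = C * 2 powr s * \<rho> powr (d - s)"
  have D: "0 \<le> D" using C by (simp add: D_def)
  have intg: "(\<integral>\<^sup>+ z. g k z \<partial>\<nu>) \<le> ennreal (D * q ^ k)" for k
  proof -
    have "(\<integral>\<^sup>+ z. g k z \<partial>\<nu>) = ennreal (r (Suc k) powr (- s)) * emeasure \<nu> (ball y (r k))"
      unfolding g_def by (rule nn_integral_cmult_indicator) (simp add: sm)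
    also have "\<dots> = ennreal (r (Suc k) powr (- s) * measure \<nu> (ball y (r k)))"
      by (simp add: emeasure_eq_measure ennreal_mult)
    also have "\<dots> \<le> ennreal (r (Suc k) powr (- s) * (C * r k ^ d))"
      by (intro ennreal_leI mult_left_mono up r0) auto
    also have "r (Suc k) powr (- s) * (C * r k ^ d) = D * q ^ k"
    proof -
      have rk: "r (Suc k) = r k * 2 powr (-1)" "r k = \<rho> * 2 powr (- real k)"
        by (simp_all add: r_def powr_minus powr_realpow power_one_over field_simps)
      have "r k ^ d = r k powr d" using r0[of k] by (simp add: powr_realpow)
      then have "r (Suc k) powr (- s) * (C * r k ^ d) = C * (2 powr (-1)) powr (-s) * (r k powr (-s) * r k powr d)"
        unfolding rk(1) using r0[of k] by (subst powr_mult) (simp_all only: mult_ac less_imp_le)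
      also have "(2 powr (-1)) powr (-s) = 2 powr s" by (simp only: powr_powr) simp
      also have "r k powr (-s) * r k powr d = r k powr (d - s)" by (simp flip: powr_add)
      also have "\<dots> = \<rho> powr (d - s) * q powr k"
        unfolding rk(2) q_def using \<rho> by (simp add: powr_mult powr_powr algebra_simps)
      finally show ?thesis using q by (simp add: D_def powr_realpow)
    qed
    finally show ?thesis .
  qed
  have "(\<integral>\<^sup>+ z. rkern s (norm (y - z) ^ 2) * indicator (ball y \<rho>) z \<partial>\<nu>) \<le> (\<integral>\<^sup>+ z. (\<Sum>k. g k z) \<partial>\<nu>)"
    by (rule nn_integral_mono_AE) (use AE dom in \<open>auto elim!: eventually_mono\<close>)
  also have "\<dots> = (\<Sum>k. \<integral>\<^sup>+ z. g k z \<partial>\<nu>)" by (rule nn_integral_suminf) measurable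
  also have "\<dots> \<le> (\<Sum>k. ennreal (D * q ^ k))" by (intro suminf_le intg) auto
  also have "\<dots> = ennreal (D * (1 / (1 - q)))"
    using q D by (intro suminf_ennreal_eq sums_mult geometric_sums) auto
  finally show ?thesis by (simp add: D_def q_def ac_simps)
qed

text \<open>\<open>equilibrium_variation\<close> only bounds averages of the potential; averages
  over shrinking balls and dominated convergence give the value at \<open>x\<close> itself. For
  poles near \<open>x\<close> the domination compares the upper growth of \<nu> around the pole with
  its lower growth around \<open>x\<close>.\<close>

lemma equilibrium_potential_ge:
  fixes \<mu> \<nu> :: "(real ^ 'p) measure" and d :: nat
  assumes eq: "equilibrium_measure s A \<mu>" and A: "A \<in> sets borel" and W: "wiener_const s A < \<infinity>"
    and s: "0 < s" "s < real d" and \<nu>: "fin_borel_measure_on A \<nu>"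
    and R: "0 < R" and C: "0 < C" and c: "0 < c"
    and up: "\<And>y r. y \<in> A \<Longrightarrow> dist x y < R \<Longrightarrow> 0 < r \<Longrightarrow> r < R \<Longrightarrow> measure \<nu> (ball y r) \<le> C * r ^ d"
    and low: "\<And>r. 0 < r \<Longrightarrow> r < R \<Longrightarrow> c * r ^ d \<le> measure \<nu> (ball x r)"
  shows "wiener_const s A \<le> pot s \<mu> x 0"
proof (cases "pot s \<mu> x 0 < \<infinity>")
  case fx: True
  have sm[measurable_cong]: "sets \<mu> = sets borel" "sets \<nu> = sets borel"
    and fin: "finite_measure \<mu>" "finite_measure \<nu>"
    and AE: "AE y in \<mu>. y \<in> A" "AE y in \<nu>. y \<in> A"
    using eq \<nu> by (auto simp: equilibrium_measure_def prob_measure_on_def fin_borel_measure_on_def)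
  interpret \<nu>: finite_measure \<nu> by fact
  define K where "K = C * 2 powr s / (1 - 2 powr (s - d))"
  have q: "2 powr (s - d) < 1" using s powr_less_mono[of "s - d" 0 2] by auto
  then have K: "0 < K" using C by (simp add: K_def)
  \<comment> \<open>With \<open>4 * r n \<le> R\<close>, balls of radius \<open>3 * r n\<close>
    around poles within \<open>2 * r n\<close> of \<open>x\<close> stay in the range of
    \<open>up\<close>, and they contain \<open>ball x (r n)\<close>.\<close>
  define r where "r n = R / (4 * real (Suc n))" for n
  have r: "0 < r n" "4 * r n \<le> R" for n
    using R by (auto simp: r_def field_simps)
  have rlim: "r \<longlonglongrightarrow> 0"
    using tendsto_mult_right_zero[OF LIMSEQ_inverse_real_of_nat, of "R / 4"]
    by (simp add: r_def[abs_def] field_simps)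
  define k where "k y = rkern s (norm (x - y) ^ 2)" for y
  define M where "M n = measure \<nu> (ball x (r n))" for n
  have M: "c * r n ^ d \<le> M n" for n using low r[of n] by (auto simp: M_def)
  have M0: "0 < M n" for n using M[of n] c r[of n] by (metis less_le_trans mult_pos_pos zero_less_power)
  \<comment> \<open>The first entry serves poles at distance at least \<open>2 * r n\<close>, where
    \<open>dist x y - r n\<close> is at least half the distance; the second serves nearer poles,
    through \<open>pot_ball_le\<close> with radius \<open>3 * r n\<close>.\<close>
  define C' where "C' = max (2 powr s) (K * 3 powr (d - s) / c * 2 powr s)"
  have C': "0 < C'" by (simp add: C'_def less_max_iff_disj)
  define f where "f n y = (\<integral>\<^sup>+ z. rkern s (norm (y - z) ^ 2) * indicator (ball x (r n)) z \<partial>\<nu>)" for n y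
  \<comment> \<open>\<open>g n\<close> bounds the average over \<open>ball x (r n)\<close> of the kernel with pole \<open>y\<close>; it is dominated by the
    kernel itself and tends to it off the diagonal.\<close>
  define g where "g n y = (if 2 * r n \<le> dist x y then rkern s ((dist x y - r n)^2) else ennreal C' * k y)" for n y
  note sq = rkern_power2[of _ s]
  have ball_bd: "(\<integral>\<^sup>+ z. rkern s (norm (y - z) ^ 2) * indicator (ball y (3 * r n)) z \<partial>\<nu>)
      \<le> ennreal (K * (3 * r n) powr (d - s))" if "y \<in> A" "dist x y < R" for y n
    unfolding K_def using that r[of n] C s fin sm by (intro pot_ball_le up) auto
  have f_near: "f n y \<le> ennreal (K * (3 * r n) powr (d - s))" if "y \<in> A" "dist x y < 2 * r n" for n y
  proof -
    have "f n y \<le> (\<integral>\<^sup>+ z. rkern s (norm (y - z) ^ 2) * indicator (ball y (3 * r n)) z \<partial>\<nu>)"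
      unfolding f_def
    proof (intro nn_integral_mono mult_left_mono)
      fix z show "indicator (ball x (r n)) z \<le> (indicator (ball y (3 * r n)) z :: ennreal)"
        using that dist_triangle[of y z x] by (auto simp: indicator_def dist_commute)
    qed simp
    also have "\<dots> \<le> ennreal (K * (3 * r n) powr (d - s))"
      using that r[of n] by (intro ball_bd) auto
    finally show ?thesis .
  qed
  have fg: "f n y \<le> ennreal (M n) * g n y" if y: "y \<in> A" for n y
  proof (cases "2 * r n \<le> dist x y")
    case True
    have "f n y \<le> (\<integral>\<^sup>+ z. rkern s ((dist x y - r n)^2) * indicator (ball x (r n)) z \<partial>\<nu>)"
      unfolding f_def
    proof (intro nn_integral_mono)
      fix z
      show "rkern s (norm (y - z) ^ 2) * indicator (ball x (r n)) z \<le> rkern s ((dist x y - r n)^2) * indicator (ball x (r n)) z"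
        using True r[of n] s dist_triangle[of x y z]
        by (auto simp: indicator_def dist_norm norm_minus_commute intro!: rkern_antimono power_mono)
    qed
    also have "\<dots> = rkern s ((dist x y - r n)^2) * emeasure \<nu> (ball x (r n))"
      by (rule nn_integral_cmult_indicator) (simp add: sm)
    finally show ?thesis using True by (simp add: g_def M_def \<nu>.emeasure_eq_measure mult.commute)
  next
    case False
    show ?thesis
    proof (cases "x = y")
      case True
      then show ?thesis using False C' M0[of n] by (simp add: g_def k_def rkern_zero ennreal_mult_top)
    next
      case ne: False
      define \<rho> where "\<rho> = dist x y"
      have \<rho>: "0 < \<rho>" "\<rho> < 2 * r n" using ne False by (auto simp: \<rho>_def)
      have "f n y \<le> ennreal (K * (3 * r n) powr (d - s))" using f_near y False by auto
      also have "K * (3 * r n) powr (d - s) \<le> M n * (C' * \<rho> powr (- s))"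
      proof -
        have "K * (3 * r n) powr (d - s) = (c * r n ^ d) * (K * 3 powr (d - s) / c * r n powr (- s))"
          using r[of n] c by (simp add: powr_mult powr_diff powr_minus powr_realpow field_simps)
        also have "\<dots> \<le> M n * (K * 3 powr (d - s) / c * r n powr (- s))"
          using M K c by (intro mult_right_mono) auto
        also have "\<dots> \<le> M n * (C' * \<rho> powr (- s))"
        proof (intro mult_left_mono)
          have "r n powr (- s) \<le> (\<rho> / 2) powr (- s)"
            using \<rho> s by (intro powr_mono2') auto
          also have "(\<rho> / 2) powr (- s) = 2 powr s * \<rho> powr (- s)"
            using \<rho> by (simp add: powr_divide powr_minus field_simps)
          finally have "K * 3 powr (d - s) / c * r n powr (- s) \<le>
              K * 3 powr (d - s) / c * (2 powr s * \<rho> powr (- s))"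
            using K c by (intro mult_left_mono) auto
          also have "\<dots> = (K * 3 powr (d - s) / c * 2 powr s) * \<rho> powr (- s)" by simp
          also have "\<dots> \<le> C' * \<rho> powr (- s)"
            by (intro mult_right_mono) (auto simp: C'_def)
          finally show "K * 3 powr (d - s) / c * r n powr (- s) \<le> C' * \<rho> powr (- s)" .
        qed (use M0[of n] in simp)
        finally show ?thesis .
      qed
      also have "ennreal (M n * (C' * \<rho> powr (- s))) = ennreal (M n) * g n y"
        using False M0[of n] C' \<rho> by (simp add: g_def k_def ennreal_mult sq \<rho>_def dist_norm)
      finally show ?thesis by (simp add: ennreal_leI)
    qed
  qed
  have kM[measurable]: "k \<in> borel_measurable \<mu>" unfolding k_def by measurable
  have gM[measurable]: "g n \<in> borel_measurable \<mu>" for n unfolding g_def by measurable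
  have W_le: "wiener_const s A \<le> (\<integral>\<^sup>+ y. g n y \<partial>\<mu>)" for n
  proof -
    have [measurable]: "ball x (r n) \<in> sets \<nu>" by (simp add: sm)
    define \<kappa> where "\<kappa> = density \<nu> (indicator (ball x (r n)))"
    have \<kappa>: "fin_borel_measure_on A \<kappa>"
      unfolding \<kappa>_def by (rule fin_borel_measure_on_density[OF \<nu>]) simp
    have s\<kappa>: "sets \<kappa> = sets borel" "finite_measure \<kappa>" using \<kappa> by (auto simp: fin_borel_measure_on_def)
    have mass: "emeasure \<kappa> UNIV = ennreal (M n)"
      unfolding \<kappa>_def M_def \<nu>.emeasure_eq_measure[symmetric] by (subst emeasure_density) (auto simp: sm)
    have p\<kappa>: "pot s \<kappa> y 0 = f n y" for y
      unfolding pot_def \<kappa>_def f_def by (subst nn_integral_density_indicator) (auto simp: sm)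
    have "(\<integral>\<^sup>+ y. pot s \<kappa> y 0 \<partial>\<kappa>) = (\<integral>\<^sup>+ y. f n y * indicator (ball x (r n)) y \<partial>\<nu>)"
      unfolding p\<kappa>[symmetric] using pot_measurable[OF s\<kappa>(2) s\<kappa>(1), of borel]
      by (subst \<kappa>_def, subst nn_integral_density_indicator) (auto simp: sm)
    also have "\<dots> \<le> (\<integral>\<^sup>+ y. ennreal (K * (3 * r n) powr (d - s)) \<partial>\<nu>)"
      by (rule nn_integral_mono_AE) (use AE(2) r[of n] f_near in \<open>auto elim!: eventually_mono simp: indicator_def\<close>)
    also have "\<dots> < \<infinity>"
      using \<nu>.emeasure_finite[of "space \<nu>"] by (simp add: ennreal_mult_eq_top_iff less_top[symmetric])
    finally have "wiener_const s A * ennreal (M n) \<le> (\<integral>\<^sup>+ y. pot s \<mu> y 0 \<partial>\<kappa>)"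
      using equilibrium_variation[OF eq A W \<kappa>] mass by simp
    also have "\<dots> = (\<integral>\<^sup>+ y. f n y \<partial>\<mu>)"
      using pot_swap[OF fin(1) s\<kappa>(2) sm(1) s\<kappa>(1)] p\<kappa> by simp
    also have "\<dots> \<le> (\<integral>\<^sup>+ y. ennreal (M n) * g n y \<partial>\<mu>)"
      by (rule nn_integral_mono_AE) (use AE(1) fg in \<open>auto elim!: eventually_mono\<close>)
    also have "\<dots> = ennreal (M n) * (\<integral>\<^sup>+ y. g n y \<partial>\<mu>)"
      by (rule nn_integral_cmult) measurable
    finally have "ennreal (M n) * wiener_const s A \<le> ennreal (M n) * (\<integral>\<^sup>+ y. g n y \<partial>\<mu>)"
      by (simp add: mult.commute)
    then show ?thesis using M0[of n] by (subst (asm) ennreal_mult_le_mult_iff) auto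
  qed
  have kx: "pot s \<mu> x 0 = (\<integral>\<^sup>+ y. k y \<partial>\<mu>)" by (simp add: pot_def k_def)
  have "AE y in \<mu>. k y \<noteq> \<infinity>"
    using fx unfolding kx by (intro nn_integral_PInf_AE) auto
  then have ne: "AE y in \<mu>. y \<noteq> x" by (auto elim!: eventually_mono simp: k_def rkern_zero)
  have "(\<lambda>n. \<integral>\<^sup>+ y. g n y \<partial>\<mu>) \<longlonglongrightarrow> (\<integral>\<^sup>+ y. k y \<partial>\<mu>)"
  proof (rule nn_integral_dominated_convergence[where w = "\<lambda>y. ennreal C' * k y"])
    show "(\<integral>\<^sup>+ y. ennreal C' * k y \<partial>\<mu>) < \<infinity>"
      using fx unfolding kx by (simp add: nn_integral_cmult ennreal_mult_less_top)
    show "AE y in \<mu>. (\<lambda>n. g n y) \<longlonglongrightarrow> k y"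
      using ne
    proof (rule eventually_mono)
      fix y assume "y \<noteq> x"
      then have pos: "0 < dist x y" by simp
      have "eventually (\<lambda>n. r n < dist x y / 2) sequentially"
        using order_tendstoD(2)[OF rlim, of "dist x y / 2"] pos by simp
      then have ev: "eventually (\<lambda>n. rkern s ((dist x y - r n)^2) = g n y) sequentially"
        by (rule eventually_mono) (auto simp: g_def)
      have "(\<lambda>n. rkern s ((dist x y - r n)^2)) \<longlonglongrightarrow> rkern s ((dist x y - 0)^2)"
        by (rule continuous_on_tendsto_compose[OF continuous_on_rkern[OF s(1)]])
          (intro tendsto_intros rlim, auto)
      then show "(\<lambda>n. g n y) \<longlonglongrightarrow> k y"
        using ev by (auto simp: k_def dist_norm elim: Lim_transform_eventually)
    qed
    show "AE y in \<mu>. g n y \<le> ennreal C' * k y" for n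
      using ne
    proof (rule eventually_mono)
      fix y assume "y \<noteq> x"
      then have pos: "0 < dist x y" by simp
      show "g n y \<le> ennreal C' * k y"
      proof (cases "2 * r n \<le> dist x y")
        case True
        then have "dist x y / 2 \<le> dist x y - r n" by simp
        then have "rkern s ((dist x y - r n)^2) \<le> rkern s ((dist x y / 2)^2)"
          using s pos by (intro rkern_antimono power_mono) auto
        also have "\<dots> = ennreal (2 powr s * dist x y powr (- s))"
          using pos by (subst sq) (simp_all add: powr_divide powr_minus field_simps)
        also have "\<dots> \<le> ennreal (C' * dist x y powr (- s))"
          by (intro ennreal_leI mult_right_mono) (auto simp: C'_def)
        also have "\<dots> = ennreal C' * k y"
          using C' pos by (simp add: k_def sq ennreal_mult flip: dist_norm)
        finally show ?thesis using True by (simp add: g_def)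
      qed (simp add: g_def)
    qed
  qed measurable
  then show ?thesis unfolding kx by (rule LIMSEQ_le_const) (use W_le in auto)
qed (simp add: not_less top.extremum_unique)

lemma d_regular_at_potential_ge:
  fixes \<mu> :: "(real ^ 'p) measure" and d :: nat
  assumes eq: "equilibrium_measure s A \<mu>" and W: "wiener_const s A < \<infinity>"
    and s: "0 < s" "s < real d" and reg: "d_regular_at d A x0"
    and nontriv: "\<And>r. 0 < r \<Longrightarrow> \<exists>y\<in>A \<inter> ball x0 r. y \<noteq> x0"
  obtains R where "0 < R" "\<And>x. x \<in> A \<Longrightarrow> dist x0 x < R \<Longrightarrow> wiener_const s A \<le> pot s \<mu> x 0"
proof -
  obtain r1 where r1: "r1 > 0" and "d_regular d (A \<inter> ball x0 r1)" and "compact A" and x0: "x0 \<in> A"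
    using reg by (auto simp: d_regular_at_def)
  define E where "E = A \<inter> ball x0 r1"
  obtain \<nu> C0 where \<nu>: "fin_borel_measure_on E \<nu>" and C0: "C0 > 0"
    and reg: "\<And>x r. x \<in> E \<Longrightarrow> 0 < r \<Longrightarrow> r < diameter E \<Longrightarrow>
       inverse C0 * r ^ d \<le> measure \<nu> (ball x r) \<and> measure \<nu> (ball x r) \<le> C0 * r ^ d"
    using \<open>d_regular d (A \<inter> ball x0 r1)\<close> unfolding d_regular_def E_def by blast
  have A: "A \<in> sets borel" using \<open>compact A\<close> by (simp add: borel_compact)
  have bE: "bounded E" unfolding E_def by (simp add: bounded_Int)
  obtain y where y: "y \<in> E" "y \<noteq> x0" using nontriv[OF r1] by (auto simp: E_def)
  have "dist x0 y \<le> diameter E" using diameter_bounded_bound[OF bE, of x0 y] y x0 r1 by (auto simp: E_def)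
  then have D: "0 < diameter E" using y by (metis dist_pos_lt less_le_trans)
  define R where "R = min (r1 / 2) (diameter E)"
  have R: "0 < R" using r1 D by (simp add: R_def)
  have \<nu>A: "fin_borel_measure_on A \<nu>"
    using \<nu> by (auto simp: fin_borel_measure_on_def E_def elim!: eventually_mono)
  have "wiener_const s A \<le> pot s \<mu> x 0" if x: "x \<in> A" "dist x0 x < R" for x
  proof (rule equilibrium_potential_ge[OF eq A W s \<nu>A R C0])
    show "0 < inverse C0" using C0 by simp
    fix r :: real assume r: "0 < r" "r < R"
    show "inverse C0 * r ^ d \<le> measure \<nu> (ball x r)" using reg[of x r] x r by (auto simp: E_def R_def)
    fix y assume y: "y \<in> A" "dist x y < R"
    then have "dist x0 y < r1" using x dist_triangle[of x0 y x] by (auto simp: R_def)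
    then show "measure \<nu> (ball y r) \<le> C0 * r ^ d" using reg[of y r] y r by (auto simp: E_def R_def)
  qed
  then show thesis using that R by blast
qed

section \<open>Comparison with supersolutions of the extension equation\<close>

text \<open>A discretisation of \<open>h\<^sup>2 (\<Delta>\<^sub>x + 4 t \<partial>\<^sub>t\<^sup>2 + 2 \<alpha> \<partial>\<^sub>t)\<close>, monotone in the neighbouring values: it is
  nonnegative at a minimum. For \<open>t = 0\<close> the value at \<open>t - h\<close> has coefficient \<open>0\<close>.\<close>

definition Dh :: "real \<Rightarrow> real \<Rightarrow> (real ^ 'p \<Rightarrow> real \<Rightarrow> real) \<Rightarrow> real ^ 'p \<Rightarrow> real \<Rightarrow> real" where
  "Dh \<alpha> h f x t = (\<Sum>i\<in>UNIV. f (x + h *\<^sub>R axis i 1) t + f (x - h *\<^sub>R axis i 1) t - 2 * f x t)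
     + 4 * t * (f x (t + h) + f x (t - h) - 2 * f x t) + 2 * \<alpha> * h * (f x (t + h) - f x t)"

section \<open>Consistency of the difference operator on kernels and on their superposition\<close>

lemma powr_taylor_bound:
  fixes \<sigma> q \<epsilon> \<delta> :: real
  assumes \<sigma>: "0 < \<sigma>" and \<delta>: "0 < \<delta>" "\<delta> \<le> q" and \<epsilon>: "\<bar>\<epsilon>\<bar> \<le> \<delta> / 2"
  shows "(q + \<epsilon>) powr (- \<sigma>) \<le> q powr (- \<sigma>) - \<sigma> * q powr (- \<sigma> - 1) * \<epsilon>
     + \<sigma> * (\<sigma> + 1) * q powr (- \<sigma> - 2) * \<epsilon>^2 / 2
     + \<sigma> * (\<sigma> + 1) * (\<sigma> + 2) * (\<delta> / 2) powr (- \<sigma> - 3) * \<bar>\<epsilon>\<bar>^3"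
proof (cases "\<epsilon> = 0")
  case False
  define D where "D m x = (\<Prod>i<m. - \<sigma> - real i) * x powr (- \<sigma> - real m)" for m :: nat and x :: real
  have "\<exists>t. (if q + \<epsilon> < q then q + \<epsilon> < t \<and> t < q else q < t \<and> t < q + \<epsilon>) \<and>
      D 0 (q + \<epsilon>) = (\<Sum>m<3. D m q / fact m * (q + \<epsilon> - q) ^ m) + D 3 t / fact 3 * (q + \<epsilon> - q) ^ 3"
  \<comment> \<open>All intermediate points stay above \<open>\<delta> / 2\<close>, so the remainder
    constant depends only on \<sigma> and \<delta> and is uniform in \<open>q\<close>.\<close>
  proof (rule Taylor[where a = "\<delta> / 2" and b = "q + \<delta>"])
    show "\<forall>(m::nat) t. m < 3 \<and> \<delta> / 2 \<le> t \<and> t \<le> q + \<delta> \<longrightarrow> (D m has_real_derivative D (Suc m) t) (at t)"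
    proof (intro allI impI)
      fix m :: nat and t :: real assume "m < 3 \<and> \<delta> / 2 \<le> t \<and> t \<le> q + \<delta>"
      then have "0 < t" using \<delta> by linarith
      then show "(D m has_real_derivative D (Suc m) t) (at t)"
        unfolding D_def by (auto intro!: derivative_eq_intros simp: algebra_simps)
    qed
  qed (use \<delta> \<epsilon> False in auto)
  then obtain t where t: "if q + \<epsilon> < q then q + \<epsilon> < t \<and> t < q else q < t \<and> t < q + \<epsilon>"
    and eq: "D 0 (q + \<epsilon>) = (\<Sum>m<3. D m q / fact m * \<epsilon> ^ m) + D 3 t / fact 3 * \<epsilon> ^ 3" by auto
  have tq: "\<delta> / 2 \<le> t" using t \<epsilon> \<delta> by (auto split: if_splits)
  have "D 3 t = - (\<sigma> * (\<sigma> + 1) * (\<sigma> + 2) * t powr (- \<sigma> - 3))"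
    by (simp add: D_def numeral_3_eq_3 algebra_simps)
  then have "\<bar>D 3 t\<bar> = \<sigma> * (\<sigma> + 1) * (\<sigma> + 2) * t powr (- \<sigma> - 3)" using \<sigma> by simp
  also have "\<dots> \<le> \<sigma> * (\<sigma> + 1) * (\<sigma> + 2) * (\<delta> / 2) powr (- \<sigma> - 3)"
    using \<sigma> tq \<delta> by (intro mult_left_mono powr_mono2') auto
  finally have B: "\<bar>D 3 t\<bar> \<le> \<sigma> * (\<sigma> + 1) * (\<sigma> + 2) * (\<delta> / 2) powr (- \<sigma> - 3)" .
  have "D 3 t / fact 3 * \<epsilon> ^ 3 \<le> \<bar>D 3 t / fact 3 * \<epsilon> ^ 3\<bar>" by (rule abs_ge_self)
  also have "\<dots> = \<bar>D 3 t\<bar> / 6 * \<bar>\<epsilon>\<bar> ^ 3" by (simp add: abs_mult power_abs fact_numeral)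
  also have "\<dots> \<le> \<bar>D 3 t\<bar> * \<bar>\<epsilon>\<bar> ^ 3" by (intro mult_right_mono) auto
  also have "\<dots> \<le> \<sigma> * (\<sigma> + 1) * (\<sigma> + 2) * (\<delta> / 2) powr (- \<sigma> - 3) * \<bar>\<epsilon>\<bar> ^ 3"
    by (intro mult_right_mono B) auto
  finally have "D 3 t / fact 3 * \<epsilon> ^ 3 \<le> \<sigma> * (\<sigma> + 1) * (\<sigma> + 2) * (\<delta> / 2) powr (- \<sigma> - 3) * \<bar>\<epsilon>\<bar> ^ 3" .
  moreover have "(\<Sum>m<3. D m q / fact m * \<epsilon> ^ m) = q powr (- \<sigma>) - \<sigma> * q powr (- \<sigma> - 1) * \<epsilon>
     + \<sigma> * (\<sigma> + 1) * q powr (- \<sigma> - 2) * \<epsilon>^2 / 2"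
    by (simp add: D_def numeral_3_eq_3 fact_numeral power2_eq_square algebra_simps)
  moreover have "D 0 (q + \<epsilon>) = (q + \<epsilon>) powr (- \<sigma>)" by (simp add: D_def)
  ultimately show ?thesis using eq by linarith
qed simp

lemma norm_add_axis_power2:
  fixes z :: "real ^ 'p"
  shows "norm (z + h *\<^sub>R axis i 1) ^ 2 = norm z ^ 2 + (h^2 + 2 * h * z $ i)"
  unfolding power2_norm_eq_inner
  by (simp add: inner_add_left inner_add_right inner_axis inner_axis' inner_commute power2_eq_square algebra_simps inner_axis_axis)

text \<open>The extended kernel solves the equation exactly, so the terms of order
  \<open>h^2\<close> cancel and an error of order \<open>h^3\<close> remains. Its constant depends
  on the point and the pole only through \<delta> and \<open>B\<close>, which permits integration
  over \<open>y\<close>.\<close>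

lemma Dh_kernel_le:
  fixes x y :: "real ^ 'p" and s \<alpha> t h B M G \<delta> :: real
  assumes s: "0 < s" and \<alpha>: "\<alpha> = s + 2 - CARD('p)" "0 \<le> \<alpha>" and t: "0 \<le> t" "t \<le> B"
    and \<delta>: "0 < \<delta>" "\<delta> \<le> norm (x - y) ^ 2 + t" and B: "norm (x - y) \<le> B"
    and h: "0 < h" "h \<le> 1" "h * (1 + 2 * B) \<le> \<delta> / 2"
    and M: "M = s/2 * (s/2 + 1) * (s/2 + 2) * (\<delta> / 2) powr (- (s/2) - 3)"
    and G: "G = s/2 * (s/2 + 1) * \<delta> powr (- (s/2) - 2)"
  shows "Dh \<alpha> h (\<lambda>x t. (norm (x - y) ^ 2 + t) powr (- s / 2)) x t
    \<le> (CARD('p) * (G + 2 * M * (1 + 2 * B)^3) + 8 * B * M + 2 * \<alpha> * (G + M)) * h^3"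
proof -
  define \<sigma> where "\<sigma> = s / 2"
  define z where "z = x - y"
  define q where "q = norm z ^ 2 + t"
  define g where "g a = a powr (- \<sigma>)" for a :: real
  define g1 where "g1 = \<sigma> * q powr (- \<sigma> - 1)"
  define g2 where "g2 = \<sigma> * (\<sigma> + 1) * q powr (- \<sigma> - 2)"
  have \<sigma>: "0 < \<sigma>" using s by (simp add: \<sigma>_def)
  have q: "\<delta> \<le> q" "0 < q" using \<delta> by (auto simp: q_def z_def)
  have B0: "0 \<le> B" using t by simp
  have M0: "0 \<le> M" using s by (simp add: M)
  have g20: "0 \<le> g2" "g2 \<le> G" using \<sigma> q \<delta>
    by (auto simp: g2_def G \<sigma>_def[symmetric] intro!: mult_left_mono powr_mono2')
  have rel: "q * g2 = (\<sigma> + 1) * g1"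
  proof -
    have "q * q powr (- \<sigma> - 2) = q powr 1 * q powr (- \<sigma> - 2)" using q by simp
    also have "\<dots> = q powr (- \<sigma> - 1)" unfolding powr_add[symmetric] by (rule arg_cong[where f = "(powr) q"]) simp
    finally show ?thesis by (simp add: g1_def g2_def algebra_simps)
  qed
  have T: "g (q + e) \<le> g q - g1 * e + g2 * e^2 / 2 + M * \<bar>e\<bar>^3" if "\<bar>e\<bar> \<le> \<delta> / 2" for e
    using powr_taylor_bound[OF \<sigma> \<delta>(1) q(1) that] by (simp add: g_def g1_def g2_def M \<sigma>_def)
  have pair: "g (q + a) + g (q + b) - 2 * g q \<le>
       - g1 * (a + b) + g2 * (a^2 + b^2) / 2 + (M * \<bar>a\<bar>^3 + M * \<bar>b\<bar>^3)"
    if "\<bar>a\<bar> \<le> \<delta> / 2" "\<bar>b\<bar> \<le> \<delta> / 2" for a b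
    using T[OF that(1)] T[OF that(2)] by (simp add: algebra_simps add_divide_distrib)
  have zi: "\<bar>z $ i\<bar> \<le> B" for i using component_le_norm_cart[of z i] B by (simp add: z_def)
  have hh: "h^2 \<le> h" "h ^ 4 \<le> h ^ 3" using h by (auto simp: power2_eq_square mult_le_cancel_left1 intro!: power_decreasing)
  have hB: "h * (1 + 2 * B) = h + 2 * (h * B)" by (simp add: algebra_simps)
  have eb: "\<bar>h^2 + 2 * h * z $ i\<bar> \<le> h * (1 + 2 * B)" "\<bar>h^2 - 2 * h * z $ i\<bar> \<le> h * (1 + 2 * B)" for i
  proof -
    have "\<bar>h * z $ i\<bar> \<le> h * B" using zi[of i] h by (simp add: abs_mult)
    moreover have "0 \<le> h^2" by simp
    ultimately show "\<bar>h^2 + 2 * h * z $ i\<bar> \<le> h * (1 + 2 * B)" "\<bar>h^2 - 2 * h * z $ i\<bar> \<le> h * (1 + 2 * B)"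
      unfolding hB using hh(1) by linarith+
  qed
  have cube: "M * \<bar>e\<bar>^3 \<le> M * (1 + 2 * B)^3 * h^3" if "\<bar>e\<bar> \<le> h * (1 + 2 * B)" for e :: real
  proof -
    have "\<bar>e\<bar>^3 \<le> (h * (1 + 2 * B))^3" using that by (intro power_mono) auto
    then have "M * \<bar>e\<bar>^3 \<le> M * (h * (1 + 2 * B))^3" using M0 by (rule mult_left_mono)
    then show ?thesis by (simp add: power_mult_distrib mult_ac)
  qed
  have xi: "g (q + (h^2 + 2 * h * z $ i)) + g (q + (h^2 - 2 * h * z $ i)) - 2 * g q
     \<le> - 2 * g1 * h^2 + 4 * g2 * h^2 * (z $ i)^2 + (G + 2 * M * (1 + 2 * B)^3) * h^3" for i
  proof -
    let ?a = "h^2 + 2 * h * z $ i" and ?b = "h^2 - 2 * h * z $ i"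
    have "g (q + ?a) + g (q + ?b) - 2 * g q \<le>
       - g1 * (?a + ?b) + g2 * (?a^2 + ?b^2) / 2 + (M * \<bar>?a\<bar>^3 + M * \<bar>?b\<bar>^3)"
      using eb[of i] h(3) by (intro pair) auto
    also have "M * \<bar>?a\<bar>^3 + M * \<bar>?b\<bar>^3 \<le> 2 * M * (1 + 2 * B)^3 * h^3"
      using cube[OF eb(1)[of i]] cube[OF eb(2)[of i]] by linarith
    also have "- g1 * (?a + ?b) + g2 * (?a^2 + ?b^2) / 2 = - 2 * g1 * h^2 + 4 * g2 * h^2 * (z $ i)^2 + g2 * h^4"
      by (simp add: power2_eq_square power4_eq_xxxx algebra_simps)
    also have "g2 * h^4 \<le> G * h^3" using g20 hh h by (intro mult_mono) auto
    finally show ?thesis by (simp add: algebra_simps)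
  qed
  have k1: "(norm (x + h *\<^sub>R axis i 1 - y) ^ 2 + t) powr (- s / 2) = g (q + (h^2 + 2 * h * z $ i))" for i
  proof -
    have e: "x + h *\<^sub>R axis i 1 - y = z + h *\<^sub>R axis i 1" by (simp add: z_def)
    show ?thesis unfolding e norm_add_axis_power2 by (simp add: g_def q_def \<sigma>_def algebra_simps)
  qed
  have k2: "(norm (x - h *\<^sub>R axis i 1 - y) ^ 2 + t) powr (- s / 2) = g (q + (h^2 - 2 * h * z $ i))" for i
  proof -
    have e: "x - h *\<^sub>R axis i 1 - y = z + (- h) *\<^sub>R axis i 1" by (simp add: z_def)
    show ?thesis unfolding e norm_add_axis_power2 by (simp add: g_def q_def \<sigma>_def algebra_simps)
  qed
  have k3: "(norm (x - y) ^ 2 + t) powr (- s / 2) = g q" "(norm (x - y) ^ 2 + (t + h)) powr (- s / 2) = g (q + h)"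
     "(norm (x - y) ^ 2 + (t - h)) powr (- s / 2) = g (q + (- h))"
    by (auto simp: g_def q_def z_def \<sigma>_def algebra_simps)
  have hd: "h \<le> \<delta> / 2" using h B0 mult_nonneg_nonneg[of h B] unfolding hB by linarith
  have S: "(\<Sum>i\<in>UNIV. g (q + (h^2 + 2 * h * z $ i)) + g (q + (h^2 - 2 * h * z $ i)) - 2 * g q)
    \<le> CARD('p) * (- 2 * g1 * h^2 + (G + 2 * M * (1 + 2 * B)^3) * h^3) + 4 * g2 * h^2 * norm z ^ 2"
  proof -
    have "(\<Sum>i\<in>UNIV. (z $ i)^2) = norm z ^ 2"
      unfolding power2_norm_eq_inner inner_vec_def by (simp add: power2_eq_square)
    then have e: "(\<Sum>i\<in>UNIV. a + b * (z $ i)^2 + c) = CARD('p) * (a + c) + b * norm z ^ 2" for a b c :: real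
      by (simp add: sum.distrib algebra_simps flip: sum_distrib_left)
    have "(\<Sum>i\<in>UNIV. g (q + (h^2 + 2 * h * z $ i)) + g (q + (h^2 - 2 * h * z $ i)) - 2 * g q)
      \<le> (\<Sum>i\<in>UNIV. - 2 * g1 * h^2 + 4 * g2 * h^2 * (z $ i)^2 + (G + 2 * M * (1 + 2 * B)^3) * h^3)"
      by (intro sum_mono xi)
    then show ?thesis unfolding e .
  qed
  have Tt: "4 * t * (g (q + h) + g (q + - h) - 2 * g q) \<le> 4 * t * (g2 * h^2) + 8 * B * M * h^3"
  proof -
    have "g (q + h) + g (q + - h) - 2 * g q \<le> g2 * h^2 + 2 * M * h^3"
      using T[of h] T[of "- h"] hd h by (simp add: algebra_simps)
    then have "4 * t * (g (q + h) + g (q + - h) - 2 * g q) \<le> 4 * t * (g2 * h^2 + 2 * M * h^3)"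
      using t by (intro mult_left_mono) auto
    also have "\<dots> = 4 * t * (g2 * h^2) + 8 * t * (M * h^3)" by (simp add: algebra_simps)
    also have "8 * t * (M * h^3) \<le> 8 * B * (M * h^3)"
      using t M0 h by (intro mult_right_mono) auto
    finally show ?thesis by (simp add: mult_ac)
  qed
  have Ta: "2 * \<alpha> * h * (g (q + h) - g q) \<le> - 2 * \<alpha> * g1 * h^2 + 2 * \<alpha> * (G + M) * h^3"
  proof -
    have "g (q + h) - g q \<le> - g1 * h + g2 * h^2 / 2 + M * h^3"
      using T[of h] hd h by (simp add: algebra_simps)
    also have "g2 * h^2 / 2 \<le> G * h^2" using mult_right_mono[OF g20(2), of "h^2"] mult_nonneg_nonneg[OF g20(1), of "h^2"] by simp
    also have "M * h^3 \<le> M * h^2" using M0 h by (intro mult_left_mono power_decreasing) auto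
    finally have "2 * \<alpha> * h * (g (q + h) - g q) \<le> 2 * \<alpha> * h * (- g1 * h + G * h^2 + M * h^2)"
      using \<alpha> h by (intro mult_left_mono) auto
    then show ?thesis by (simp add: power2_eq_square power3_eq_cube algebra_simps)
  qed
  \<comment> \<open>Here the exact value of \<alpha> enters: \<open>CARD('p) + \<alpha>\<close>
    equals \<open>s + 2\<close>, which is twice the factor \<open>\<sigma> + 1\<close> in
    \<open>rel\<close>.\<close>
  have zero: "CARD('p) * (- 2 * g1 * h^2) + 4 * g2 * h^2 * norm z ^ 2 + 4 * t * (g2 * h^2) - 2 * \<alpha> * g1 * h^2 = 0"
  proof -
    have "CARD('p) * (- 2 * g1 * h^2) + 4 * g2 * h^2 * norm z ^ 2 + 4 * t * (g2 * h^2) - 2 * \<alpha> * g1 * h^2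
      = h^2 * (4 * (q * g2) - 2 * (CARD('p) + \<alpha>) * g1)" by (simp add: q_def algebra_simps)
    also have "4 * (q * g2) - 2 * (CARD('p) + \<alpha>) * g1 = 0" unfolding rel by (simp add: \<alpha> \<sigma>_def algebra_simps)
    finally show ?thesis by simp
  qed
  have "Dh \<alpha> h (\<lambda>x t. (norm (x - y) ^ 2 + t) powr (- s / 2)) x t =
     (\<Sum>i\<in>UNIV. g (q + (h^2 + 2 * h * z $ i)) + g (q + (h^2 - 2 * h * z $ i)) - 2 * g q)
     + 4 * t * (g (q + h) + g (q + - h) - 2 * g q) + 2 * \<alpha> * h * (g (q + h) - g q)"
    unfolding Dh_def k1 k2 k3 ..
  also have "\<dots> \<le> (CARD('p) * (- 2 * g1 * h^2 + (G + 2 * M * (1 + 2 * B)^3) * h^3) + 4 * g2 * h^2 * norm z ^ 2)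
      + (4 * t * (g2 * h^2) + 8 * B * M * h^3) + (- 2 * \<alpha> * g1 * h^2 + 2 * \<alpha> * (G + M) * h^3)"
    by (intro add_mono S Tt Ta)
  also have "\<dots> = (CARD('p) * (- 2 * g1 * h^2) + 4 * g2 * h^2 * norm z ^ 2 + 4 * t * (g2 * h^2) - 2 * \<alpha> * g1 * h^2)
     + (CARD('p) * (G + 2 * M * (1 + 2 * B)^3) + 8 * B * M + 2 * \<alpha> * (G + M)) * h^3"
    by (simp add: algebra_simps)
  finally show ?thesis unfolding zero by simp
qed

text \<open>A real-valued form of \<open>pot\<close>, meant for points off \<open>A\<close> or at
  positive height. Elsewhere it may differ from \<open>pot\<close>: at \<open>t = 0\<close> its
  integrand is \<open>0\<close> on the diagonal, and a divergent integral is \<open>0\<close> by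
  convention.\<close>

definition vpot :: "real \<Rightarrow> (real ^ 'p) measure \<Rightarrow> real ^ 'p \<Rightarrow> real \<Rightarrow> real" where
  "vpot s \<mu> x t = (\<integral> y. (norm (x - y) ^ 2 + t) powr (- s / 2) \<partial>\<mu>)"

lemma vpot_nonneg: "0 \<le> vpot s \<mu> x t"
  unfolding vpot_def by (rule integral_nonneg_AE) simp

lemma
  fixes \<mu> :: "(real ^ 'p) measure"
  assumes s: "0 < s" and \<mu>: "fin_borel_measure_on A \<mu>" and \<delta>: "0 < \<delta>" "\<And>y. y \<in> A \<Longrightarrow> \<delta> \<le> norm (x - y) ^ 2 + t"
  shows integrable_vpot: "integrable \<mu> (\<lambda>y. (norm (x - y) ^ 2 + t) powr (- s / 2))"
    and pot_eq_vpot: "pot s \<mu> x t = ennreal (vpot s \<mu> x t)"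
proof -
  have sm[measurable_cong]: "sets \<mu> = sets borel" and fin: "finite_measure \<mu>" and AE: "AE y in \<mu>. y \<in> A"
    using \<mu> by (auto simp: fin_borel_measure_on_def)
  interpret finite_measure \<mu> by fact
  show int: "integrable \<mu> (\<lambda>y. (norm (x - y) ^ 2 + t) powr (- s / 2))"
  proof (rule integrable_const_bound[of _ "\<delta> powr (- s / 2)"])
    show "AE y in \<mu>. norm ((norm (x - y) ^ 2 + t) powr (- s / 2)) \<le> \<delta> powr (- s / 2)"
      using AE by (rule eventually_mono) (use s \<delta> in \<open>auto intro!: powr_mono2'\<close>)
  qed measurable
  have "pot s \<mu> x t = (\<integral>\<^sup>+ y. ennreal ((norm (x - y) ^ 2 + t) powr (- s / 2)) \<partial>\<mu>)"
    unfolding pot_def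
  proof (rule nn_integral_cong_AE, use AE in \<open>rule eventually_mono\<close>)
    fix y assume "y \<in> A"
    then have "0 < norm (x - y) ^ 2 + t" using \<delta> by force
    then show "rkern s (norm (x - y) ^ 2 + t) = ennreal ((norm (x - y) ^ 2 + t) powr (- s / 2))"
      by (rule rkern_pos)
  qed
  also have "\<dots> = ennreal (vpot s \<mu> x t)"
    unfolding vpot_def by (intro nn_integral_eq_integral int) auto
  finally show "pot s \<mu> x t = ennreal (vpot s \<mu> x t)" .
qed

text \<open>The kernel estimate integrated over \<mu>. The constant may depend on
  \<open>(x, t)\<close>, since it is used at a single minimum, but not on \<open>h\<close>.\<close>

lemma Dh_vpot_le:
  fixes \<mu> :: "(real ^ 'p) measure" and s \<alpha> t \<delta> :: real
  assumes s: "0 < s" and \<alpha>: "\<alpha> = s + 2 - CARD('p)" "0 \<le> \<alpha>" and t: "0 \<le> t"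
    and \<mu>: "fin_borel_measure_on A \<mu>" and A: "bounded A"
    and \<delta>: "0 < \<delta>" "\<And>y. y \<in> A \<Longrightarrow> \<delta> \<le> norm (x - y) ^ 2 + t"
  obtains C h0 where "0 < h0" "0 \<le> C" "\<And>h. 0 < h \<Longrightarrow> h < h0 \<Longrightarrow> Dh \<alpha> h (vpot s \<mu>) x t \<le> C * h ^ 3"
proof -
  interpret finite_measure \<mu> using \<mu> by (simp add: fin_borel_measure_on_def)
  have AE: "AE y in \<mu>. y \<in> A" using \<mu> by (auto simp: fin_borel_measure_on_def)
  obtain B0 where B0: "\<And>y. y \<in> A \<Longrightarrow> norm y \<le> B0" using A by (auto simp: bounded_iff)
  define B where "B = norm x + \<bar>B0\<bar> + t"
  have B: "norm (x - y) \<le> B" if "y \<in> A" for y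
    using B0[OF that] t norm_triangle_ineq4[of x y] by (simp add: B_def)
  have tB: "t \<le> B" "0 \<le> B" using t by (auto simp: B_def)
  define M where "M = s/2 * (s/2 + 1) * (s/2 + 2) * (\<delta> / 2) powr (- (s/2) - 3)"
  define G where "G = s/2 * (s/2 + 1) * \<delta> powr (- (s/2) - 2)"
  define C where "C = CARD('p) * (G + 2 * M * (1 + 2 * B)^3) + 8 * B * M + 2 * \<alpha> * (G + M)"
  have MG: "0 \<le> M" "0 \<le> G" using s by (auto simp: M_def G_def)
  then have C: "0 \<le> C" using tB \<alpha> by (auto simp: C_def)
  define h0 where "h0 = min 1 (\<delta> / (2 * (1 + 2 * B)))"
  have h0: "0 < h0" using \<delta> tB by (auto simp: h0_def)
  have "Dh \<alpha> h (vpot s \<mu>) x t \<le> (C * measure \<mu> (space \<mu>)) * h ^ 3" if h: "0 < h" "h < h0" for h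
  proof -
    have h': "h \<le> 1" "h * (1 + 2 * B) \<le> \<delta> / 2"
      using h tB by (auto simp: h0_def field_simps)
    define k where "k y x t = (norm (x - y) ^ 2 + t) powr (- s / 2)" for y x :: "real ^ 'p" and t :: real
    \<comment> \<open>All neighbours in \<open>Dh\<close> keep half of the separation. For
      \<open>t = 0\<close> this includes the point at height \<open>- h\<close>, so that even the
      term with coefficient \<open>0\<close> is integrable.\<close>
    have far: "\<delta> / 2 \<le> norm (x' - y) ^ 2 + t'"
      if y: "y \<in> A" and near: "x' = x \<and> \<bar>t' - t\<bar> \<le> h \<or> t' = t \<and> norm (x' - x) = h" for x' t' y
    proof -
      have "h + 2 * (h * B) \<le> \<delta> / 2" using h' by (simp add: algebra_simps)
      moreover have "0 \<le> h * B" using h tB by simp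
      ultimately have "h \<le> \<delta> / 2" by linarith
      moreover have "norm (x - y) ^ 2 - 2 * h * B \<le> norm (x' - y) ^ 2" if "norm (x' - x) = h"
      proof -
        have "norm (x - y) \<le> norm (x' - y) + h"
          using norm_triangle_ineq[of "x' - y" "x - x'"] that by (simp add: norm_minus_commute)
        then have "norm (x - y) - h \<le> norm (x' - y)" by simp
        show ?thesis
        proof (cases "h \<le> norm (x - y)")
          case True
          then have "(norm (x - y) - h) ^ 2 \<le> norm (x' - y) ^ 2"
            using \<open>norm (x - y) - h \<le> norm (x' - y)\<close> by (intro power_mono) auto
          moreover have "h * norm (x - y) \<le> h * B" using B[OF y] h by (intro mult_left_mono) auto
          moreover have "0 \<le> h^2" by simp
          moreover have "(norm (x - y) - h) ^ 2 = norm (x - y) ^ 2 + h ^ 2 - 2 * (h * norm (x - y))"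
            by (simp add: power2_diff)
          ultimately show ?thesis by linarith
        next
          case False
          then have "norm (x - y) * norm (x - y) \<le> h * B" using B[OF y] h by (intro mult_mono) auto
          moreover have "0 \<le> norm (x' - y) ^ 2" "0 \<le> h * B" using h tB by auto
          ultimately show ?thesis unfolding power2_eq_square[of "norm (x - y)"] by linarith
        qed
      qed
      moreover have "2 * h * B \<le> \<delta> / 2" using h' h tB by (simp add: algebra_simps)
      ultimately show ?thesis using near \<delta>(2)[OF y] by (auto simp: abs_le_iff)
    qed
    have int: "integrable \<mu> (\<lambda>y. k y x' t')"
      if "x' = x \<and> \<bar>t' - t\<bar> \<le> h \<or> t' = t \<and> norm (x' - x) = h" for x' t'
      unfolding k_def by (rule integrable_vpot[OF s \<mu>, of "\<delta> / 2"]) (use \<delta> far that in auto)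
    have ints: "integrable \<mu> (\<lambda>y. k y (x + h *\<^sub>R axis i 1) t)" "integrable \<mu> (\<lambda>y. k y (x - h *\<^sub>R axis i 1) t)"
      "integrable \<mu> (\<lambda>y. k y x t)" "integrable \<mu> (\<lambda>y. k y x (t + h))" "integrable \<mu> (\<lambda>y. k y x (t - h))" for i
      using h by (auto intro!: int)
    have v: "vpot s \<mu> x' t' = (\<integral> y. k y x' t' \<partial>\<mu>)" for x' t' by (simp add: vpot_def k_def)
    have intD: "integrable \<mu> (\<lambda>y. Dh \<alpha> h (k y) x t)"
      unfolding Dh_def by (intro Bochner_Integration.integrable_add Bochner_Integration.integrable_sum integrable_mult_right Bochner_Integration.integrable_diff ints)
    have "Dh \<alpha> h (vpot s \<mu>) x t = (\<integral> y. Dh \<alpha> h (k y) x t \<partial>\<mu>)"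
      unfolding Dh_def v
      by (simp add: ints Bochner_Integration.integral_add Bochner_Integration.integral_sum
        Bochner_Integration.integral_diff)
    also have "\<dots> \<le> (\<integral> y. C * h ^ 3 \<partial>\<mu>)"
    proof (rule integral_mono_AE[OF intD])
      show "AE y in \<mu>. Dh \<alpha> h (k y) x t \<le> C * h ^ 3"
        using AE
      proof (rule eventually_mono)
        fix y assume y: "y \<in> A"
        show "Dh \<alpha> h (k y) x t \<le> C * h ^ 3"
          unfolding k_def C_def
          by (rule Dh_kernel_le[OF s \<alpha> t tB(1) \<delta>(1) \<delta>(2)[OF y] B[OF y] h(1) h' M_def G_def])
      qed
    qed simp
    finally show ?thesis by (simp add: mult_ac)
  qed
  moreover have "0 \<le> C * measure \<mu> (space \<mu>)" using C by simp
  ultimately show thesis using h0 that by blast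
qed

text \<open>Minimum principle for \<open>vpot\<close> plus \<open>b\<close> on the cylinder with
  \<open>A\<close> at height zero removed. Towards the removed set \<open>bottom\<close> and
  semicontinuity keep limits above \<open>w\<close>; on the side and the top the barrier alone does.
  A smaller infimum is thus attained at a point where \<open>Dh\<close> of the sum is nonnegative
  for small \<open>h\<close>, against the strict inequality for \<open>b\<close>.\<close>

lemma vpot_comparison:
  fixes \<mu> :: "(real ^ 'p) measure" and b :: "real ^ 'p \<Rightarrow> real \<Rightarrow> real" and s \<alpha> R T w :: real
  assumes s: "0 < s" and \<alpha>: "\<alpha> = s + 2 - CARD('p)" "0 \<le> \<alpha>"
    and A: "compact A" and \<mu>: "fin_borel_measure_on A \<mu>"
    and bottom: "\<And>x. x \<in> A \<Longrightarrow> dist x0 x \<le> R \<Longrightarrow> ennreal w \<le> pot s \<mu> x 0"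
    and b: "continuous_on (cball x0 R \<times> {0..T}) (\<lambda>(x, t). b x t)"
    and b0: "\<And>x t. dist x0 x \<le> R \<Longrightarrow> 0 \<le> t \<Longrightarrow> t \<le> T \<Longrightarrow> 0 \<le> b x t"
    and lateral: "\<And>x t. dist x0 x = R \<Longrightarrow> 0 \<le> t \<Longrightarrow> t \<le> T \<Longrightarrow> w \<le> b x t"
    and top: "\<And>x. dist x0 x \<le> R \<Longrightarrow> w \<le> b x T"
    and super: "\<And>x t. dist x0 x < R \<Longrightarrow> 0 \<le> t \<Longrightarrow> t < T \<Longrightarrow> x \<notin> A \<or> 0 < t \<Longrightarrow>
      \<exists>c>0. \<exists>h0>0. \<forall>h. 0 < h \<and> h < h0 \<longrightarrow> Dh \<alpha> h b x t \<le> - c * h ^ 2"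
    and z1: "dist x0 x1 \<le> R" "0 < t1" "t1 \<le> T"
  shows "w \<le> vpot s \<mu> x1 t1 + b x1 t1"
proof (rule ccontr)
  assume neg: "\<not> ?thesis"
  have sm: "sets \<mu> = sets borel" using \<mu> by (simp add: fin_borel_measure_on_def)
  define F where "F z = vpot s \<mu> (fst z) (snd z) + b (fst z) (snd z)" for z
  define D where "D = cball x0 R \<times> {0..T}"
  \<comment> \<open>Points of \<open>A\<close> at height zero are left out because
    \<open>vpot\<close> is not reliable there; the price is that \<open>S\<close> need not be
    compact.\<close>
  define S where "S = {z \<in> D. fst z \<notin> A \<or> 0 < snd z}"
  have S1: "(x1, t1) \<in> S" using z1 by (auto simp: S_def D_def)
  have F0: "0 \<le> F z" if "z \<in> D" for z
    using that b0[of "fst z" "snd z"] vpot_nonneg[of s \<mu> "fst z" "snd z"] by (auto simp: F_def D_def)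
  have bdd: "bdd_below (F ` S)" by (rule bdd_belowI2[where m = 0]) (auto simp: S_def F0)
  define m where "m = Inf (F ` S)"
  have m_le: "m \<le> F z" if "z \<in> S" for z unfolding m_def using bdd that by (intro cINF_lower)
  have mw: "m < w" using m_le[OF S1] neg by (simp add: F_def)
  have sep: "\<exists>\<delta>>0. \<forall>y\<in>A. \<delta> \<le> norm (fst z - y) ^ 2 + snd z" if "z \<in> S" for z
  proof (cases "0 < snd z")
    case True
    then show ?thesis by (intro exI[of _ "snd z"]) auto
  next
    case False
    then have "fst z \<notin> A" "snd z = 0" using that by (auto simp: S_def D_def)
    then obtain d where d: "0 < d" "\<And>y. y \<in> A \<Longrightarrow> d \<le> dist (fst z) y"
      using separate_point_closed[OF compact_imp_closed[OF A]] by blast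
    then show ?thesis using \<open>snd z = 0\<close> by (intro exI[of _ "d^2"]) (auto simp: dist_norm intro!: power_mono)
  qed
  have pv: "pot s \<mu> (fst z) (snd z) = ennreal (vpot s \<mu> (fst z) (snd z))" if z: "z \<in> S" for z
    using sep[OF z] pot_eq_vpot[OF s \<mu>] by blast
  have "\<exists>z\<in>S. F z < m + inverse (real (Suc n))" for n
  proof -
    have "m < m + inverse (real (Suc n))" by simp
    then show ?thesis using cInf_lessD[of "F ` S"] S1 unfolding m_def by blast
  qed
  then obtain z where z: "\<And>n. z n \<in> S" "\<And>n. F (z n) < m + inverse (real (Suc n))" by metis
  have Fz: "(\<lambda>n. F (z n)) \<longlonglongrightarrow> m"
  proof (rule tendsto_sandwich[OF _ _ tendsto_const])
    show "(\<lambda>n. m + inverse (real (Suc n))) \<longlonglongrightarrow> m"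
      using tendsto_add[OF tendsto_const LIMSEQ_inverse_real_of_nat] by simp
    show "\<forall>\<^sub>F n in sequentially. m \<le> F (z n)" using m_le z(1) by simp
    show "\<forall>\<^sub>F n in sequentially. F (z n) \<le> m + inverse (real (Suc n))"
      using z(2) by (simp add: less_imp_le)
  qed
  have "compact D" unfolding D_def by (intro compact_Times compact_cball compact_Icc)
  then obtain l r where l: "l \<in> D" and r: "strict_mono r" and lim: "(z \<circ> r) \<longlonglongrightarrow> l"
    using z(1) unfolding compact_def S_def by (metis (mono_tags, lifting) mem_Collect_eq)
  have zD: "z n \<in> D" for n using z(1) by (auto simp: S_def)
  have blim: "(\<lambda>n. b (fst (z (r n))) (snd (z (r n)))) \<longlonglongrightarrow> b (fst l) (snd l)"
    using continuous_on_tendsto_compose[OF b lim] l zD by (auto simp: D_def o_def case_prod_unfold)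
  then have vlim: "(\<lambda>n. vpot s \<mu> (fst (z (r n))) (snd (z (r n)))) \<longlonglongrightarrow> m - b (fst l) (snd l)"
    using tendsto_diff[OF LIMSEQ_subseq_LIMSEQ[OF Fz r] blim] by (auto simp: F_def o_def)
  have "pot s \<mu> (fst l) (snd l) \<le> liminf (\<lambda>n. pot s \<mu> (fst (z (r n))) (snd (z (r n))))"
    using lim zD by (intro pot_lower_semicontinuous[OF s sm] tendsto_fst tendsto_snd) (auto simp: o_def D_def mem_Times_iff)
  also have "\<dots> = ennreal (m - b (fst l) (snd l))"
    unfolding pv[OF z(1)] by (intro lim_imp_Liminf tendsto_ennrealI vlim) simp
  finally have pl: "pot s \<mu> (fst l) (snd l) \<le> ennreal (m - b (fst l) (snd l))" .
  have mb: "0 \<le> m - b (fst l) (snd l)"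
    by (rule LIMSEQ_le_const[OF vlim]) (auto simp: vpot_nonneg)
  have bl: "0 \<le> b (fst l) (snd l)" using l by (intro b0) (auto simp: D_def mem_Times_iff)
  \<comment> \<open>The limit could leave \<open>S\<close> only into \<open>A\<close> at height
    zero, where \<open>bottom\<close> and the semicontinuity bound \<open>pl\<close> would force
    \<open>w \<le> m\<close>.\<close>
  have lS: "l \<in> S"
  proof (rule ccontr)
    assume "l \<notin> S"
    then have "fst l \<in> A" "snd l = 0" "dist x0 (fst l) \<le> R" using l by (auto simp: S_def D_def)
    then have "ennreal w \<le> ennreal (m - b (fst l) (snd l))" using bottom[of "fst l"] pl by auto
    then have "w \<le> m - b (fst l) (snd l)" using mb by (simp add: ennreal_le_iff)
    then show False using bl mw by simp
  qed
  define x where "x = fst l"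
  define t where "t = snd l"
  have "vpot s \<mu> x t \<le> m - b x t"
    using pl mb unfolding pv[OF lS] by (simp add: ennreal_le_iff x_def t_def)
  then have Fl: "F l \<le> m" by (simp add: F_def x_def t_def)
  have t0: "0 \<le> t" and lx: "dist x0 x \<le> R" and tT: "t \<le> T" and xA: "x \<notin> A \<or> 0 < t"
    using lS by (auto simp: S_def D_def x_def t_def mem_Times_iff)
  have bw: "b x t < w" using Fl mw vpot_nonneg[of s \<mu> x t] by (simp add: F_def x_def t_def)
  have "dist x0 x \<noteq> R" using lateral[of x t] bw t0 tT by auto
  then have lxR: "dist x0 x < R" using lx by simp
  have "t \<noteq> T" using top[of x] bw lx by auto
  then have tT': "t < T" using tT by simp
  obtain c h1 where c: "0 < c" and h1: "0 < h1" "\<And>h. 0 < h \<Longrightarrow> h < h1 \<Longrightarrow> Dh \<alpha> h b x t \<le> - c * h ^ 2"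
    using super[OF lxR t0 tT' xA] by blast
  obtain \<delta> where \<delta>: "0 < \<delta>" "\<And>y. y \<in> A \<Longrightarrow> \<delta> \<le> norm (x - y) ^ 2 + t"
    using sep[OF lS] by (auto simp: x_def t_def)
  obtain C h2 where h2_pos: "0 < h2" and C: "0 \<le> C"
    and h2: "\<And>h. 0 < h \<Longrightarrow> h < h2 \<Longrightarrow> Dh \<alpha> h (vpot s \<mu>) x t \<le> C * h ^ 3"
    by (rule Dh_vpot_le[OF s \<alpha> t0 \<mu> compact_imp_bounded[OF A] \<delta>]) auto
  \<comment> \<open>In order: the thresholds of \<open>super\<close> and \<open>Dh_vpot_le\<close>,
    the distances to the side and the top, then the room below or, at \<open>t = 0\<close>, a radius
    within which horizontal neighbours avoid \<open>A\<close>. The last entry makes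
    \<open>C * h ^ 3\<close> smaller than \<open>c * h ^ 2\<close>.\<close>
  define e where "e = Min {h1, h2, R - dist x0 x, T - t, if t = 0 then sqrt \<delta> else t, c / (C + 1)}"
  define h where "h = e / 2"
  have "0 < e" using h1 h2_pos lxR tT' c C \<delta> t0 unfolding e_def by (subst Min_gr_iff) auto
  then have he: "0 < h" "h < e" by (auto simp: h_def)
  have "e \<le> h1" "e \<le> h2" "e \<le> R - dist x0 x" "e \<le> T - t" "e \<le> (if t = 0 then sqrt \<delta> else t)" "e \<le> c / (C + 1)"
    unfolding e_def by (rule Min_le, simp, simp only: insert_iff simp_thms)+
  then have h: "0 < h" "h < h1" "h < h2" "h < R - dist x0 x" "h < T - t" "0 < t \<Longrightarrow> h < t"
    "t = 0 \<Longrightarrow> h < sqrt \<delta>" "h < c / (C + 1)"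
    using he by auto
  have side: "m \<le> F (x + e, t)" if e: "norm e = h" for e
  proof -
    have "dist x0 (x + e) \<le> R"
      using h(4) norm_triangle_ineq[of "x - x0" e] e by (simp add: dist_norm norm_minus_commute algebra_simps)
    moreover have "x + e \<notin> A" if "t = 0"
    proof
      assume "x + e \<in> A"
      then have "\<delta> \<le> h ^ 2" using \<delta>(2)[of "x + e"] e that by simp
      moreover have "h ^ 2 < \<delta>" using power_strict_mono[OF h(7)[OF that], of 2] h(1) \<delta>(1) by simp
      ultimately show False by simp
    qed
    ultimately show ?thesis using t0 tT by (intro m_le) (cases "t = 0", auto simp: S_def D_def)
  qed
  have up: "m \<le> F (x, t + h)" using t0 h lx by (intro m_le) (auto simp: S_def D_def)
  have down: "0 \<le> t * (F (x, t + h) + F (x, t - h) - 2 * F (x, t))"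
  proof (cases "t = 0")
    case False
    then have "m \<le> F (x, t - h)" using t0 h lx tT by (intro m_le) (auto simp: S_def D_def)
    then show ?thesis using up Fl t0 by (intro mult_nonneg_nonneg) (auto simp: x_def t_def)
  qed simp
  have "0 \<le> Dh \<alpha> h (\<lambda>x t. F (x, t)) x t"
  proof -
    have "0 \<le> F (x + h *\<^sub>R axis i 1, t) + F (x - h *\<^sub>R axis i 1, t) - 2 * F (x, t)" for i
      using side[of "h *\<^sub>R axis i 1"] side[of "- (h *\<^sub>R axis i 1)"] h Fl by (simp add: x_def t_def)
    moreover have "0 \<le> 2 * \<alpha> * h * (F (x, t + h) - F (x, t))"
      using up Fl \<alpha> h by (intro mult_nonneg_nonneg) (auto simp: x_def t_def)
    ultimately show ?thesis using down unfolding Dh_def by (intro add_nonneg_nonneg sum_nonneg) (auto simp: mult.assoc)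
  qed
  also have "Dh \<alpha> h (\<lambda>x t. F (x, t)) x t = Dh \<alpha> h (vpot s \<mu>) x t + Dh \<alpha> h b x t"
    unfolding Dh_def F_def by (simp add: sum.distrib sum_subtractf algebra_simps)
  also have "\<dots> \<le> C * h ^ 3 - c * h ^ 2" using h1(2)[OF h(1,2)] h2[OF h(1,3)] by simp
  also have "\<dots> = h ^ 2 * (C * h - c)" by (simp add: power2_eq_square power3_eq_cube algebra_simps)
  finally have "0 \<le> C * h - c" using h(1) by (simp add: zero_le_mult_iff)
  moreover have "(C + 1) * h < c" using h(8) C by (simp add: field_simps)
  ultimately show False using h(1) by (simp add: algebra_simps)
qed

section \<open>From derivatives to difference inequalities\<close>

lemma second_difference_limit:
  fixes \<phi> P :: "real \<Rightarrow> real"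
  assumes ev: "\<forall>\<^sub>F u in nhds 0. (\<phi> has_real_derivative P u) (at u)"
    and D: "(P has_real_derivative D) (at 0)"
  shows "((\<lambda>h. (\<phi> h + \<phi> (- h) - 2 * \<phi> 0) / h ^ 2) \<longlongrightarrow> D) (at_right 0)"
proof -
  obtain e where e: "0 < e" "\<And>u. \<bar>u\<bar> < e \<Longrightarrow> (\<phi> has_real_derivative P u) (at u)"
    using ev unfolding eventually_nhds_metric by (auto simp: dist_real_def)
  have d: "((\<lambda>h. \<phi> h + \<phi> (- h) - 2 * \<phi> 0) has_real_derivative P h - P (- h)) (at h)" if "\<bar>h\<bar> < e" for h
  proof -
    have "((\<lambda>h. \<phi> (- h)) has_real_derivative P (- h) * (- 1)) (at h)"
      by (rule DERIV_chain2[where f = \<phi> and g = "\<lambda>h. - h"])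
        (use e(2)[of "- h"] that in \<open>auto intro!: derivative_eq_intros\<close>)
    then show ?thesis using e(2)[OF that] by (auto intro!: derivative_eq_intros)
  qed
  have small: "\<forall>\<^sub>F h in at_right 0. \<bar>h::real\<bar> < e"
    using eventually_at_right_real[OF e(1)] by (rule eventually_mono) auto
  show ?thesis
  \<comment> \<open>One application of L'Hopital's rule suffices, so \<open>P\<close> has to be
    differentiable at \<open>0\<close> only: there its symmetric quotient is the mean of two
    one-sided ones.\<close>
  proof (rule lhopital_right_0[where f' = "\<lambda>h. P h - P (- h)" and g' = "\<lambda>h. 2 * h"])
    have "isCont (\<lambda>h. \<phi> h + \<phi> (- h) - 2 * \<phi> 0) 0" using d[of 0] e(1) by (intro DERIV_isCont) auto
    then show "((\<lambda>h. \<phi> h + \<phi> (- h) - 2 * \<phi> 0) \<longlongrightarrow> 0) (at_right 0)"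
      unfolding isCont_def by (auto intro: tendsto_mono[OF at_le])
    show "((\<lambda>h::real. h ^ 2) \<longlongrightarrow> 0) (at_right 0)" by (auto intro!: tendsto_eq_intros)
    show "\<forall>\<^sub>F h in at_right 0. (h::real) ^ 2 \<noteq> 0"
      using eventually_at_right_less[of "0::real"] by (rule eventually_mono) auto
    show "\<forall>\<^sub>F h in at_right 0. 2 * (h::real) \<noteq> 0"
      using eventually_at_right_less[of "0::real"] by (rule eventually_mono) auto
    show "\<forall>\<^sub>F h in at_right 0. ((\<lambda>h. \<phi> h + \<phi> (- h) - 2 * \<phi> 0) has_real_derivative P h - P (- h)) (at h)"
      using small d by (auto elim: eventually_mono)
    show "\<forall>\<^sub>F h in at_right 0. ((\<lambda>h. h ^ 2) has_real_derivative 2 * h) (at h)"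
      by (intro always_eventually allI) (auto intro!: derivative_eq_intros)
    have D': "((\<lambda>h. (P h - P 0) / h) \<longlongrightarrow> D) (at 0)" using D by (simp add: has_field_derivative_iff)
    have 1: "((\<lambda>h. (P h - P 0) / h) \<longlongrightarrow> D) (at_right 0)"
      using D' by (rule tendsto_mono[OF at_le, rotated]) simp
    have "((\<lambda>h. (P h - P 0) / h) \<longlongrightarrow> D) (at_left 0)"
      using D' by (rule tendsto_mono[OF at_le, rotated]) simp
    then have "((\<lambda>h. (P (- h) - P 0) / (- h)) \<longlongrightarrow> D) (at_right 0)"
      by (subst (asm) filterlim_at_left_to_right) simp
    from tendsto_add[OF 1 this] have "((\<lambda>h. ((P h - P 0) / h + (P (- h) - P 0) / (- h)) / 2) \<longlongrightarrow> (D + D) / 2) (at_right 0)"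
      by (intro tendsto_divide) auto
    moreover have "\<forall>\<^sub>F h in at_right 0. ((P h - P 0) / h + (P (- h) - P 0) / (- h)) / 2 = (P h - P (- h)) / (2 * h)"
      using eventually_at_right_less[of "0::real"] by (rule eventually_mono) (simp add: field_simps)
    ultimately have "((\<lambda>h. (P h - P (- h)) / (2 * h)) \<longlongrightarrow> (D + D) / 2) (at_right 0)"
      by (rule Lim_transform_eventually)
    then show "((\<lambda>h. (P h - P (- h)) / (2 * h)) \<longlongrightarrow> D) (at_right 0)" by simp
  qed
qed

text \<open>\<open>Dh\<close> divided by \<open>h ^ 2\<close> tends to the value \<open>L\<close> of
  the differential operator, so \<open>L < 0\<close> gives the inequality with
  \<open>c = - L / 2\<close>.\<close>

lemma Dh_le_of_derivatives:
  fixes b :: "real ^ 'p \<Rightarrow> real \<Rightarrow> real"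
  assumes x1: "\<And>i. \<forall>\<^sub>F u in nhds 0. ((\<lambda>u. b (x + u *\<^sub>R axis i 1) t) has_real_derivative P i u) (at u)"
    and x2: "\<And>i. (P i has_real_derivative D2 i) (at 0)"
    and t1: "\<forall>\<^sub>F u in nhds 0. ((\<lambda>u. b x (t + u)) has_real_derivative Q u) (at u)"
    and t2: "(Q has_real_derivative Dtt) (at 0)"
    and neg: "(\<Sum>i\<in>UNIV. D2 i) + 4 * t * Dtt + 2 * \<alpha> * Q 0 < 0"
  shows "\<exists>c>0. \<exists>h0>0. \<forall>h. 0 < h \<and> h < h0 \<longrightarrow> Dh \<alpha> h b x t \<le> - c * h ^ 2"
proof -
  define L where "L = (\<Sum>i\<in>UNIV. D2 i) + 4 * t * Dtt + 2 * \<alpha> * Q 0"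
  have L: "L < L / 2" using neg unfolding L_def[symmetric] by linarith
  have X: "((\<lambda>h. (b (x + h *\<^sub>R axis i 1) t + b (x - h *\<^sub>R axis i 1) t - 2 * b x t) / h ^ 2) \<longlongrightarrow> D2 i) (at_right 0)" for i
    using second_difference_limit[OF x1 x2, of i] by simp
  have Tt: "((\<lambda>h. (b x (t + h) + b x (t - h) - 2 * b x t) / h ^ 2) \<longlongrightarrow> Dtt) (at_right 0)"
    using second_difference_limit[OF t1 t2] by simp
  have "((\<lambda>u. b x (t + u)) has_real_derivative Q 0) (at 0)" using eventually_nhds_x_imp_x[OF t1] .
  then have "((\<lambda>h. (b x (t + h) - b x t) / h) \<longlongrightarrow> Q 0) (at 0)" by (simp add: has_field_derivative_iff)
  then have T1: "((\<lambda>h. (b x (t + h) - b x t) / h) \<longlongrightarrow> Q 0) (at_right 0)"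
    by (rule tendsto_mono[OF at_le, rotated]) simp
  have "((\<lambda>h. (\<Sum>i\<in>UNIV. (b (x + h *\<^sub>R axis i 1) t + b (x - h *\<^sub>R axis i 1) t - 2 * b x t) / h ^ 2)
     + 4 * t * ((b x (t + h) + b x (t - h) - 2 * b x t) / h ^ 2) + 2 * \<alpha> * ((b x (t + h) - b x t) / h)) \<longlongrightarrow> L) (at_right 0)"
    unfolding L_def by (intro tendsto_intros X Tt T1)
  then have "\<forall>\<^sub>F h in at_right 0. (\<Sum>i\<in>UNIV. (b (x + h *\<^sub>R axis i 1) t + b (x - h *\<^sub>R axis i 1) t - 2 * b x t) / h ^ 2)
     + 4 * t * ((b x (t + h) + b x (t - h) - 2 * b x t) / h ^ 2) + 2 * \<alpha> * ((b x (t + h) - b x t) / h) < L / 2"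
    by (rule order_tendstoD(2)[OF _ L])
  then obtain h0 where h0: "0 < h0" "\<And>h. 0 < h \<Longrightarrow> h < h0 \<Longrightarrow>
     (\<Sum>i\<in>UNIV. (b (x + h *\<^sub>R axis i 1) t + b (x - h *\<^sub>R axis i 1) t - 2 * b x t) / h ^ 2)
     + 4 * t * ((b x (t + h) + b x (t - h) - 2 * b x t) / h ^ 2) + 2 * \<alpha> * ((b x (t + h) - b x t) / h) < L / 2"
    unfolding eventually_at_right_field by blast
  have "Dh \<alpha> h b x t \<le> - (- L / 2) * h ^ 2" if h: "0 < h" "h < h0" for h
  proof -
    have "Dh \<alpha> h b x t = ((\<Sum>i\<in>UNIV. (b (x + h *\<^sub>R axis i 1) t + b (x - h *\<^sub>R axis i 1) t - 2 * b x t) / h ^ 2)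
     + 4 * t * ((b x (t + h) + b x (t - h) - 2 * b x t) / h ^ 2) + 2 * \<alpha> * ((b x (t + h) - b x t) / h)) * h ^ 2"
      using h unfolding sum_divide_distrib[symmetric] Dh_def by (simp add: field_simps power2_eq_square)
    also have "\<dots> \<le> L / 2 * h ^ 2" using h0(2)[OF h] by (intro mult_right_mono) auto
    finally show ?thesis by simp
  qed
  then show ?thesis using h0(1) neg by (intro exI[of _ "- L / 2"]) (auto simp: L_def)
qed

section \<open>The full-dimensional case\<close>

text \<open>In the variable \<open>t\<close>, the power \<open>t powr (\<gamma> / 2)\<close> solves the equation, a slightly higher power is a
  strict subsolution and a lower one a strict supersolution. The quartic term makes the barrier positive
  on the lateral boundary. A quadratic one would not do: its Laplacian does not vanish at \<open>x0\<close>, and for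
  \<open>\<gamma> = 2\<close> no term of order \<open>t\<close> compensates it.\<close>

definition flat_barrier :: "real \<Rightarrow> real \<Rightarrow> real \<Rightarrow> real ^ 'p \<Rightarrow> real ^ 'p \<Rightarrow> real \<Rightarrow> real" where
  "flat_barrier \<gamma> C K x0 x t = C * (t powr (\<gamma> / 2) - t powr (\<gamma> / 2 + 1/4))
     + K * norm (x - x0) ^ 2 * t powr (\<gamma> / 4) + (norm (x - x0) ^ 2) ^ 2"

text \<open>\<open>K\<close> makes the negative contribution of the mixed term dominate
  \<open>(4 * CARD('p) + 8) * norm (x - x0) ^ 2\<close>, the Laplacian of the quartic.
  \<open>C\<close> makes the gain from the subtracted power of \<open>t\<close> dominate the
  Laplacian of the mixed term in turn.\<close>

lemma flat_barrier_super:
  fixes x0 x :: "real ^ 'p" and \<gamma> t M K C :: real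
  assumes \<gamma>: "0 < \<gamma>" "\<gamma> \<le> 2" and t: "0 < t" "t < 1" and M: "0 < M"
    and K: "K = 4 * (4 * CARD('p) + 8) / \<gamma> ^ 2" and C: "C = (2 * CARD('p) * K + 1) / (\<gamma> / 2 + 1/4)"
  shows "\<exists>c>0. \<exists>h0>0. \<forall>h. 0 < h \<and> h < h0 \<longrightarrow>
    Dh (2 - \<gamma>) h (\<lambda>x t. M * flat_barrier \<gamma> C K x0 x t) x t \<le> - c * h ^ 2"
proof -
  define z where "z = x - x0"
  define r2 where "r2 = norm z ^ 2"
  define \<rho> where "\<rho> i u = r2 + (u^2 + 2 * u * z $ i)" for i and u :: real
  have nx: "norm (x + u *\<^sub>R axis i 1 - x0) ^ 2 = \<rho> i u" for i u
  proof -
    have e: "x + u *\<^sub>R axis i 1 - x0 = z + u *\<^sub>R axis i 1" by (simp add: z_def)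
    show ?thesis unfolding e norm_add_axis_power2 by (simp add: \<rho>_def r2_def)
  qed
  have sumz: "(\<Sum>i\<in>UNIV. (z $ i)^2) = r2"
    unfolding r2_def power2_norm_eq_inner inner_vec_def by (simp add: power2_eq_square)
  define a where "a = K * t powr (\<gamma> / 4)"
  define e where "e = \<gamma> / 2 + 1/4"
  have e: "0 < e" using \<gamma> by (simp add: e_def)
  have r2: "norm (x - x0) ^ 2 = r2" by (simp add: r2_def z_def)
  define Q where "Q u = M * (C * (\<gamma> / 2 * (t + u) powr (\<gamma> / 2 - 1) - e * (t + u) powr (e - 1))
       + K * r2 * (\<gamma> / 4 * (t + u) powr (\<gamma> / 4 - 1)))" for u
  have tu: "\<forall>\<^sub>F u in nhds 0. 0 < t + u"
    unfolding eventually_nhds_metric using t by (intro exI[of _ t]) (auto simp: dist_real_def)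
  define D2 where "D2 i = M * (2 * a + 4 * r2 + 8 * (z $ i)^2)" for i
  define Dtt where "Dtt = M * (C * (\<gamma> / 2 * ((\<gamma> / 2 - 1) * t powr (\<gamma> / 2 - 2)) - e * ((e - 1) * t powr (e - 2)))
       + K * r2 * (\<gamma> / 4 * ((\<gamma> / 4 - 1) * t powr (\<gamma> / 4 - 2))))"
  have neg: "(\<Sum>i\<in>UNIV. D2 i) + 4 * t * Dtt + 2 * (2 - \<gamma>) * Q 0 < 0"
  proof -
    have S: "(\<Sum>i\<in>UNIV. M * (2 * a + 4 * r2 + 8 * (z $ i)^2)) = M * (2 * CARD('p) * a + (4 * CARD('p) + 8) * r2)"
      using sumz by (simp add: sum.distrib flip: sum_distrib_left) (simp add: algebra_simps)
    have p: "t * t powr (k - 2) = t powr (k - 1)" for k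
      using t by (simp add: powr_diff power2_eq_square)
    have "4 * t * (M * (C * (\<gamma> / 2 * ((\<gamma> / 2 - 1) * t powr (\<gamma> / 2 - 2)) - e * ((e - 1) * t powr (e - 2)))
       + K * r2 * (\<gamma> / 4 * ((\<gamma> / 4 - 1) * t powr (\<gamma> / 4 - 2)))))
       = 4 * (M * (C * (\<gamma> / 2 * ((\<gamma> / 2 - 1) * (t * t powr (\<gamma> / 2 - 2))) - e * ((e - 1) * (t * t powr (e - 2))))
       + K * r2 * (\<gamma> / 4 * ((\<gamma> / 4 - 1) * (t * t powr (\<gamma> / 4 - 2))))))" by (simp add: algebra_simps)
    also have "\<dots> + 2 * (2 - \<gamma>) * Q 0 = M * (- C * e * t powr (e - 1) - K * r2 * \<gamma> ^ 2 / 4 * t powr (\<gamma> / 4 - 1))"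
      unfolding p Q_def e_def by (simp add: field_simps power2_eq_square)
    finally have T: "4 * t * (M * (C * (\<gamma> / 2 * ((\<gamma> / 2 - 1) * t powr (\<gamma> / 2 - 2)) - e * ((e - 1) * t powr (e - 2)))
       + K * r2 * (\<gamma> / 4 * ((\<gamma> / 4 - 1) * t powr (\<gamma> / 4 - 2))))) + 2 * (2 - \<gamma>) * Q 0
       = M * (- C * e * t powr (e - 1) - K * r2 * \<gamma> ^ 2 / 4 * t powr (\<gamma> / 4 - 1))" .
    have r20: "0 \<le> r2" by (simp add: r2_def)
    have K0: "0 < K" unfolding K using \<gamma> by (intro divide_pos_pos) auto
    have "(4 * CARD('p) + 8) * r2 = K * r2 * \<gamma> ^ 2 / 4 * 1" using \<gamma> by (simp add: K)
    also have "\<dots> \<le> K * r2 * \<gamma> ^ 2 / 4 * t powr (\<gamma> / 4 - 1)"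
    proof (rule mult_left_mono)
      have "1 powr (\<gamma> / 4 - 1) \<le> t powr (\<gamma> / 4 - 1)" using \<gamma> t by (intro powr_mono2') auto
      then show "1 \<le> t powr (\<gamma> / 4 - 1)" by simp
    qed (use r20 K0 in auto)
    finally have 1: "(4 * CARD('p) + 8) * r2 \<le> K * r2 * \<gamma> ^ 2 / 4 * t powr (\<gamma> / 4 - 1)" .
    \<comment> \<open>The exponents satisfy \<open>\<gamma> / 2 - 3/4 \<le> \<gamma> / 4\<close>
      because \<open>\<gamma> \<le> 2\<close>, and \<open>t < 1\<close> reverses the order.\<close>
    have "t powr (\<gamma> / 4) \<le> t powr (e - 1)" using t \<gamma> by (intro powr_mono') (auto simp: e_def)
    then have "(2 * CARD('p) * K) * t powr (\<gamma> / 4) \<le> (2 * CARD('p) * K) * t powr (e - 1)"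
      using K0 by (intro mult_left_mono) auto
    also have "\<dots> < (2 * CARD('p) * K + 1) * t powr (e - 1)" using t by (intro mult_strict_right_mono) auto
    also have "\<dots> = C * e * t powr (e - 1)" using e by (simp add: C e_def)
    finally have "2 * CARD('p) * a < C * e * t powr (e - 1)" by (simp add: a_def mult_ac)
    then have "2 * CARD('p) * a + (4 * CARD('p) + 8) * r2 + (- C * e * t powr (e - 1) - K * r2 * \<gamma> ^ 2 / 4 * t powr (\<gamma> / 4 - 1)) < 0"
      using 1 by linarith
    then have "M * (2 * CARD('p) * a + (4 * CARD('p) + 8) * r2 + (- C * e * t powr (e - 1) - K * r2 * \<gamma> ^ 2 / 4 * t powr (\<gamma> / 4 - 1))) < 0"
      using M by (simp add: mult_less_0_iff)
    then show ?thesis using S T unfolding distrib_left[of M] D2_def Dtt_def by linarith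
  qed
  show ?thesis
  proof (rule Dh_le_of_derivatives[where ?D2.0 = D2 and Dtt = Dtt and Q = Q and P = "\<lambda>i u. M * (a * (2 * u + 2 * z $ i) + 2 * \<rho> i u * (2 * u + 2 * z $ i))"])
    fix i :: 'p
    show "\<forall>\<^sub>F u in nhds 0. ((\<lambda>u. M * flat_barrier \<gamma> C K x0 (x + u *\<^sub>R axis i 1) t) has_real_derivative
        M * (a * (2 * u + 2 * z $ i) + 2 * \<rho> i u * (2 * u + 2 * z $ i))) (at u)"
      unfolding flat_barrier_def nx a_def \<rho>_def
      by (intro always_eventually allI) (auto intro!: derivative_eq_intros simp: field_simps)
    show "((\<lambda>u. M * (a * (2 * u + 2 * z $ i) + 2 * \<rho> i u * (2 * u + 2 * z $ i))) has_real_derivative D2 i) (at 0)"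
      unfolding \<rho>_def D2_def by (auto intro!: derivative_eq_intros simp: power2_eq_square algebra_simps)
  next
    show "\<forall>\<^sub>F u in nhds 0. ((\<lambda>u. M * flat_barrier \<gamma> C K x0 x (t + u)) has_real_derivative Q u) (at u)"
      using tu
    proof (rule eventually_mono)
      fix u :: real assume "0 < t + u"
      then show "((\<lambda>u. M * flat_barrier \<gamma> C K x0 x (t + u)) has_real_derivative Q u) (at u)"
        unfolding flat_barrier_def Q_def r2 e_def by (auto intro!: derivative_eq_intros)
    qed
    show "(Q has_real_derivative Dtt) (at 0)"
      unfolding Q_def Dtt_def using t by (auto intro!: derivative_eq_intros simp: field_simps)
  qed (rule neg)
qed

text \<open>A whole ball lies in \<open>A\<close>, so the bottom of the cylinder belongs to
  \<open>A\<close> and the barrier has to be a supersolution only for \<open>t > 0\<close>. At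
  \<open>x0\<close> only the two pure powers of \<open>t\<close> survive, and the first of them is
  the claimed rate.\<close>

lemma vpot_gap_full_dimensional:
  fixes \<mu> :: "(real ^ 'p) measure" and s w R :: real
  assumes s: "0 < s" "real CARD('p) - 2 \<le> s" "s < CARD('p)"
    and A: "compact A" and \<mu>: "fin_borel_measure_on A \<mu>" and w: "0 \<le> w"
    and bottom: "\<And>x. dist x0 x \<le> R \<Longrightarrow> ennreal w \<le> pot s \<mu> x 0"
    and R: "0 < R" "cball x0 R \<subseteq> A"
  shows "\<exists>C T. 0 < T \<and> (\<forall>t. 0 < t \<and> t \<le> T \<longrightarrow> w \<le> vpot s \<mu> x0 t + C * t powr ((CARD('p) - s) / 2))"
proof -
  define \<gamma> where "\<gamma> = CARD('p) - s"
  have \<gamma>: "0 < \<gamma>" "\<gamma> \<le> 2" using s by (auto simp: \<gamma>_def)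
  define K where "K = 4 * (4 * CARD('p) + 8) / \<gamma> ^ 2"
  define C where "C = (2 * CARD('p) * K + 1) / (\<gamma> / 2 + 1/4)"
  have K: "0 < K" unfolding K_def using \<gamma> by (intro divide_pos_pos) auto
  have C: "0 < C" unfolding C_def using \<gamma> K by (intro divide_pos_pos add_nonneg_pos mult_nonneg_nonneg) auto
  \<comment> \<open>Any height strictly between \<open>0\<close> and \<open>1\<close> makes the
    difference \<open>k\<close> positive. \<open>M\<close> then lifts the barrier above
    \<open>w\<close> on the top and, through the quartic, on the side.\<close>
  define T where "T = (1/2 :: real)"
  define k where "k = C * (T powr (\<gamma> / 2) - T powr (\<gamma> / 2 + 1/4))"
  have k: "0 < k" unfolding k_def T_def using C by (intro mult_pos_pos) (auto intro!: powr_less_mono')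
  define M where "M = max 1 (max (w / k) (w / R ^ 4))"
  have M: "0 < M" "w \<le> M * k" "w \<le> M * R ^ 4"
    using k R by (auto simp: M_def less_max_iff_disj simp flip: pos_divide_le_eq)
  define b where "b x t = M * flat_barrier \<gamma> C K x0 x t" for x t
  have diff0: "0 \<le> t powr (\<gamma> / 2) - t powr (\<gamma> / 2 + 1/4)" if "0 \<le> t" "t \<le> 1" for t :: real
    using that by (auto intro!: powr_mono')
  have *: "w \<le> vpot s \<mu> x0 t + b x0 t" if t: "0 < t" "t \<le> T" for t
  proof (rule vpot_comparison[where R = R and T = T and A = A])
    show "2 - \<gamma> = s + 2 - real CARD('p)" "0 \<le> 2 - \<gamma>" using \<gamma> by (auto simp: \<gamma>_def)
    show "continuous_on (cball x0 R \<times> {0..T}) (\<lambda>(x, t). b x t)"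
    proof -
      have pw: "continuous_on (cball x0 R \<times> {0..T}) (\<lambda>p. snd p powr k)" if "0 < k" for k
        using that by (intro continuous_on_powr' continuous_intros) auto
      show ?thesis
        unfolding b_def flat_barrier_def case_prod_unfold using \<gamma>
        by (intro continuous_on_mult continuous_on_const continuous_on_add continuous_on_diff
            continuous_on_power continuous_on_norm continuous_on_fst continuous_on_id pw) auto
    qed
    show "0 \<le> b x t" if "0 \<le> t" "t \<le> T" for x t
      unfolding b_def flat_barrier_def using M C K diff0[of t] that
      by (intro mult_nonneg_nonneg add_nonneg_nonneg) (auto simp: T_def)
    show "w \<le> b x t" if x: "dist x0 x = R" and t: "0 \<le> t" "t \<le> T" for x t
    proof -
      have n: "norm (x - x0) = R" using x by (simp add: dist_norm norm_minus_commute)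
      have "0 \<le> C * (t powr (\<gamma> / 2) - t powr (\<gamma> / 2 + 1/4)) + K * norm (x - x0) ^ 2 * t powr (\<gamma> / 4)"
        using C K diff0[of t] t by (intro mult_nonneg_nonneg add_nonneg_nonneg) (auto simp: T_def)
      then have "R ^ 4 \<le> flat_barrier \<gamma> C K x0 x t" unfolding flat_barrier_def n by simp
      then show ?thesis using M(3) mult_left_mono[OF _ less_imp_le[OF M(1)], of "R ^ 4" "flat_barrier \<gamma> C K x0 x t"]
        unfolding b_def by linarith
    qed
    show "w \<le> b x T" for x
    proof -
      have "k \<le> flat_barrier \<gamma> C K x0 x T" unfolding flat_barrier_def k_def using K by simp
      then show ?thesis using M(2) mult_left_mono[OF _ less_imp_le[OF M(1)], of k "flat_barrier \<gamma> C K x0 x T"]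
        unfolding b_def by linarith
    qed
    show "\<exists>c>0. \<exists>h0>0. \<forall>h. 0 < h \<and> h < h0 \<longrightarrow> Dh (2 - \<gamma>) h b x t \<le> - c * h ^ 2"
      if "dist x0 x < R" "0 \<le> t" "t < T" "x \<notin> A \<or> 0 < t" for x t
    proof -
      have "x \<in> A" using that(1) R(2) by (auto simp: subset_iff)
      then have "0 < t" "t < 1" using that by (auto simp: T_def)
      then show ?thesis using flat_barrier_super[OF \<gamma> _ _ M(1) K_def C_def, of t x0 x] unfolding b_def[abs_def] by blast
    qed
  qed (use s A \<mu> bottom R t in auto)
  have "b x0 t \<le> (M * C) * t powr (\<gamma> / 2)" if "0 < t" "t \<le> T" for t
    using M C \<gamma> by (simp add: b_def flat_barrier_def mult.assoc mult_left_mono)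
  then have "w \<le> vpot s \<mu> x0 t + (M * C) * t powr (\<gamma> / 2)" if "0 < t" "t \<le> T" for t
    using *[OF that] that by force
  then show ?thesis unfolding \<gamma>_def by (intro exI[of _ "M * C"] exI[of _ T]) (auto simp: T_def)
qed

section \<open>Calculus of functions of class \<open>C\<^sup>n\<close>\<close>

lemma Ck_on_cong:
  assumes "open S" "\<And>x. x \<in> S \<Longrightarrow> f x = g x" "Ck_on n S f"
  shows "Ck_on n S g"
  using assms(2,3)
proof (induction n arbitrary: f g)
  case 0
  then show ?case by (simp cong: continuous_on_cong)
next
  case (Suc n)
  have D: "(g has_derivative frechet_derivative f (at x)) (at x)" if "x \<in> S" for x
  proof -
    have "(f has_derivative frechet_derivative f (at x)) (at x)"
      using Suc.prems that by (simp add: frechet_derivative_works)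
    then show ?thesis using has_derivative_transform_within_open[OF _ assms(1) that] Suc.prems(1) by blast
  qed
  then have "frechet_derivative g (at x) = frechet_derivative f (at x)" if "x \<in> S" for x
    using frechet_derivative_at that by metis
  then have "Ck_on n S (\<lambda>x. frechet_derivative g (at x) v)" for v
    using Suc.IH[of "\<lambda>x. frechet_derivative f (at x) v" "\<lambda>x. frechet_derivative g (at x) v"] Suc.prems by simp
  then show ?case using D by (auto simp: differentiable_def)
qed

text \<open>Uniqueness of derivatives at points of an open set lets any explicit \<open>f'\<close>
  stand for \<open>frechet_derivative\<close>.\<close>

lemma Ck_on_SucI:
  assumes S: "open S" and D: "\<And>x. x \<in> S \<Longrightarrow> (f has_derivative f' x) (at x)"
    and C: "\<And>v. Ck_on n S (\<lambda>x. f' x v)"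
  shows "Ck_on (Suc n) S f"
proof -
  have "f' x = frechet_derivative f (at x)" if "x \<in> S" for x
    using frechet_derivative_at[OF D[OF that]] .
  then have "Ck_on n S (\<lambda>x. frechet_derivative f (at x) v)" for v
    using Ck_on_cong[OF S _ C[of v], of "\<lambda>x. frechet_derivative f (at x) v"] by metis
  then show ?thesis using D by (auto simp: differentiable_def)
qed

lemma Ck_on_SucD:
  assumes "Ck_on (Suc n) S f"
  shows "x \<in> S \<Longrightarrow> (f has_derivative frechet_derivative f (at x)) (at x)"
    and "Ck_on n S (\<lambda>x. frechet_derivative f (at x) v)"
  using assms by (auto simp: frechet_derivative_works)

lemma Ck_on_Suc_le: "Ck_on (Suc n) S f \<Longrightarrow> Ck_on n S f"
proof (induction n arbitrary: f)
  case 0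
  then show ?case
    by (auto intro!: differentiable_imp_continuous_on simp: differentiable_on_def differentiable_at_withinI)
next
  case (Suc n)
  have "Ck_on n S (\<lambda>x. frechet_derivative f (at x) v)" for v
    using Suc.IH Ck_on_SucD(2)[OF Suc.prems] by blast
  then show ?case using Suc.prems by simp
qed

lemma Ck_on_imp_continuous_on: "Ck_on n S f \<Longrightarrow> continuous_on S f"
  by (induction n) (simp, blast dest: Ck_on_Suc_le)

lemma Ck_on_subset: "Ck_on n S f \<Longrightarrow> T \<subseteq> S \<Longrightarrow> Ck_on n T f"
proof (induction n arbitrary: f)
  case 0
  then show ?case using continuous_on_subset by auto
qed auto

lemma Ck_on_const: "open S \<Longrightarrow> Ck_on n S (\<lambda>x. c)"
proof (induction n arbitrary: c)
  case (Suc n)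
  show ?case
    by (rule Ck_on_SucI[where f' = "\<lambda>_ _. 0"]) (use Suc in auto)
qed simp

lemma Ck_on_bounded_linear:
  assumes "bounded_linear f" "open S"
  shows "Ck_on n S f"
proof (cases n)
  case 0
  then show ?thesis using assms by (simp add: linear_continuous_on)
next
  case (Suc m)
  show ?thesis unfolding Suc
    by (rule Ck_on_SucI[where f' = "\<lambda>_. f"])
      (use assms in \<open>auto intro: Ck_on_const bounded_linear_imp_has_derivative\<close>)
qed

lemma Ck_on_id: "open S \<Longrightarrow> Ck_on n S (\<lambda>x. x)"
  by (rule Ck_on_bounded_linear) (auto simp: bounded_linear_ident)

lemma Ck_on_bounded_linear_compose:
  assumes h: "bounded_linear h" and S: "open S"
  shows "Ck_on n S f \<Longrightarrow> Ck_on n S (\<lambda>x. h (f x))"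
proof (induction n arbitrary: f)
  case 0
  then show ?case by (simp add: bounded_linear.continuous_on[OF h])
next
  case (Suc n)
  show ?case
    by (rule Ck_on_SucI[OF S, where f' = "\<lambda>x v. h (frechet_derivative f (at x) v)"])
      (use Suc.IH Ck_on_SucD[OF Suc.prems] in \<open>auto intro: bounded_linear.has_derivative[OF h]\<close>)
qed

lemma Ck_on_add:
  assumes S: "open S"
  shows "Ck_on n S f \<Longrightarrow> Ck_on n S g \<Longrightarrow> Ck_on n S (\<lambda>x. f x + g x)"
proof (induction n arbitrary: f g)
  case 0
  then show ?case by (auto intro: continuous_on_add)
next
  case (Suc n)
  show ?case
    by (rule Ck_on_SucI[OF S, where f' = "\<lambda>x v. frechet_derivative f (at x) v + frechet_derivative g (at x) v"])
      (use Suc.IH Ck_on_SucD[OF Suc.prems(1)] Ck_on_SucD[OF Suc.prems(2)] in \<open>auto intro!: has_derivative_add\<close>)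
qed

lemma Ck_on_sum:
  assumes "open S" "\<And>i. i \<in> I \<Longrightarrow> Ck_on n S (f i)"
  shows "Ck_on n S (\<lambda>x. \<Sum>i\<in>I. f i x)"
  using assms(2)
  by (induction I rule: infinite_finite_induct) (auto intro: Ck_on_const Ck_on_add assms(1))

lemma Ck_on_bounded_bilinear:
  assumes h: "bounded_bilinear h" and S: "open S"
  shows "Ck_on n S f \<Longrightarrow> Ck_on n S g \<Longrightarrow> Ck_on n S (\<lambda>x. h (f x) (g x))"
proof (induction n arbitrary: f g)
  case 0
  then show ?case using bounded_bilinear.continuous_on[OF h] by auto
next
  case (Suc n)
  have "Ck_on n S f" "Ck_on n S g" using Suc.prems Ck_on_Suc_le by blast+
  then show ?case
    by (intro Ck_on_SucI[OF S, where f' = "\<lambda>x v. h (f x) (frechet_derivative g (at x) v) + h (frechet_derivative f (at x) v) (g x)"]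
        Ck_on_add S Suc.IH Ck_on_SucD(2)[OF Suc.prems(1)] Ck_on_SucD(2)[OF Suc.prems(2)]
        bounded_bilinear.FDERIV[OF h] Ck_on_SucD(1)[OF Suc.prems(1)] Ck_on_SucD(1)[OF Suc.prems(2)])
qed

text \<open>\<open>Ck_on\<close> controls derivatives in fixed directions, while the chain rule
  evaluates the derivative of \<open>g\<close> in a direction that moves with \<open>x\<close>.
  Expanding this direction in \<open>Basis\<close> leaves sums of products with fixed
  directions.\<close>

lemma Ck_on_compose:
  fixes f :: "'a::real_normed_vector \<Rightarrow> 'b::euclidean_space" and g :: "'b \<Rightarrow> 'c::real_normed_vector"
  assumes S: "open S" and fS: "f ` S \<subseteq> T"
  shows "Ck_on n S f \<Longrightarrow> Ck_on n T g \<Longrightarrow> Ck_on n S (\<lambda>x. g (f x))"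
proof (induction n arbitrary: g)
  case 0
  then show ?case using continuous_on_compose2[OF _ _ fS] by auto
next
  case (Suc n)
  have fn: "Ck_on n S f" using Suc.prems Ck_on_Suc_le by blast
  show ?case
  proof (rule Ck_on_SucI[OF S, where f' = "\<lambda>x v. frechet_derivative g (at (f x)) (frechet_derivative f (at x) v)"])
    fix x assume x: "x \<in> S"
    then have "f x \<in> T" using fS by auto
    then have "(g has_derivative frechet_derivative g (at (f x))) (at (f x))"
      by (rule Ck_on_SucD(1)[OF Suc.prems(2)])
    from has_derivative_compose[OF Ck_on_SucD(1)[OF Suc.prems(1) x] this]
    show "((\<lambda>x. g (f x)) has_derivative (\<lambda>v. frechet_derivative g (at (f x)) (frechet_derivative f (at x) v))) (at x)" .
  next
    fix v
    have "Ck_on n S (\<lambda>x. \<Sum>b\<in>Basis. (frechet_derivative f (at x) v \<bullet> b) *\<^sub>R frechet_derivative g (at (f x)) b)"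
      by (intro Ck_on_sum S Ck_on_bounded_bilinear[OF bounded_bilinear_scaleR S]
          Ck_on_bounded_linear_compose[OF bounded_linear_inner_left S]
          Ck_on_SucD(2)[OF Suc.prems(1)] Suc.IH[OF fn] Ck_on_SucD(2)[OF Suc.prems(2)])
    then show "Ck_on n S (\<lambda>x. frechet_derivative g (at (f x)) (frechet_derivative f (at x) v))"
    proof (rule Ck_on_cong[OF S, rotated])
      fix x assume "x \<in> S"
      then have "f x \<in> T" using fS by auto
      then have "linear (frechet_derivative g (at (f x)))"
        using Ck_on_SucD(1)[OF Suc.prems(2)] has_derivative_linear by blast
      note l = this
      define w where "w = frechet_derivative f (at x) v"
      have "frechet_derivative g (at (f x)) w = frechet_derivative g (at (f x)) (\<Sum>b\<in>Basis. (w \<bullet> b) *\<^sub>R b)"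
        by (simp only: euclidean_representation)
      also have "\<dots> = (\<Sum>b\<in>Basis. frechet_derivative g (at (f x)) ((w \<bullet> b) *\<^sub>R b))"
        by (rule linear_sum[OF l])
      also have "\<dots> = (\<Sum>b\<in>Basis. (w \<bullet> b) *\<^sub>R frechet_derivative g (at (f x)) b)"
        by (simp only: linear_scale[OF l])
      finally show "(\<Sum>b\<in>Basis. (frechet_derivative f (at x) v \<bullet> b) *\<^sub>R frechet_derivative g (at (f x)) b)
        = frechet_derivative g (at (f x)) (frechet_derivative f (at x) v)"
        by (simp only: w_def)
    qed
  qed
qed

section \<open>A defining function for a smooth hypersurface\<close>

text \<open>Mean value inequality for \<open>f\<close> minus its linearisation at \<open>a\<close>.
  Continuity of the derivative is known one direction at a time; the finite sum
  \<open>\<omega>\<close> over \<open>Basis\<close> turns it into smallness in operator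
  norm.\<close>

lemma C1_strict_derivative:
  fixes f :: "'a::euclidean_space \<Rightarrow> 'b::euclidean_space"
  assumes f: "Ck_on 1 S f" and S: "open S" "a \<in> S" and e: "0 < e"
  obtains r where "0 < r" "ball a r \<subseteq> S"
    "\<And>x y. x \<in> ball a r \<Longrightarrow> y \<in> ball a r \<Longrightarrow> norm (f x - f y - frechet_derivative f (at a) (x - y)) \<le> e * norm (x - y)"
proof -
  let ?D = "\<lambda>x. frechet_derivative f (at x)"
  have f': "Ck_on (Suc 0) S f" using f by simp
  have D: "(f has_derivative ?D x) (at x)" if "x \<in> S" for x using Ck_on_SucD(1)[OF f' that] .
  have c: "continuous_on S (\<lambda>x. ?D x v)" for v using Ck_on_SucD(2)[OF f', of v] by simp
  define \<omega> where "\<omega> x = (\<Sum>b\<in>Basis. norm (?D x b - ?D a b))" for x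
  have "continuous_on S \<omega>" unfolding \<omega>_def by (intro continuous_intros c)
  then have "isCont \<omega> a" using S continuous_on_eq_continuous_at by blast
  then have "(\<omega> \<longlongrightarrow> \<omega> a) (nhds a)" by (simp only: isCont_def tendsto_at_iff_tendsto_nhds)
  then have "\<forall>\<^sub>F x in nhds a. \<omega> x < e"
    by (rule order_tendstoD(2)) (use e in \<open>simp add: \<omega>_def\<close>)
  moreover have "\<forall>\<^sub>F x in nhds a. x \<in> S" using S by (intro eventually_nhds_in_open)
  ultimately have "\<forall>\<^sub>F x in nhds a. \<omega> x < e \<and> x \<in> S" by eventually_elim auto
  then obtain r where r: "0 < r" "\<And>x. x \<in> ball a r \<Longrightarrow> \<omega> x < e \<and> x \<in> S"
    unfolding eventually_nhds_metric by (auto simp: dist_commute)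
  have lin: "linear (?D x)" if "x \<in> S" for x using D[OF that] has_derivative_linear by blast
  have "norm ((f x - ?D a x) - (f y - ?D a y)) \<le> e * norm (x - y)" if xy: "x \<in> ball a r" "y \<in> ball a r" for x y
  proof (rule differentiable_bound[where S = "ball a r" and f = "\<lambda>x. f x - ?D a x" and f' = "\<lambda>x v. ?D x v - ?D a v"])
    fix x assume x: "x \<in> ball a r"
    have "(f has_derivative ?D x) (at x within ball a r)"
      by (rule has_derivative_at_withinI) (use D[of x] r(2)[OF x] in auto)
    moreover have "(?D a has_derivative ?D a) (at x within ball a r)"
      using has_derivative_bounded_linear[OF D[OF S(2)]] by (rule bounded_linear_imp_has_derivative)
    ultimately show "((\<lambda>x. f x - ?D a x) has_derivative (\<lambda>v. ?D x v - ?D a v)) (at x within ball a r)"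
      by (rule has_derivative_diff)
    show "onorm (\<lambda>v. ?D x v - ?D a v) \<le> e"
    proof (rule onorm_le)
      fix v
      have l: "linear (\<lambda>v. ?D x v - ?D a v)" using lin r x S by (intro linear_compose_sub) auto
      have "?D x v - ?D a v = (\<Sum>b\<in>Basis. (v \<bullet> b) *\<^sub>R (?D x b - ?D a b))"
      proof -
        have "?D x v - ?D a v = (\<lambda>v. ?D x v - ?D a v) (\<Sum>b\<in>Basis. (v \<bullet> b) *\<^sub>R b)"
          by (simp only: euclidean_representation)
        also have "\<dots> = (\<Sum>b\<in>Basis. (\<lambda>v. ?D x v - ?D a v) ((v \<bullet> b) *\<^sub>R b))"
          by (rule linear_sum[OF l])
        also have "\<dots> = (\<Sum>b\<in>Basis. (v \<bullet> b) *\<^sub>R (?D x b - ?D a b))"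
          by (simp only: linear_scale[OF l])
        finally show ?thesis .
      qed
      also have "norm \<dots> \<le> (\<Sum>b\<in>Basis. norm v * norm (?D x b - ?D a b))"
        by (rule sum_norm_le) (auto intro!: mult_right_mono simp: Basis_le_norm)
      also have "\<dots> = norm v * \<omega> x" by (simp add: \<omega>_def sum_distrib_left)
      also have "\<dots> \<le> norm v * e" using r(2)[OF x] by (intro mult_left_mono) auto
      finally show "norm (?D x v - ?D a v) \<le> e * norm v" by (simp add: mult.commute)
    qed
  qed (use xy in auto)
  moreover have "f x - f y - ?D a (x - y) = (f x - ?D a x) - (f y - ?D a y)" for x y
    by (simp add: linear_diff[OF lin[OF S(2)]])
  ultimately have "norm (f x - f y - ?D a (x - y)) \<le> e * norm (x - y)"
    if "x \<in> ball a r" "y \<in> ball a r" for x y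
    using that by metis
  then show thesis using r that by (meson subsetI)
qed

text \<open>The composition \<Psi> of the two smooth extensions acts near \<open>x0\<close> like a
  projection onto the chart, and \<open>G\<close> is the component of the displacement
  \<open>x - \<Psi> x\<close> along the normal \<open>n\<close> of the tangent space. Zeros of
  \<open>G\<close> lying in \<open>A\<close> is the inclusion that matters: it keeps the barrier
  nondegenerate off \<open>A\<close>.\<close>

lemma hypersurface_defining_function:
  fixes A :: "(real ^ 'p) set" and \<phi> :: "real ^ 'p \<Rightarrow> real ^ 'd"
  assumes card: "CARD('p) = CARD('d) + 1" and x0: "x0 \<in> A" and r0: "0 < r0"
    and V: "V = ball x0 r0 \<inter> A" and inj: "inj_on \<phi> V" and \<phi>: "Cinf_on V \<phi>"
    and op: "open (\<phi> ` V)" and inv: "Cinf_on (\<phi> ` V) (inv_into V \<phi>)"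
  obtains U G where "open U" "x0 \<in> U" "\<And>n. Ck_on n U G" "G x0 = (0::real)"
    "\<exists>v. frechet_derivative G (at x0) v \<noteq> 0" "\<And>x. x \<in> U \<Longrightarrow> G x = 0 \<Longrightarrow> x \<in> A"
proof -
  have xV: "x0 \<in> V" using x0 r0 V by simp
  define z0 where "z0 = \<phi> x0"
  have z0: "z0 \<in> \<phi> ` V" using xV by (simp add: z0_def)
  obtain U1 \<Phi> where U1: "open U1" "x0 \<in> U1" and \<Phi>: "\<And>n. Ck_on n U1 \<Phi>" "\<And>y. y \<in> V \<inter> U1 \<Longrightarrow> \<Phi> y = \<phi> y"
    using \<phi>[unfolded Cinf_on_def, rule_format, OF xV] by auto
  from inv[unfolded Cinf_on_def, rule_format, OF z0] obtain O1 where
    "\<exists>\<psi>. open O1 \<and> z0 \<in> O1 \<and> (\<forall>n. Ck_on n O1 \<psi>) \<and> (\<forall>z\<in>\<phi> ` V \<inter> O1. \<psi> z = inv_into V \<phi> z)" ..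
  then obtain \<psi> where
    "open O1 \<and> z0 \<in> O1 \<and> (\<forall>n. Ck_on n O1 \<psi>) \<and> (\<forall>z\<in>\<phi> ` V \<inter> O1. \<psi> z = inv_into V \<phi> z)" ..
  then have O1: "open O1" "z0 \<in> O1" and \<psi>: "\<And>n. Ck_on n O1 \<psi>"
    "\<And>z. z \<in> \<phi> ` V \<inter> O1 \<Longrightarrow> \<psi> z = inv_into V \<phi> z"
    by auto
  \<comment> \<open>Openness of the chart image makes \<psi> the inverse chart on a full
    neighbourhood of \<open>z0\<close>, so the identity for \<Phi> after \<psi> can be
    differentiated there.\<close>
  define O2 where "O2 = O1 \<inter> \<phi> ` V"
  have \<psi>V: "\<psi> z \<in> V" "\<phi> (\<psi> z) = z" if "z \<in> O2" for z
    using that \<psi>(2)[of z] by (auto simp: O2_def inv_into_into f_inv_into_f)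
  have \<psi>z0: "\<psi> z0 = x0" using \<psi>(2)[of z0] z0 O1 inj xV by (simp add: z0_def)
  have \<Phi>x0: "\<Phi> x0 = z0" using \<Phi>(2) xV U1 by (simp add: z0_def)
  define O3 where "O3 = O2 \<inter> \<psi> -` U1"
  have O2: "open O2" "z0 \<in> O2" using O1 op z0 by (auto simp: O2_def)
  have \<psi>c: "Ck_on n O2 \<psi>" for n using Ck_on_subset[OF \<psi>(1)] by (auto simp: O2_def)
  have O3: "open O3" "z0 \<in> O3" unfolding O3_def
    using continuous_open_preimage[OF Ck_on_imp_continuous_on[OF \<psi>c] O2(1) U1(1)] O2 U1 \<psi>z0 by auto
  have \<Phi>\<psi>: "\<Phi> (\<psi> z) = z" if "z \<in> O3" for z
    using that \<psi>V[of z] \<Phi>(2)[of "\<psi> z"] by (auto simp: O3_def)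
  define U2 where "U2 = U1 \<inter> \<Phi> -` O3"
  have U2: "open U2" "x0 \<in> U2" unfolding U2_def
    using continuous_open_preimage[OF Ck_on_imp_continuous_on[OF \<Phi>(1)] U1(1) O3(1)] U1 O3 \<Phi>x0 by auto
  define L where "L = frechet_derivative \<Phi> (at x0)"
  define X where "X = frechet_derivative \<psi> (at z0)"
  have L: "(\<Phi> has_derivative L) (at x0)" unfolding L_def using Ck_on_SucD(1)[OF \<Phi>(1)] U1 by blast
  have X: "(\<psi> has_derivative X) (at z0)" unfolding X_def using Ck_on_SucD(1)[OF \<psi>(1)] O1 by blast
  have linX: "linear X" and blX: "bounded_linear X" using X has_derivative_linear has_derivative_bounded_linear by blast+
  have LX: "L (X v) = v" for v
  proof -
    have L': "(\<Phi> has_derivative L) (at (\<psi> z0))" using L \<psi>z0 by simp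
    have "((\<lambda>z. \<Phi> (\<psi> z)) has_derivative (\<lambda>v. L (X v))) (at z0)"
      by (rule has_derivative_compose[OF X L'])
    then have "((\<lambda>z. z) has_derivative (\<lambda>v. L (X v))) (at z0)"
      by (rule has_derivative_transform_within_open[where f = "\<lambda>z. \<Phi> (\<psi> z)" and g = "\<lambda>z. z" and s = O3])
        (use O3 \<Phi>\<psi> in auto)
    then show ?thesis using has_derivative_unique[OF _ has_derivative_ident] by metis
  qed
  define T where "T = range X"
  have T: "subspace T" unfolding T_def using linX linear_subspace_image subspace_UNIV by blast
  have "inj X" by (metis LX injI)
  then have dimT: "dim T = CARD('d)"
    unfolding T_def using dim_image_eq[OF linX, of UNIV] by (simp add: inj_on_subset)
  obtain n where n0: "n \<noteq> 0" "\<And>v. v \<in> span T \<Longrightarrow> orthogonal n v"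
    by (rule orthogonal_to_subspace_exists[of T]) (use dimT card in auto)
  then have n: "n \<noteq> 0" "\<And>v. v \<in> T \<Longrightarrow> n \<bullet> v = 0" by (auto simp: orthogonal_def span_base)
  \<comment> \<open>Codimension one: \<open>T\<close> has the dimension of the hyperplane containing
    it.\<close>
  have T_eq: "T = {v. n \<bullet> v = 0}"
    using T n dimT card dim_hyperplane[OF n(1)] by (intro subspace_dim_equal subspace_hyperplane) auto
  have hyp: "X (L v) = v" if v: "n \<bullet> v = 0" for v
  proof -
    obtain w where "v = X w" using v T_eq unfolding T_def by blast
    then show ?thesis by (simp add: LX)
  qed
  obtain B where B: "0 < B" "\<And>v. norm (X v) \<le> norm v * B" using bounded_linear.pos_bounded[OF blX] by blast
  obtain r where r: "0 < r" "ball x0 r \<subseteq> U1" "\<And>x y. x \<in> ball x0 r \<Longrightarrow> y \<in> ball x0 r \<Longrightarrow>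
      norm (\<Phi> x - \<Phi> y - L (x - y)) \<le> 1 / (2 * B) * norm (x - y)"
    using C1_strict_derivative[OF \<Phi>(1) U1, of "1 / (2 * B)"] B unfolding L_def by (metis divide_pos_pos mult_pos_pos zero_less_numeral zero_less_one)
  define \<Psi> where "\<Psi> x = \<psi> (\<Phi> x)" for x
  have \<Psi>C: "Ck_on k U2 \<Psi>" for k unfolding \<Psi>_def
    by (rule Ck_on_compose[OF U2(1) _ Ck_on_subset[OF \<Phi>(1)] \<psi>c]) (auto simp: U2_def O3_def)
  define U where "U = (U2 \<inter> \<Psi> -` ball x0 r) \<inter> ball x0 r"
  have \<Psi>x0: "\<Psi> x0 = x0" by (simp add: \<Psi>_def \<Phi>x0 \<psi>z0)
  have U: "open U" "x0 \<in> U" unfolding U_def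
    using continuous_open_preimage[OF Ck_on_imp_continuous_on[OF \<Psi>C] U2(1), of "ball x0 r"] U2 r \<Psi>x0 by auto
  define G where "G x = n \<bullet> (x - \<Psi> x)" for x
  have GC: "Ck_on k U G" for k
  proof -
    have "Ck_on k U \<Psi>" by (rule Ck_on_subset[OF \<Psi>C]) (auto simp: U_def)
    then have "Ck_on k U (\<lambda>x. - \<Psi> x)"
      by (rule Ck_on_bounded_linear_compose[OF bounded_linear_minus[OF bounded_linear_ident] U(1)])
    from Ck_on_add[OF U(1) Ck_on_id[OF U(1)] this]
    have "Ck_on k U (\<lambda>x. n \<bullet> (x + - \<Psi> x))"
      by (rule Ck_on_bounded_linear_compose[OF bounded_linear_inner_right U(1)])
    then show ?thesis by (simp add: G_def[abs_def])
  qed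
  have "(\<Psi> has_derivative (\<lambda>v. X (L v))) (at x0)"
    unfolding \<Psi>_def using has_derivative_compose[OF L X[folded \<Phi>x0]] .
  then have "((\<lambda>x. x - \<Psi> x) has_derivative (\<lambda>v. v - X (L v))) (at x0)"
    by (rule has_derivative_diff[OF has_derivative_ident])
  from has_derivative_inner_right[OF this, of n]
  have GD: "(G has_derivative (\<lambda>v. n \<bullet> (v - X (L v)))) (at x0)" by (simp only: G_def[abs_def])
  have "frechet_derivative G (at x0) n = n \<bullet> (n - X (L n))"
    by (simp only: frechet_derivative_at[OF GD, symmetric])
  also have "\<dots> = n \<bullet> n" using n(2)[of "X (L n)"] by (simp add: T_def inner_diff_right)
  finally have grad: "frechet_derivative G (at x0) n \<noteq> 0" using n(1) by simp
  \<comment> \<open>At a zero of \<open>G\<close> the displacement is tangential, so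
    \<open>v = X (L v)\<close>. As \<Phi> agrees at \<open>x\<close> and \<open>\<Psi> x\<close>,
    \<open>L v\<close> is up to sign a pure linearisation error. The tolerance
    \<open>1 / (2 * B)\<close> was chosen to make its norm at most half of itself.\<close>
  have sub: "x \<in> A" if x: "x \<in> U" "G x = 0" for x
  proof -
    define v where "v = x - \<Psi> x"
    have Xv: "X (L v) = v" using hyp x(2) by (simp add: G_def v_def)
    have \<Phi>O: "\<Phi> x \<in> O3" using x by (auto simp: U_def U2_def)
    then have "\<Phi> (\<Psi> x) = \<Phi> x" using \<Phi>\<psi> by (simp add: \<Psi>_def)
    then have "norm (L v) \<le> 1 / (2 * B) * norm v"
      using r(3)[of x "\<Psi> x"] x by (auto simp: U_def v_def)
    also have "\<dots> \<le> 1 / (2 * B) * (norm (L v) * B)" using B Xv by (intro mult_left_mono) (metis, auto)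
    also have "\<dots> = norm (L v) / 2" using B by simp
    finally have "L v = 0" by simp
    then have "v = 0" using Xv linear_0[OF linX] by simp
    then have "x = \<psi> (\<Phi> x)" by (simp add: v_def \<Psi>_def)
    moreover have "\<psi> (\<Phi> x) \<in> V" using \<Phi>O \<psi>V by (auto simp: O3_def)
    ultimately show "x \<in> A" using V by auto
  qed
  have "G x0 = 0" by (simp add: G_def \<Psi>x0)
  moreover have "\<exists>v. frechet_derivative G (at x0) v \<noteq> 0" using grad by (rule exI[of _ n])
  ultimately show thesis by (rule that[OF U GC _ _ sub])
qed

section \<open>The barrier at a hypersurface\<close>

text \<open>\<open>F1\<close> and \<open>F2\<close> are the first two derivatives of the profile.
  The critical power cancels, and the other leaves a negative main term of order
  \<open>q powr (\<gamma> / 2 - 3/4)\<close>. The curvature errors and the Laplacian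
  \<open>2 * P\<close> of the quadratic term are smaller by a factor of order
  \<open>q powr (1/4)\<close>.\<close>

lemma hypersurface_barrier_inequality:
  fixes \<gamma> N0 N q E1 E2 K P :: real
  assumes \<gamma>: "0 < \<gamma>" "\<gamma> \<le> 1" and N: "0 < N0" "N0 \<le> N" and q: "0 < q" "q \<le> 1" and K: "0 \<le> K" "0 \<le> P"
    and E1: "\<bar>E1\<bar> \<le> K * q powr (1/2)" and E2: "\<bar>E2\<bar> \<le> K * q powr (3/2)"
    and small: "4 * (4 * K + 2 * P + 1) * q powr (1/4) \<le> N0"
    and F1: "F1 = \<gamma> / 2 * q powr (\<gamma> / 2 - 1) - (\<gamma> / 2 + 1/4) * q powr (\<gamma> / 2 + 1/4 - 1)"
    and F2: "F2 = \<gamma> / 2 * ((\<gamma> / 2 - 1) * q powr (\<gamma> / 2 - 2))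
       - (\<gamma> / 2 + 1/4) * ((\<gamma> / 2 + 1/4 - 1) * q powr (\<gamma> / 2 + 1/4 - 2))"
  shows "F1 * (2 * N + 2 * (1 - \<gamma>) * N + E1) + F2 * (4 * N * q + E2) + 2 * P < 0"
proof -
  define g where "g = \<gamma> / 2"
  define k where "k = g + 1/4"
  have g: "0 < g" "g \<le> 1/2" and k: "1/4 \<le> k" "k \<le> 3/4" using \<gamma> by (auto simp: g_def k_def)
  have F1': "F1 = g * q powr (g - 1) - k * q powr (k - 1)" by (simp add: F1 g_def k_def)
  have F2': "F2 = g * ((g - 1) * q powr (g - 2)) - k * ((k - 1) * q powr (k - 2))"
    by (simp add: F2 g_def k_def)
  have pw: "q * q powr (e - 2) = q powr (e - 1)" for e using q by (simp add: powr_diff power2_eq_square)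
  have "F1 * (2 * N + 2 * (1 - \<gamma>) * N) + 4 * N * (q * F2) = - N * k * q powr (k - 1)"
  proof -
    have "q * F2 = g * ((g - 1) * (q * q powr (g - 2))) - k * ((k - 1) * (q * q powr (k - 2)))"
      by (simp add: F2' algebra_simps)
    then have "q * F2 = g * ((g - 1) * q powr (g - 1)) - k * ((k - 1) * q powr (k - 1))" by (simp only: pw)
    moreover have "\<gamma> = 2 * g" by (simp add: g_def)
    moreover have "k * 4 = 4 * g + 1" by (simp add: k_def)
    ultimately show ?thesis unfolding F1' by algebra
  qed
  then have main: "F1 * (2 * N + 2 * (1 - \<gamma>) * N + E1) + F2 * (4 * N * q + E2)
     = - N * k * q powr (k - 1) + (F1 * E1 + F2 * E2)"
    by (simp add: algebra_simps)
  have le: "q powr (k - 1) \<le> q powr (g - 1)" "q powr (k - 2) \<le> q powr (g - 2)"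
    using q by (auto intro!: powr_mono' simp: k_def)
  have "\<bar>F1\<bar> \<le> g * q powr (g - 1) + k * q powr (k - 1)"
    unfolding F1' by (rule order_trans[OF abs_triangle_ineq4]) (use g k in \<open>simp add: abs_mult\<close>)
  also have "\<dots> \<le> 1 * q powr (g - 1) + 1 * q powr (g - 1)" using g k le by (intro add_mono mult_mono) auto
  finally have F1b: "\<bar>F1\<bar> \<le> 2 * q powr (g - 1)" by simp
  have "\<bar>F2\<bar> \<le> g * (1 - g) * q powr (g - 2) + k * (1 - k) * q powr (k - 2)"
    unfolding F2' by (rule order_trans[OF abs_triangle_ineq4]) (use g k in \<open>simp add: abs_mult\<close>)
  also have "\<dots> \<le> 1 * q powr (g - 2) + 1 * q powr (g - 2)" using g k le
    by (intro add_mono mult_mono) (auto intro!: mult_le_one)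
  finally have F2b: "\<bar>F2\<bar> \<le> 2 * q powr (g - 2)" by simp
  have "F1 * E1 + F2 * E2 \<le> \<bar>F1\<bar> * \<bar>E1\<bar> + \<bar>F2\<bar> * \<bar>E2\<bar>"
    by (intro add_mono) (metis abs_ge_self abs_mult)+
  also have "\<dots> \<le> (2 * q powr (g - 1)) * (K * q powr (1/2)) + (2 * q powr (g - 2)) * (K * q powr (3/2))"
    by (intro add_mono mult_mono F1b F2b E1 E2) auto
  also have "\<dots> = 2 * K * (q powr (g - 1) * q powr (1/2)) + 2 * K * (q powr (g - 2) * q powr (3/2))"
    by (simp add: algebra_simps)
  also have "q powr (g - 1) * q powr (1/2) = q powr (k - 1) * q powr (1/4)"
    unfolding powr_add[symmetric] by (simp add: k_def algebra_simps)
  also have "q powr (g - 2) * q powr (3/2) = q powr (k - 1) * q powr (1/4)"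
    unfolding powr_add[symmetric] by (simp add: k_def algebra_simps)
  finally have err: "F1 * E1 + F2 * E2 \<le> 4 * K * (q powr (k - 1) * q powr (1/4))" by simp
  \<comment> \<open>The total exponent is \<open>\<gamma> / 2 - 1/2\<close>, nonpositive since
    \<open>\<gamma> \<le> 1\<close>. This is what allows a quadratic lateral term here, unlike in
    the full-dimensional case.\<close>
  have "1 \<le> q powr (k - 1) * q powr (1/4)"
  proof -
    have "q powr 0 \<le> q powr (k - 1) * q powr (1/4)"
      unfolding powr_add[symmetric] using q g by (intro powr_mono') (auto simp: k_def)
    then show ?thesis using q by simp
  qed
  then have "2 * P \<le> 2 * P * (q powr (k - 1) * q powr (1/4))" using K mult_left_mono[of 1 _ "2 * P"] by fastforce
  then have "F1 * (2 * N + 2 * (1 - \<gamma>) * N + E1) + F2 * (4 * N * q + E2) + 2 * P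
     \<le> - N * k * q powr (k - 1) + 4 * K * (q powr (k - 1) * q powr (1/4)) + 2 * P * (q powr (k - 1) * q powr (1/4))"
    using main err by linarith
  also have "\<dots> = q powr (k - 1) * ((4 * K + 2 * P) * q powr (1/4) - N * k)" by (simp add: algebra_simps)
  also have "\<dots> < 0"
  proof -
    have "N0 * (1/4) \<le> N * k" using N k by (intro mult_mono) auto
    moreover have "(4 * K + 2 * P) * q powr (1/4) < (4 * K + 2 * P + 1) * q powr (1/4)"
      using q by (intro mult_strict_right_mono) auto
    moreover have "4 * ((4 * K + 2 * P + 1) * q powr (1/4)) \<le> N0" using small by (simp only: mult.assoc)
    ultimately have "(4 * K + 2 * P) * q powr (1/4) - N * k < 0" by linarith
    then show ?thesis using q by (intro mult_pos_neg) auto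
  qed
  finally show ?thesis .
qed

section \<open>Partial derivatives and the squared gradient\<close>

definition pd :: "'p \<Rightarrow> (real ^ 'p \<Rightarrow> real) \<Rightarrow> real ^ 'p \<Rightarrow> real" where
  "pd i f x = frechet_derivative f (at x) (axis i 1)"

lemma Ck_on_pd: "Ck_on (Suc n) U f \<Longrightarrow> Ck_on n U (pd i f)"
  unfolding pd_def[abs_def] by (rule Ck_on_SucD(2))

lemma has_real_derivative_along_axis:
  assumes f: "Ck_on (Suc n) U f" and x: "x + u *\<^sub>R axis i 1 \<in> U"
  shows "((\<lambda>u. f (x + u *\<^sub>R axis i 1)) has_real_derivative pd i f (x + u *\<^sub>R axis i 1)) (at u)"
proof -
  let ?D = "frechet_derivative f (at (x + u *\<^sub>R axis i 1))"
  have D: "(f has_derivative ?D) (at (x + u *\<^sub>R axis i 1))" by (rule Ck_on_SucD(1)[OF f x])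
  have "((\<lambda>u. x + u *\<^sub>R axis i 1) has_derivative (\<lambda>h. h *\<^sub>R axis i (1::real))) (at u)"
    by (auto intro!: derivative_eq_intros)
  from has_derivative_compose[OF this D]
  have "((\<lambda>u. f (x + u *\<^sub>R axis i 1)) has_derivative (\<lambda>h. ?D (h *\<^sub>R axis i 1))) (at u)" .
  moreover have "(\<lambda>h. ?D (h *\<^sub>R axis i 1)) = (*) (pd i f (x + u *\<^sub>R axis i 1))"
    using linear_scale[OF has_derivative_linear[OF D]] by (auto simp: pd_def mult.commute)
  ultimately show ?thesis by (simp only: has_field_derivative_def)
qed

definition grad2 :: "(real ^ 'p \<Rightarrow> real) \<Rightarrow> real ^ 'p \<Rightarrow> real" where
  "grad2 G x = (\<Sum>j\<in>UNIV. (pd j G x) ^ 2)"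

lemma Ck_on_grad2:
  assumes "open U" "Ck_on (Suc n) U G"
  shows "Ck_on n U (grad2 G)"
  unfolding grad2_def[abs_def] power2_eq_square
  by (intro Ck_on_sum Ck_on_bounded_bilinear[OF bounded_bilinear_mult] Ck_on_pd assms)

text \<open>For a flat hypersurface, with \<open>G\<close> the signed distance, \<open>q = G x ^ 2 + t\<close> is the squared distance to
  it in the half-space and \<open>q powr (\<gamma> / 2)\<close> solves the equation. For a curved one the weight \<open>grad2 G\<close> on
  \<open>t\<close> leaves errors of relative order \<open>sqrt q\<close>, which the second power absorbs.\<close>

definition profile :: "real \<Rightarrow> real \<Rightarrow> real" where
  "profile \<gamma> q = q powr (\<gamma> / 2) - q powr (\<gamma> / 2 + 1/4)"

text \<open>The weight on \<open>t\<close> makes the leading coefficients of the second derivative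
  of the profile, \<open>4 * G x ^ 2 * N x\<close> from the gradient in \<open>x\<close> and
  \<open>4 * t * N x ^ 2\<close> from the \<open>t\<close>-direction, add up to
  \<open>4 * N x * q\<close>. What remains is \<open>E1\<close>, from the Laplacian of
  \<open>q\<close>, and \<open>E2\<close>, from its squared gradient.\<close>

lemma hypersurface_barrier_super:
  fixes G :: "real ^ 'p \<Rightarrow> real" and \<gamma> t M K1 N0 :: real and x x0 :: "real ^ 'p"
  assumes \<gamma>: "0 < \<gamma>" "\<gamma> \<le> 1" and U: "open U" "x \<in> U" and G: "Ck_on 3 U G" and t: "0 \<le> t"
    and q: "0 < q" "q \<le> 1" "q = G x ^ 2 + grad2 G x * t" and N: "0 < N0" "N0 \<le> grad2 G x"
    and K1: "\<bar>\<Sum>i\<in>UNIV. pd i (pd i G) x\<bar> \<le> K1" "\<bar>\<Sum>i\<in>UNIV. pd i (pd i (grad2 G)) x\<bar> \<le> K1"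
      "\<bar>\<Sum>i\<in>UNIV. pd i G x * pd i (grad2 G) x\<bar> \<le> K1" "(\<Sum>i\<in>UNIV. (pd i (grad2 G) x) ^ 2) \<le> K1"
    and K: "K = K1 * (2 + 5 / N0 + 1 / N0 ^ 2)"
    and small: "4 * (4 * K + 2 * CARD('p) + 1) * q powr (1/4) \<le> N0" and M: "0 < M"
  shows "\<exists>c>0. \<exists>h0>0. \<forall>h. 0 < h \<and> h < h0 \<longrightarrow>
    Dh (1 - \<gamma>) h (\<lambda>x t. M * (profile \<gamma> (G x ^ 2 + grad2 G x * t) + norm (x - x0) ^ 2)) x t \<le> - c * h ^ 2"
proof -
  define N where "N = grad2 G"
  define g where "g = \<gamma> / 2"
  define k where "k = \<gamma> / 2 + 1/4"
  define F1 where "F1 v = g * v powr (g - 1) - k * v powr (k - 1)" for v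
  define F2 where "F2 v = g * ((g - 1) * v powr (g - 2)) - k * ((k - 1) * v powr (k - 2))" for v
  have dF: "(profile \<gamma> has_real_derivative F1 v) (at v)" if "0 < v" for v
    unfolding profile_def[abs_def] F1_def g_def k_def using that by (auto intro!: derivative_eq_intros)
  have dF1: "(F1 has_real_derivative F2 v) (at v)" if "0 < v" for v
    unfolding F1_def[abs_def] F2_def using that by (auto intro!: derivative_eq_intros simp: algebra_simps)
  have G3: "Ck_on (Suc (Suc (Suc 0))) U G" using G by (simp only: numeral_3_eq_3)
  have N2: "Ck_on (Suc (Suc 0)) U N" unfolding N_def by (rule Ck_on_grad2[OF U(1) G3])
  have q': "q = G x ^ 2 + N x * t" using q by (simp add: N_def)
  have N0: "0 < N x" using N by (simp add: N_def)
  define z where "z = x - x0"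
  define y where "y i u = x + u *\<^sub>R axis i (1::real)" for i u
  define Q where "Q i u = G (y i u) ^ 2 + N (y i u) * t" for i u
  define dq where "dq i u = 2 * G (y i u) * pd i G (y i u) + pd i N (y i u) * t" for i u
  have y0: "y i 0 = x" for i by (simp add: y_def)
  have Q0: "Q i 0 = q" for i by (simp add: Q_def y0 q')
  have evU: "\<forall>\<^sub>F u in nhds 0. y i u \<in> U" for i
  proof -
    have "isCont (y i) 0" unfolding y_def by (intro continuous_intros)
    then have "(y i \<longlongrightarrow> y i 0) (nhds 0)" by (simp only: isCont_def tendsto_at_iff_tendsto_nhds)
    then show ?thesis using U by (intro topological_tendstoD) (auto simp: y0)
  qed
  have dQ: "(Q i has_real_derivative dq i u) (at u)" if "y i u \<in> U" for i u
    unfolding Q_def[abs_def] dq_def y_def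
    using has_real_derivative_along_axis[OF G3, of x u i] has_real_derivative_along_axis[OF N2, of x u i] that
    by (auto intro!: derivative_eq_intros simp: y_def)
  have evQ: "\<forall>\<^sub>F u in nhds 0. 0 < Q i u" for i
  proof -
    have "isCont (Q i) 0" using dQ[of i 0] U by (intro DERIV_isCont) (auto simp: y0)
    then have "(Q i \<longlongrightarrow> Q i 0) (nhds 0)" by (simp only: isCont_def tendsto_at_iff_tendsto_nhds)
    then show ?thesis by (rule order_tendstoD(1)) (simp only: Q0 q(1))
  qed
  define ddq where "ddq i = 2 * (pd i G x) ^ 2 + 2 * G x * pd i (pd i G) x + pd i (pd i N) x * t" for i
  have ddq: "(dq i has_real_derivative ddq i) (at 0)" for i
    unfolding dq_def[abs_def] ddq_def y_def
    using has_real_derivative_along_axis[OF G3, of x 0 i] has_real_derivative_along_axis[OF Ck_on_pd[OF G3], of x 0 i i]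
      has_real_derivative_along_axis[OF Ck_on_pd[OF N2], of x 0 i i] U
    by (auto intro!: derivative_eq_intros simp: power2_eq_square)
  have nx: "norm (y i u - x0) ^ 2 = norm z ^ 2 + (u^2 + 2 * u * z $ i)" for i u
  proof -
    have e: "y i u - x0 = z + u *\<^sub>R axis i 1" by (simp add: y_def z_def)
    show ?thesis unfolding e by (rule norm_add_axis_power2)
  qed
  define D2 where "D2 i = M * (F2 q * dq i 0 ^ 2 + F1 q * ddq i + 2)" for i
  define Qt where "Qt u = M * (F1 (G x ^ 2 + N x * (t + u)) * N x)" for u
  define Dtt where "Dtt = M * (F2 q * N x ^ 2)"
  define E1 where "E1 = 2 * G x * (\<Sum>i\<in>UNIV. pd i (pd i G) x) + t * (\<Sum>i\<in>UNIV. pd i (pd i N) x)"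
  define E2 where "E2 = 4 * G x * t * (\<Sum>i\<in>UNIV. pd i G x * pd i N x) + t ^ 2 * (\<Sum>i\<in>UNIV. (pd i N x) ^ 2)"
  \<comment> \<open>\<open>G x\<close> is of order \<open>r\<close> and \<open>t\<close> of order
    \<open>r ^ 2\<close>, so \<open>E1\<close> is of order \<open>r\<close> and \<open>E2\<close> of
    order \<open>r ^ 3\<close>. \<open>K\<close> is the sum of the constants of these two
    bounds.\<close>
  define r where "r = q powr (1/2)"
  have r: "0 < r" "r ^ 2 = q" using q by (auto simp: r_def powr_half_sqrt)
  have r1: "r \<le> 1" using q by (simp add: r_def powr_half_sqrt)
  have r3: "q powr (3/2) = r ^ 3"
    using q by (simp add: r_def powr_powr flip: powr_realpow)
  have Gr: "\<bar>G x\<bar> \<le> r"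
  proof -
    have "0 \<le> N x * t" using N0 t by simp
    then have "G x ^ 2 \<le> r ^ 2" using r q' by simp
    then have "\<bar>G x\<bar> \<le> \<bar>r\<bar>" by (simp only: abs_le_square_iff)
    then show ?thesis using r by simp
  qed
  have tr: "t \<le> r ^ 2 / N0"
  proof -
    have "N0 * t \<le> N x * t" using N t by (intro mult_right_mono) (auto simp: N_def)
    also have "\<dots> \<le> q" using q' by simp
    finally show ?thesis using r N by (simp add: field_simps)
  qed
  have K10: "0 \<le> K1" using K1(1) by linarith
  have E1b: "\<bar>E1\<bar> \<le> K * q powr (1/2)"
  proof -
    have "\<bar>E1\<bar> \<le> 2 * \<bar>G x\<bar> * \<bar>\<Sum>i\<in>UNIV. pd i (pd i G) x\<bar> + t * \<bar>\<Sum>i\<in>UNIV. pd i (pd i N) x\<bar>"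
      unfolding E1_def by (rule order_trans[OF abs_triangle_ineq]) (use t in \<open>simp add: abs_mult\<close>)
    also have "\<dots> \<le> 2 * r * K1 + r ^ 2 / N0 * K1"
      using Gr tr t r N K1 K10 by (intro add_mono mult_mono) (auto simp: N_def)
    also have "\<dots> \<le> 2 * r * K1 + r / N0 * K1"
      using r r1 N K10 by (intro add_mono mult_mono divide_right_mono) (auto simp: power2_eq_square mult_le_cancel_left1)
    also have "\<dots> \<le> K1 * (2 + 5 / N0 + 1 / N0 ^ 2) * r"
    proof -
      have "0 \<le> K1 * r * (4 / N0 + 1 / N0 ^ 2)" using K10 r N by (intro mult_nonneg_nonneg add_nonneg_nonneg) auto
      moreover have "K1 * (2 + 5 / N0 + 1 / N0 ^ 2) * r = 2 * r * K1 + r / N0 * K1 + K1 * r * (4 / N0 + 1 / N0 ^ 2)"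
        by (simp add: divide_inverse algebra_simps)
      ultimately show ?thesis by linarith
    qed
    finally show ?thesis by (simp add: K r_def)
  qed
  have E2b: "\<bar>E2\<bar> \<le> K * q powr (3/2)"
  proof -
    have "0 \<le> (\<Sum>i\<in>UNIV. (pd i N x) ^ 2)" by (intro sum_nonneg) auto
    then have "\<bar>E2\<bar> \<le> 4 * \<bar>G x\<bar> * t * \<bar>\<Sum>i\<in>UNIV. pd i G x * pd i N x\<bar> + t ^ 2 * (\<Sum>i\<in>UNIV. (pd i N x) ^ 2)"
      unfolding E2_def by (intro order_trans[OF abs_triangle_ineq]) (use t in \<open>simp add: abs_mult\<close>)
    also have "\<dots> \<le> 4 * r * (r ^ 2 / N0) * K1 + (r ^ 2 / N0) ^ 2 * K1"
    proof (rule add_mono)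
      have Gt: "\<bar>G x\<bar> * t \<le> r * (r ^ 2 / N0)" using Gr tr t r(1) by (intro mult_mono) auto
      have "\<bar>G x\<bar> * t * \<bar>\<Sum>i\<in>UNIV. pd i G x * pd i N x\<bar> \<le> r * (r ^ 2 / N0) * K1"
        by (rule mult_mono[OF Gt]) (use K1(3) N(1) r(1) in \<open>auto simp: N_def\<close>)
      then show "4 * \<bar>G x\<bar> * t * \<bar>\<Sum>i\<in>UNIV. pd i G x * pd i N x\<bar> \<le> 4 * r * (r ^ 2 / N0) * K1" by simp
      show "t ^ 2 * (\<Sum>i\<in>UNIV. (pd i N x) ^ 2) \<le> (r ^ 2 / N0) ^ 2 * K1"
      proof (rule mult_mono)
        show "t ^ 2 \<le> (r ^ 2 / N0) ^ 2" using tr t by (rule power_mono)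
        show "(\<Sum>i\<in>UNIV. (pd i N x) ^ 2) \<le> K1" using K1(4) by (simp only: N_def)
      qed (auto intro: sum_nonneg)
    qed
    also have "\<dots> = 4 * K1 / N0 * r ^ 3 + K1 / N0 ^ 2 * r ^ 4"
      by (simp add: power2_eq_square power3_eq_cube power4_eq_xxxx field_simps)
    also have "\<dots> \<le> 4 * K1 / N0 * r ^ 3 + K1 / N0 ^ 2 * r ^ 3"
      using r r1 N K10 by (intro add_mono mult_left_mono power_decreasing) auto
    also have "\<dots> \<le> K1 * (2 + 5 / N0 + 1 / N0 ^ 2) * r ^ 3"
    proof -
      have "0 \<le> K1 * r ^ 3 * (2 + 1 / N0)" using K10 r N by (intro mult_nonneg_nonneg add_nonneg_nonneg) auto
      moreover have "K1 * (2 + 5 / N0 + 1 / N0 ^ 2) * r ^ 3 =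
          4 * K1 / N0 * r ^ 3 + K1 / N0 ^ 2 * r ^ 3 + K1 * r ^ 3 * (2 + 1 / N0)"
        by (simp add: divide_inverse algebra_simps)
      ultimately show ?thesis by linarith
    qed
    finally show ?thesis by (simp add: K r3)
  qed
  have neg: "(\<Sum>i\<in>UNIV. D2 i) + 4 * t * Dtt + 2 * (1 - \<gamma>) * Qt 0 < 0"
  proof -
    have N_sum: "(\<Sum>i\<in>UNIV. (pd i G x) ^ 2) = N x" by (simp add: N_def grad2_def)
    have S1: "(\<Sum>i\<in>UNIV. ddq i) = 2 * N x + E1"
      unfolding ddq_def E1_def N_sum[symmetric]
      by (simp add: sum.distrib sum_distrib_left sum_distrib_right algebra_simps)
    have "(\<Sum>i\<in>UNIV. dq i 0 ^ 2) = (\<Sum>i\<in>UNIV. 4 * G x ^ 2 * (pd i G x) ^ 2 + 4 * G x * t * (pd i G x * pd i N x) + t ^ 2 * (pd i N x) ^ 2)"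
      by (intro sum.cong) (auto simp: dq_def y0 power2_eq_square algebra_simps)
    also have "\<dots> = 4 * G x ^ 2 * N x + E2"
      unfolding E2_def N_sum[symmetric] sum.distrib sum_distrib_left by simp
    finally have S2: "(\<Sum>i\<in>UNIV. dq i 0 ^ 2) = 4 * G x ^ 2 * N x + E2" .
    have "(\<Sum>i\<in>UNIV. D2 i) = M * (F2 q * (\<Sum>i\<in>UNIV. dq i 0 ^ 2) + F1 q * (\<Sum>i\<in>UNIV. ddq i) + 2 * CARD('p))"
      unfolding D2_def sum_distrib_left[symmetric] sum.distrib by simp
    then have "(\<Sum>i\<in>UNIV. D2 i) + 4 * t * Dtt + 2 * (1 - \<gamma>) * Qt 0 =
       M * (F2 q * (4 * G x ^ 2 * N x + E2) + F1 q * (2 * N x + E1) + 2 * CARD('p))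
       + 4 * t * (M * (F2 q * N x ^ 2)) + 2 * (1 - \<gamma>) * (M * (F1 q * N x))"
      unfolding S1 S2 Dtt_def Qt_def q' by simp
    also have "\<dots> = M * (F1 q * (2 * N x + 2 * (1 - \<gamma>) * N x + E1) + F2 q * (4 * N x * (G x ^ 2 + N x * t) + E2) + 2 * real CARD('p))"
      by (simp add: algebra_simps power2_eq_square)
    also have "\<dots> < 0"
    proof (rule mult_pos_neg[OF M])
      have "0 \<le> K" unfolding K using K10 N by (intro mult_nonneg_nonneg add_nonneg_nonneg) auto
      then show "F1 q * (2 * N x + 2 * (1 - \<gamma>) * N x + E1) + F2 q * (4 * N x * (G x ^ 2 + N x * t) + E2) + 2 * real CARD('p) < 0"
        unfolding q'[symmetric] using N small
        by (intro hypersurface_barrier_inequality[OF \<gamma> N(1) _ q(1,2) _ _ E1b E2b])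
          (auto simp: F1_def F2_def N_def g_def k_def)
    qed
    finally show ?thesis .
  qed
  show ?thesis
    unfolding N_def[symmetric]
  proof (rule Dh_le_of_derivatives[where ?D2.0 = D2 and Dtt = Dtt and Q = Qt
        and P = "\<lambda>i u. M * (F1 (Q i u) * dq i u + (2 * u + 2 * z $ i))"])
    fix i :: 'p
    show "\<forall>\<^sub>F u in nhds 0. ((\<lambda>u. M * (profile \<gamma> (G (x + u *\<^sub>R axis i 1) ^ 2 + N (x + u *\<^sub>R axis i 1) * t)
        + norm (x + u *\<^sub>R axis i 1 - x0) ^ 2)) has_real_derivative M * (F1 (Q i u) * dq i u + (2 * u + 2 * z $ i))) (at u)"
      using evU[of i] evQ[of i]
    proof eventually_elim
      case (elim u)
      have "((\<lambda>u. profile \<gamma> (Q i u)) has_real_derivative F1 (Q i u) * dq i u) (at u)"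
        by (rule DERIV_chain2[OF dF[OF elim(2)] dQ[OF elim(1)]])
      then have "((\<lambda>u. M * (profile \<gamma> (Q i u) + (norm z ^ 2 + (u^2 + 2 * u * z $ i)))) has_real_derivative
          M * (F1 (Q i u) * dq i u + (2 * u + 2 * z $ i))) (at u)"
        by (auto intro!: derivative_eq_intros)
      then show ?case unfolding nx[symmetric, of _ i] unfolding Q_def y_def .
    qed
    have "((\<lambda>u. F1 (Q i u)) has_real_derivative F2 q * dq i 0) (at 0)"
      using DERIV_chain2[of F1 "F2 q" "Q i" 0] dF1[OF q(1)] dQ[of i 0] U by (simp add: Q0 y0)
    then show "((\<lambda>u. M * (F1 (Q i u) * dq i u + (2 * u + 2 * z $ i))) has_real_derivative D2 i) (at 0)"
      unfolding D2_def using ddq[of i] by (auto intro!: derivative_eq_intros simp: Q0 power2_eq_square algebra_simps)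
  next
    define l where "l u = G x ^ 2 + N x * (t + u)" for u
    have l0: "l 0 = q" by (simp add: l_def q')
    have dl: "(l has_real_derivative N x) (at u)" for u
      unfolding l_def[abs_def] by (auto intro!: derivative_eq_intros)
    have "isCont l 0" by (rule DERIV_isCont[OF dl])
    then have "(l \<longlongrightarrow> l 0) (nhds 0)" by (simp only: isCont_def tendsto_at_iff_tendsto_nhds)
    then have "\<forall>\<^sub>F u in nhds 0. 0 < l u" by (rule order_tendstoD(1)) (simp only: l0 q(1))
    then show "\<forall>\<^sub>F u in nhds 0. ((\<lambda>u. M * (profile \<gamma> (G x ^ 2 + N x * (t + u)) + norm (x - x0) ^ 2)) has_real_derivative Qt u) (at u)"
      unfolding Qt_def l_def[symmetric]
    proof eventually_elim
      case (elim u)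
      have "((\<lambda>u. profile \<gamma> (l u)) has_real_derivative F1 (l u) * N x) (at u)"
        by (rule DERIV_chain2[OF dF[OF elim] dl])
      then show ?case by (auto intro!: derivative_eq_intros)
    qed
    have "((\<lambda>u. F1 (l u)) has_real_derivative F2 q * N x) (at 0)"
      using DERIV_chain2[of F1 "F2 q" l 0, OF _ dl] dF1[OF q(1)] by (simp add: l0)
    then show "(Qt has_real_derivative Dtt) (at 0)"
      unfolding Qt_def[abs_def] Dtt_def l_def[symmetric]
      by (auto intro!: derivative_eq_intros simp: power2_eq_square)
  qed (rule neg)
qed

lemma grad2_pos:
  assumes G: "Ck_on (Suc n) U G" "x \<in> U" and v: "frechet_derivative G (at x) v \<noteq> 0"
  shows "0 < grad2 G x"
proof -
  have l: "linear (frechet_derivative G (at x))"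
    using Ck_on_SucD(1)[OF G] by (rule has_derivative_linear)
  have "frechet_derivative G (at x) v = frechet_derivative G (at x) (\<Sum>i\<in>UNIV. v $ i *\<^sub>R axis i 1)"
    by (simp only: basis_expansion[of v, unfolded scalar_mult_eq_scaleR])
  also have "\<dots> = (\<Sum>i\<in>UNIV. v $ i * pd i G x)"
    by (simp add: linear_sum[OF l] linear_scale[OF l] pd_def)
  finally obtain i where "pd i G x \<noteq> 0" using v by (metis (no_types, lifting) mult_zero_right sum.neutral)
  then have "0 < (pd i G x) ^ 2" by simp
  also have "\<dots> \<le> grad2 G x" unfolding grad2_def by (rule member_le_sum) auto
  finally show ?thesis .
qed

lemma profile_bounds:
  assumes "0 < \<gamma>" "0 \<le> q" "q powr (1/4) \<le> 1/2"
  shows "q powr (\<gamma> / 2) / 2 \<le> profile \<gamma> q" "profile \<gamma> q \<le> q powr (\<gamma> / 2)"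
proof -
  have "q powr (\<gamma> / 2 + 1/4) = q powr (\<gamma> / 2) * q powr (1/4)" by (rule powr_add)
  also have "\<dots> \<le> q powr (\<gamma> / 2) * (1/2)" using assms by (intro mult_left_mono) auto
  finally show "q powr (\<gamma> / 2) / 2 \<le> profile \<gamma> q" by (simp add: profile_def)
qed (simp add: profile_def)

text \<open>Since \<open>G x0 = 0\<close>, the approximate squared distance in the barrier reduces
  at \<open>x0\<close> to \<open>grad2 G x0 * t\<close>, which yields the rate. All smallness
  conditions are met by shrinking the cylinder.\<close>

lemma vpot_gap_hypersurface:
  fixes \<mu> :: "(real ^ 'p) measure" and s w R1 :: real and G :: "real ^ 'p \<Rightarrow> real"
  assumes s: "0 < s" "real CARD('p) - 2 \<le> s" "s < real CARD('p) - 1"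
    and A: "compact A" and \<mu>: "fin_borel_measure_on A \<mu>" and w: "0 \<le> w"
    and R1: "0 < R1" and bottom: "\<And>x. x \<in> A \<Longrightarrow> dist x0 x < R1 \<Longrightarrow> ennreal w \<le> pot s \<mu> x 0"
    and U: "open U" "x0 \<in> U" and G: "Ck_on 3 U G" "G x0 = 0"
    and grad: "\<exists>v. frechet_derivative G (at x0) v \<noteq> 0" and GA: "\<And>x. x \<in> U \<Longrightarrow> G x = 0 \<Longrightarrow> x \<in> A"
  shows "\<exists>C T. 0 < T \<and> (\<forall>t. 0 < t \<and> t \<le> T \<longrightarrow> w \<le> vpot s \<mu> x0 t + C * t powr ((real CARD('p) - 1 - s) / 2))"
proof -
  define \<gamma> where "\<gamma> = real CARD('p) - 1 - s"
  have \<gamma>: "0 < \<gamma>" "\<gamma> \<le> 1" using s by (auto simp: \<gamma>_def)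
  define N where "N = grad2 G"
  have G3: "Ck_on (Suc (Suc (Suc 0))) U G" using G(1) by (simp only: numeral_3_eq_3)
  have N2: "Ck_on (Suc (Suc 0)) U N" unfolding N_def by (rule Ck_on_grad2[OF U(1) G3])
  have Gc: "continuous_on U G" and Nc: "continuous_on U N"
    using G(1) N2 Ck_on_imp_continuous_on by blast+
  define N0 where "N0 = N x0 / 2"
  have N0: "0 < N0" using grad grad2_pos[OF G3 U(2)] by (auto simp: N0_def N_def)
  have "open ((U \<inter> N -` {N0<..}) \<inter> ball x0 R1)"
    using continuous_open_preimage[OF Nc U(1)] by auto
  moreover have "x0 \<in> (U \<inter> N -` {N0<..}) \<inter> ball x0 R1" using U R1 N0 by (simp add: N0_def)
  ultimately obtain R2 where R2: "0 < R2" "cball x0 R2 \<subseteq> (U \<inter> N -` {N0<..}) \<inter> ball x0 R1"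
    using open_contains_cball by blast
  then have R2U: "cball x0 R2 \<subseteq> U" by auto
  \<comment> \<open>One continuous function whose maximum on the compact ball bounds every
    coefficient at once.\<close>
  define f where "f x = \<bar>\<Sum>i\<in>UNIV. pd i (pd i G) x\<bar> + \<bar>\<Sum>i\<in>UNIV. pd i (pd i N) x\<bar>
      + \<bar>\<Sum>i\<in>UNIV. pd i G x * pd i N x\<bar> + (\<Sum>i\<in>UNIV. (pd i N x) ^ 2) + N x" for x
  have pc: "continuous_on U (pd i (pd i G))" "continuous_on U (pd i (pd i N))"
    "continuous_on U (pd i G)" "continuous_on U (pd i N)" for i
    using Ck_on_imp_continuous_on[OF Ck_on_pd[OF Ck_on_pd[OF G3]]] Ck_on_imp_continuous_on[OF Ck_on_pd[OF Ck_on_pd[OF N2]]]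
      Ck_on_imp_continuous_on[OF Ck_on_pd[OF G3]] Ck_on_imp_continuous_on[OF Ck_on_pd[OF N2]] by auto
  have "continuous_on U f" unfolding f_def by (intro continuous_intros pc Nc)
  then have "continuous_on (cball x0 R2) f" using R2U continuous_on_subset by blast
  then obtain m where "\<forall>x\<in>cball x0 R2. f x \<le> f m"
    using continuous_attains_sup[OF compact_cball, of x0 R2 f] R2(1) by auto
  then have m: "\<And>x. x \<in> cball x0 R2 \<Longrightarrow> f x \<le> f m" by blast
  define K1 where "K1 = f m"
  have Npos: "0 \<le> N x" for x by (simp add: N_def grad2_def sum_nonneg)
  have sq: "0 \<le> (\<Sum>i\<in>UNIV. (pd i N x) ^ 2)" for x by (intro sum_nonneg) auto
  have K1: "\<bar>\<Sum>i\<in>UNIV. pd i (pd i G) x\<bar> \<le> K1" "\<bar>\<Sum>i\<in>UNIV. pd i (pd i N) x\<bar> \<le> K1"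
      "\<bar>\<Sum>i\<in>UNIV. pd i G x * pd i N x\<bar> \<le> K1" "(\<Sum>i\<in>UNIV. (pd i N x) ^ 2) \<le> K1" "N x \<le> K1"
    if "x \<in> cball x0 R2" for x
    using m[OF that] Npos[of x] sq[of x] unfolding K1_def f_def[of x] by linarith+
  have K10: "0 < K1" using K1(5)[of x0] N0 R2 by (simp add: N0_def)
  define K where "K = K1 * (2 + 5 / N0 + 1 / N0 ^ 2)"
  have K: "0 \<le> K" unfolding K_def using K10 N0 by (intro mult_nonneg_nonneg add_nonneg_nonneg) auto
  define P where "P = 4 * (4 * K + 2 * CARD('p) + 1)"
  have P: "0 < P" using K by (simp add: P_def)
  \<comment> \<open>The target for \<open>q powr (1/4)\<close>: the bound \<open>1/2\<close> keeps
    the profile comparable to \<open>q powr (\<gamma> / 2)\<close>, and \<open>N0 / P\<close> is the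
    smallness asked for by the supersolution.\<close>
  define \<epsilon> where "\<epsilon> = min (1/2) (N0 / P)"
  have "0 < \<epsilon>" using N0 P by (simp add: \<epsilon>_def)
  moreover have "\<epsilon> \<le> 1/2" unfolding \<epsilon>_def by (rule min.cobounded1)
  moreover have "\<epsilon> \<le> N0 / P" unfolding \<epsilon>_def by (rule min.cobounded2)
  ultimately have \<epsilon>: "0 < \<epsilon>" "\<epsilon> \<le> 1/2" "\<epsilon> \<le> N0 / P" .
  have \<epsilon>P: "P * \<epsilon> \<le> N0" using \<epsilon>(3) P by (simp add: field_simps)
  define q0 where "q0 = \<epsilon> ^ 4"
  have q0: "0 < q0" using \<epsilon> by (simp add: q0_def)
  have root: "q powr (1/4) \<le> \<epsilon>" if "0 \<le> q" "q \<le> q0" for q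
  proof -
    have "q powr (1/4) \<le> q0 powr (1/4)" using that by (intro powr_mono2) auto
    also have "q0 powr (1/4) = (\<epsilon> powr 4) powr (1/4)" using \<epsilon> by (simp add: q0_def)
    also have "\<dots> = \<epsilon>" using \<epsilon>(1) by (simp only: powr_powr) simp
    finally show ?thesis .
  qed
  have q1: "q0 \<le> 1" using \<epsilon> by (simp add: q0_def power_le_one)
  have "isCont G x0" using Gc U continuous_on_eq_continuous_at by blast
  then have "((\<lambda>x. G x ^ 2) \<longlongrightarrow> G x0 ^ 2) (nhds x0)"
    by (intro tendsto_power) (simp only: isCont_def tendsto_at_iff_tendsto_nhds)
  then have "\<forall>\<^sub>F x in nhds x0. G x ^ 2 < q0 / 2"
    by (rule order_tendstoD(2)) (use G q0 in simp)
  then obtain R3 where R3: "0 < R3" "\<And>x. dist x x0 < R3 \<Longrightarrow> G x ^ 2 < q0 / 2"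
    unfolding eventually_nhds_metric by blast
  define R where "R = min R2 (R3 / 2)"
  have R: "0 < R" "R \<le> R2" using R2 R3 by (auto simp: R_def)
  \<comment> \<open>Together with \<open>R3\<close> this keeps both summands of \<open>q x t\<close>
    below or at half of \<open>q0\<close> on the cylinder.\<close>
  define T where "T = q0 / (2 * K1)"
  have T: "0 < T" using q0 K10 by (simp add: T_def)
  define q where "q x t = G x ^ 2 + N x * t" for x t
  have in_R: "x \<in> cball x0 R2" "G x ^ 2 < q0 / 2" "x \<in> U" "N0 \<le> N x" "dist x0 x < R1" if "dist x0 x \<le> R" for x
  proof -
    show x: "x \<in> cball x0 R2" using that R by auto
    show "G x ^ 2 < q0 / 2" using R3 that by (auto simp: R_def dist_commute)
    show "x \<in> U" "N0 \<le> N x" "dist x0 x < R1" using R2(2) x by auto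
  qed
  have q_bd: "0 \<le> q x t" "q x t \<le> q0" "N0 * t \<le> q x t" if "dist x0 x \<le> R" "0 \<le> t" "t \<le> T" for x t
  proof -
    show "0 \<le> q x t" using Npos that by (simp add: q_def)
    have "N x * t \<le> K1 * T" using K1(5)[OF in_R(1)[OF that(1)]] K10 that by (intro mult_mono) auto
    then show "q x t \<le> q0" using in_R(2)[OF that(1)] K10 by (simp add: q_def T_def)
    show "N0 * t \<le> q x t" using in_R(4)[OF that(1)] that(2) by (simp add: q_def mult_right_mono add_increasing)
  qed
  define k where "k = (N0 * T) powr (\<gamma> / 2) / 2"
  have k: "0 < k" using N0 T by (simp add: k_def)
  define M where "M = max 1 (max (w / k) (w / R ^ 2))"
  have M: "0 < M" "w \<le> M * k" "w \<le> M * R ^ 2"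
    using k R by (auto simp: M_def less_max_iff_disj simp flip: pos_divide_le_eq)
  have prof: "q x t powr (\<gamma> / 2) / 2 \<le> profile \<gamma> (q x t)" "profile \<gamma> (q x t) \<le> q x t powr (\<gamma> / 2)" "0 \<le> profile \<gamma> (q x t)"
    if "dist x0 x \<le> R" "0 \<le> t" "t \<le> T" for x t
  proof -
    have "q x t powr (1/4) \<le> 1/2" using root[OF q_bd(1,2)[OF that]] \<epsilon> by linarith
    note b = profile_bounds[OF \<gamma>(1) q_bd(1)[OF that] this]
    show "q x t powr (\<gamma> / 2) / 2 \<le> profile \<gamma> (q x t)" "profile \<gamma> (q x t) \<le> q x t powr (\<gamma> / 2)" by (fact b)+
    have "0 \<le> q x t powr (\<gamma> / 2) / 2" by simp
    with b(1) show "0 \<le> profile \<gamma> (q x t)" by linarith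
  qed
  define b where "b x t = M * (profile \<gamma> (q x t) + norm (x - x0) ^ 2)" for x t
  have *: "w \<le> vpot s \<mu> x0 t + b x0 t" if t: "0 < t" "t \<le> T" for t
  proof (rule vpot_comparison[where R = R and T = T and A = A])
    show "1 - \<gamma> = s + 2 - real CARD('p)" "0 \<le> 1 - \<gamma>" using \<gamma> by (auto simp: \<gamma>_def)
    show "ennreal w \<le> pot s \<mu> x 0" if "x \<in> A" "dist x0 x \<le> R" for x using bottom in_R(5) that by blast
    show "continuous_on (cball x0 R \<times> {0..T}) (\<lambda>(x, t). b x t)"
    proof -
      have sub: "cball x0 R \<subseteq> U" using in_R(3) by auto
      have c1: "continuous_on (cball x0 R \<times> {0..T}) (\<lambda>p. G (fst p))"
        "continuous_on (cball x0 R \<times> {0..T}) (\<lambda>p. N (fst p))"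
        using continuous_on_subset[OF Gc sub] continuous_on_subset[OF Nc sub]
        by (auto intro!: continuous_on_compose2[of _ _ _ fst] continuous_on_fst continuous_on_id)
      have c2: "continuous_on (cball x0 R \<times> {0..T}) (\<lambda>p. q (fst p) (snd p))"
        unfolding q_def by (intro continuous_on_add continuous_on_power continuous_on_mult c1 continuous_on_snd continuous_on_id)
      have pw: "continuous_on (cball x0 R \<times> {0..T}) (\<lambda>p. q (fst p) (snd p) powr e)" if "0 < e" for e
        using that q_bd(1) by (intro continuous_on_powr' c2 continuous_on_const) auto
      show ?thesis
        unfolding b_def profile_def case_prod_unfold using \<gamma>
        by (intro continuous_on_mult continuous_on_const continuous_on_add continuous_on_diff
            continuous_on_power continuous_on_norm continuous_on_fst continuous_on_id pw) auto
    qed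
    show "0 \<le> b x t" if "dist x0 x \<le> R" "0 \<le> t" "t \<le> T" for x t
      unfolding b_def using M prof(3)[OF that] by simp
    show "w \<le> b x t" if x: "dist x0 x = R" and t: "0 \<le> t" "t \<le> T" for x t
    proof -
      have n: "norm (x - x0) = R" using x by (simp add: dist_norm norm_minus_commute)
      have "R ^ 2 \<le> profile \<gamma> (q x t) + norm (x - x0) ^ 2" using prof(3)[of x t] x t n by simp
      from mult_left_mono[OF this less_imp_le[OF M(1)]] show ?thesis using M(3) unfolding b_def by linarith
    qed
    show "w \<le> b x T" if x: "dist x0 x \<le> R" for x
    proof -
      have "(N0 * T) powr (\<gamma> / 2) \<le> q x T powr (\<gamma> / 2)"
        using q_bd(3)[OF x, of T] T N0 \<gamma> by (intro powr_mono2) auto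
      then have "k \<le> profile \<gamma> (q x T) + norm (x - x0) ^ 2"
        using prof(1)[OF x less_imp_le[OF T] order_refl] zero_le_power2[of "norm (x - x0)"]
        unfolding k_def by linarith
      from mult_left_mono[OF this less_imp_le[OF M(1)]] show ?thesis using M(2) unfolding b_def by linarith
    qed
    show "\<exists>c>0. \<exists>h0>0. \<forall>h. 0 < h \<and> h < h0 \<longrightarrow> Dh (1 - \<gamma>) h b x t \<le> - c * h ^ 2"
      if x: "dist x0 x < R" and t: "0 \<le> t" "t < T" and xt: "x \<notin> A \<or> 0 < t" for x t
    proof -
      have x': "dist x0 x \<le> R" and t': "t \<le> T" using x t by auto
      \<comment> \<open>The degenerate points are the zeros of \<open>G\<close> at height zero; they
        belong to \<open>A\<close> by \<open>GA\<close> and are excluded.\<close>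
      have pos: "0 < q x t"
      proof (cases "0 < t")
        case True
        then show ?thesis using q_bd(3)[OF x' t(1) t'] N0 mult_pos_pos[of N0 t] by linarith
      next
        case False
        then have "G x \<noteq> 0" using xt GA in_R(3)[OF x'] by auto
        then show ?thesis using False t by (simp add: q_def)
      qed
      have small: "4 * (4 * K + 2 * CARD('p) + 1) * q x t powr (1/4) \<le> N0"
        using mult_left_mono[OF root[OF q_bd(1,2)[OF x' t(1) t']] less_imp_le[OF P]] \<epsilon>P
        unfolding P_def by linarith
      show ?thesis
        using hypersurface_barrier_super[OF \<gamma> U(1) in_R(3)[OF x'] G(1) t(1) pos _ _ N0 _ _ _ _ _ K_def small M(1), of x0]
          K1(1-4)[OF in_R(1)[OF x']] in_R(4)[OF x'] q_bd(2)[OF x' t(1) t'] q1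
        unfolding b_def[abs_def] q_def N_def by simp
    qed
  qed (use s A \<mu> R t in auto)
  have "b x0 t \<le> (M * N x0 powr (\<gamma> / 2)) * t powr (\<gamma> / 2)" if "0 < t" "t \<le> T" for t
  proof -
    have "b x0 t \<le> M * q x0 t powr (\<gamma> / 2)"
      unfolding b_def using prof(2)[of x0 t] that R M by simp
    also have "q x0 t powr (\<gamma> / 2) = N x0 powr (\<gamma> / 2) * t powr (\<gamma> / 2)"
      using Npos[of x0] that by (simp add: q_def G powr_mult)
    finally show ?thesis by (simp add: mult.assoc)
  qed
  then have "w \<le> vpot s \<mu> x0 t + (M * N x0 powr (\<gamma> / 2)) * t powr (\<gamma> / 2)" if "0 < t" "t \<le> T" for t
    using *[OF that] that by force
  then show ?thesis using T unfolding \<gamma>_def by blast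
qed

section \<open>Upper regularity of the equilibrium measure\<close>

lemma Cinf_on_imp_continuous_on:
  assumes "Cinf_on S f"
  shows "continuous_on S f"
  unfolding continuous_on_eq_continuous_within
proof
  fix x assume x: "x \<in> S"
  from assms[unfolded Cinf_on_def, rule_format, OF x] obtain U where
    "\<exists>g. open U \<and> x \<in> U \<and> (\<forall>n. Ck_on n U g) \<and> (\<forall>y\<in>S \<inter> U. g y = f y)" ..
  then obtain g where g: "open U \<and> x \<in> U \<and> (\<forall>n. Ck_on n U g) \<and> (\<forall>y\<in>S \<inter> U. g y = f y)" ..
  then have "continuous_on U g" using Ck_on_imp_continuous_on by blast
  then have "isCont g x" using g continuous_on_eq_continuous_at by blast
  then have gc: "continuous (at x within S) g" by (rule continuous_at_imp_continuous_at_within)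
  obtain e where e: "0 < e" "ball x e \<subseteq> U" using g open_contains_ball by blast
  show "continuous (at x within S) f"
    by (rule continuous_transform_within[OF gc e(1) x]) (use g e(2) in \<open>auto simp: subset_iff dist_commute\<close>)
qed

text \<open>The target space has no isolated points, and the continuous inverse chart carries this
  back to \<open>x0\<close>. It supplies the nontriviality required by
  \<open>d_regular_at_potential_ge\<close>.\<close>

lemma smooth_chart_accumulation:
  fixes \<phi> :: "'a::metric_space \<Rightarrow> 'b::{perfect_space,metric_space}"
  assumes x0: "x0 \<in> V" and op: "open (\<phi> ` V)" and inv: "continuous_on (\<phi> ` V) (inv_into V \<phi>)"
    and inj: "inj_on \<phi> V" and r: "0 < r"
  shows "\<exists>y\<in>V \<inter> ball x0 r. y \<noteq> x0"
proof -
  let ?S = "\<phi> ` V \<inter> inv_into V \<phi> -` ball x0 r"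
  have "open ?S" using continuous_open_preimage[OF inv op] by simp
  moreover have "\<phi> x0 \<in> ?S" using x0 inj r by simp
  ultimately have "?S \<noteq> {\<phi> x0}" using not_open_singleton by metis
  then obtain z where z: "z \<in> ?S" "z \<noteq> \<phi> x0" using \<open>\<phi> x0 \<in> ?S\<close> by blast
  show ?thesis
  proof (rule bexI[of _ "inv_into V \<phi> z"])
    show "inv_into V \<phi> z \<in> V \<inter> ball x0 r" using z by (auto simp: inv_into_into)
    show "inv_into V \<phi> z \<noteq> x0" using z f_inv_into_f[of z \<phi> V] by auto
  qed
qed

text \<open>For \<open>r ^ 2 \<le> T\<close>, \<open>pot_gap\<close> and \<open>gap\<close> bound
  \<open>r powr (- s)\<close> times the mass of the ball by a multiple of
  \<open>r powr (d - s)\<close>. Larger radii are settled by the total mass \<open>1\<close>, hence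
  the second entry of \<open>c\<close>.\<close>

lemma upper_regular_of_vpot_gap:
  fixes \<mu> :: "(real ^ 'p) measure" and d :: nat and s w T C :: real
  assumes s: "0 < s" and \<mu>: "prob_measure_on A \<mu>" and w: "pot s \<mu> x0 0 \<le> ennreal w" "0 \<le> w"
    and T: "0 < T" and gap: "\<And>t. 0 < t \<Longrightarrow> t \<le> T \<Longrightarrow> w \<le> vpot s \<mu> x0 t + C * t powr ((d - s) / 2)"
  shows "\<exists>c::real. \<forall>r>0. measure \<mu> (ball x0 r) \<le> c * r ^ d"
proof -
  have f\<mu>: "fin_borel_measure_on A \<mu>" and mass: "emeasure \<mu> UNIV = 1"
    using \<mu> by (auto simp: prob_measure_on_def)
  have sm: "sets \<mu> = sets borel" and fin: "finite_measure \<mu>"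
    using f\<mu> by (auto simp: fin_borel_measure_on_def)
  interpret finite_measure \<mu> by fact
  have le1: "measure \<mu> X \<le> 1" for X
    using mass bounded_measure[of X] sets_eq_imp_space_eq[OF sm] by (simp add: measure_def)
  define c0 where "c0 = 1 - 2 powr (- s / 2)"
  have c0: "0 < c0" using s powr_less_mono[of "- s / 2" 0 2] by (simp add: c0_def)
  define c where "c = max (C / c0) (1 / sqrt T ^ d)"
  have "measure \<mu> (ball x0 r) \<le> c * r ^ d" if r: "0 < r" for r
  proof (cases "r ^ 2 \<le> T")
    case True
    have p: "pot s \<mu> x0 (r ^ 2) = ennreal (vpot s \<mu> x0 (r ^ 2))"
      by (rule pot_eq_vpot[OF s f\<mu>, of "r ^ 2"]) (use r in auto)
    have "ennreal (vpot s \<mu> x0 (r ^ 2) + c0 * r powr (- s) * measure \<mu> (ball x0 r)) \<le> ennreal w"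
      using order_trans[OF pot_gap[OF s r sm, of x0] w(1)] c0 vpot_nonneg[of s \<mu> x0 "r^2"]
      by (simp add: p emeasure_eq_measure c0_def ennreal_plus ennreal_mult)
    then have "vpot s \<mu> x0 (r ^ 2) + c0 * r powr (- s) * measure \<mu> (ball x0 r) \<le> w"
      using w by (simp add: ennreal_le_iff)
    also have "w \<le> vpot s \<mu> x0 (r ^ 2) + C * r powr (d - s)"
      using gap[of "r ^ 2"] r True power2_powr_half[OF r, of "s - d"] by (simp add: minus_divide_left)
    finally have "c0 * r powr (- s) * measure \<mu> (ball x0 r) \<le> C * r powr (d - s)" by simp
    also have "\<dots> = r powr (- s) * (C * r ^ d)"
      using r by (simp add: powr_diff powr_minus powr_realpow field_simps)
    finally have "c0 * measure \<mu> (ball x0 r) \<le> C * r ^ d" using r by (simp add: mult_ac)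
    then have "measure \<mu> (ball x0 r) \<le> C / c0 * r ^ d" using c0 by (simp add: field_simps)
    also have "\<dots> \<le> c * r ^ d" using r by (intro mult_right_mono) (auto simp: c_def)
    finally show ?thesis .
  next
    case False
    then have "sqrt T \<le> r" using r by (simp add: real_le_lsqrt)
    then have "sqrt T ^ d \<le> r ^ d" using T by (intro power_mono) auto
    then have "1 \<le> 1 / sqrt T ^ d * r ^ d" using T by (simp add: field_simps)
    also have "\<dots> \<le> c * r ^ d" using r by (intro mult_right_mono) (auto simp: c_def)
    finally show ?thesis using le1[of "ball x0 r"] by linarith
  qed
  then show ?thesis by blast
qed

theorem theorem2p7:
  fixes A :: "(real ^ 'p) set" and x0 :: "real ^ 'p" and \<mu> :: "(real ^ 'p) measure" and s :: real
  assumes "CARD('p) = CARD('d::finite) \<or> CARD('p) = CARD('d) + 1"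
    and "0 < s" and "real CARD('p) - 2 \<le> s" and "s < real CARD('d)"
    and "compact A" and "0 < riesz_capacity s A"
    and "equilibrium_measure s A \<mu>"
    and "x0 \<in> A" and "dCinf_smooth_at TYPE('d) A x0"
  shows "\<exists>c::real. \<forall>r>0. measure \<mu> (ball x0 r) \<le> c * r ^ CARD('d)"
proof -
  have s: "0 < s" "real CARD('p) - 2 \<le> s" "s < real CARD('d)" and A: "compact A" and eq: "equilibrium_measure s A \<mu>"
    and x0: "x0 \<in> A" by fact+
  have Ab: "A \<in> sets borel" using A by (simp add: borel_compact)
  have W: "wiener_const s A < \<infinity>"
    using \<open>0 < riesz_capacity s A\<close> unfolding riesz_capacity_def less_top[symmetric] infinity_ennreal_def
    by (intro notI) simp
  then obtain w where w: "wiener_const s A = ennreal w" "0 \<le> w" by (cases "wiener_const s A") auto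
  have p\<mu>: "prob_measure_on A \<mu>" using eq by (simp add: equilibrium_measure_def)
  then have f\<mu>: "fin_borel_measure_on A \<mu>" and mass: "emeasure \<mu> UNIV = 1" by (auto simp: prob_measure_on_def)
  obtain r0 and \<phi> :: "real ^ 'p \<Rightarrow> real ^ 'd" and V where r0: "0 < r0" and V: "V = ball x0 r0 \<inter> A"
    and inj: "inj_on \<phi> V" and \<phi>: "Cinf_on V \<phi>" and op: "open (\<phi> ` V)" and inv: "Cinf_on (\<phi> ` V) (inv_into V \<phi>)"
    and reg: "d_regular_at CARD('d) A x0"
    using \<open>dCinf_smooth_at TYPE('d) A x0\<close> unfolding dCinf_smooth_at_def Let_def by blast
  have xV: "x0 \<in> V" using x0 r0 V by simp
  have invc: "continuous_on (\<phi> ` V) (inv_into V \<phi>)" by (rule Cinf_on_imp_continuous_on[OF inv])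
  have acc: "\<exists>y\<in>A \<inter> ball x0 r. y \<noteq> x0" if "0 < r" for r
    using smooth_chart_accumulation[OF xV op invc inj that] V by blast
  obtain R where R: "0 < R" "\<And>x. x \<in> A \<Longrightarrow> dist x0 x < R \<Longrightarrow> ennreal w \<le> pot s \<mu> x 0"
    using d_regular_at_potential_ge[OF eq W s(1,3) reg acc] unfolding w(1) by metis
  have gap: "\<exists>C T. 0 < T \<and> (\<forall>t. 0 < t \<and> t \<le> T \<longrightarrow> w \<le> vpot s \<mu> x0 t + C * t powr ((CARD('d) - s) / 2))"
    using \<open>CARD('p) = CARD('d) \<or> CARD('p) = CARD('d) + 1\<close>
  proof
    assume card: "CARD('p) = CARD('d)"
    \<comment> \<open>Invariance of domain: with equal dimensions the inverse chart has an open
      image, so \<open>A\<close> contains a ball around \<open>x0\<close>.\<close>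
    have "open (inv_into V \<phi> ` (\<phi> ` V))"
      using card by (intro invariance_of_domain_gen[OF op invc]) (auto simp: inj_on_inv_into)
    then have "open V" using inj by simp
    then have "open (V \<inter> ball x0 R)" "x0 \<in> V \<inter> ball x0 R" using xV R by auto
    then obtain R' where R': "0 < R'" "cball x0 R' \<subseteq> V \<inter> ball x0 R" using open_contains_cball by blast
    have bot: "ennreal w \<le> pot s \<mu> x 0" if "dist x0 x \<le> R'" for x
    proof -
      have "x \<in> V \<inter> ball x0 R" using that R'(2) by (meson mem_cball subsetD)
      then show ?thesis using R(2)[of x] V by auto
    qed
    show ?thesis
      using vpot_gap_full_dimensional[OF s(1,2) _ A f\<mu> w(2) bot R'(1)] R' V card s by auto
  next
    assume card: "CARD('p) = CARD('d) + 1"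
    obtain U G where U: "open U" "x0 \<in> U" "\<And>n. Ck_on n U G" "G x0 = (0::real)"
      "\<exists>v. frechet_derivative G (at x0) v \<noteq> 0" "\<And>x. x \<in> U \<Longrightarrow> G x = 0 \<Longrightarrow> x \<in> A"
      by (rule hypersurface_defining_function[OF card x0 r0 V inj \<phi> op inv]) blast
    have e: "real CARD('d) - s = real CARD('p) - 1 - s" using card by simp
    show ?thesis unfolding e
      by (rule vpot_gap_hypersurface[OF s(1,2) _ A f\<mu> w(2) R(1) _ U(1,2) U(3) U(4,5)])
        (use s card R(2) U(6) in auto)
  qed
  show ?thesis
  \<comment> \<open>The upper bound on the potential holds at points of the support. Off the support
    small balls are null, and the total mass settles the others.\<close>
  proof (cases "\<exists>r>0. emeasure \<mu> (ball x0 r) = 0")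
    case True
    then obtain \<rho> where \<rho>: "0 < \<rho>" "emeasure \<mu> (ball x0 \<rho>) = 0" by blast
    have sm: "sets \<mu> = sets borel" and fin: "finite_measure \<mu>"
      using f\<mu> by (auto simp: fin_borel_measure_on_def)
    have "measure \<mu> (ball x0 r) \<le> (1 / \<rho> ^ CARD('d)) * r ^ CARD('d)" if r: "0 < r" for r
    proof (cases "r \<le> \<rho>")
      case True
      then have "emeasure \<mu> (ball x0 r) \<le> emeasure \<mu> (ball x0 \<rho>)" by (intro emeasure_mono) (auto simp: sm)
      then have "measure \<mu> (ball x0 r) = 0" using \<rho> by (simp add: measure_def)
      then show ?thesis using r \<rho> by simp
    next
      case False
      have "measure \<mu> (ball x0 r) \<le> 1"
        using mass finite_measure.bounded_measure[OF fin, of "ball x0 r"] sets_eq_imp_space_eq[OF sm] by (simp add: measure_def)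
      also have "1 \<le> (1 / \<rho> ^ CARD('d)) * r ^ CARD('d)"
        using False \<rho> power_mono[of \<rho> r "CARD('d)"] by (simp add: field_simps)
      finally show ?thesis .
    qed
    then show ?thesis by blast
  next
    case False
    then have "0 < emeasure \<mu> (ball x0 r)" if "0 < r" for r using that by (auto simp: zero_less_iff_neq_zero)
    then have "pot s \<mu> x0 0 \<le> ennreal w"
      using pot_equilibrium_le[OF eq Ab s(1) W] w(1) by simp
    then show ?thesis using gap upper_regular_of_vpot_gap[OF s(1) p\<mu> _ w(2)] by blast
  qed
qed

end
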